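(* Let $\Gamma\subset\mathbb{R}^2$ be a lattice and let $V=V(\Gamma)$ be its set of visible points. Then the natural autocorrelation $\gamma$ of $V$ exists and is supported on $\Gamma$, i.e. $\gamma=\sum_{\mathbf{a}\in\Gamma}w(\mathbf{a})\delta_{\mathbf{a}}$, and for each $\mathbf{a}\in\Gamma$ the weight of $\mathbf{a}$ is $$w(\mathbf{a})=\mathrm{dens}(\Gamma)\,\xi(2)\prod_{p\mid\mathrm{cont}(\mathbf{a})}\Bigl(1+\frac{1}{p^2-2}\Bigr),$$ with error term $O(1/\sqrt{R})$, that is, $$\Bigl|\,w(\mathbf{a})-\frac{1}{\pi R^2}\,\bigl|\{\mathbf{x}\in V\mid \mathbf{x}-\mathbf{a}\in V,\ |\mathbf{x}|<R,\ |\mathbf{x}-\mathbf{a}|<R\}\bigr|\,\Bigr|=O(1/\sqrt{R})\quad(R\to\infty),$$ where the implied constant depends on $\mathbf{a}$ as well as on $\Gamma$.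
   Context: A lattice in $\mathbb{R}^2$ is $\Gamma=\mathbb{Z}\mathbf{b}_1\oplus\mathbb{Z}\mathbf{b}_2$ with $\mathbf{b}_1,\mathbf{b}_2$ linearly independent; $\mathrm{dens}(\Gamma)=1/|\det(\mathbf{b}_1,\mathbf{b}_2)|$. For $\mathbf{x}\in\Gamma\setminus\{\mathbf{0}\}$, $\mathrm{cont}(\mathbf{x})=\max\{l\in\mathbb{Z}^+\mid\mathbf{x}\in l\Gamma\}$, and $\mathrm{cont}(\mathbf{0})=\infty$, with the convention that every prime divides $\infty$ (so for $\mathbf{a}=\mathbf{0}$ the product is over all primes). The set of visible points is $V(\Gamma)=\{\mathbf{x}\in\Gamma\mid\mathrm{cont}(\mathbf{x})=1\}$. The products run over primes $p$; $\xi(s)=\prod_p\bigl(1-\frac{2}{p^s}\bigr)$ for $\mathrm{Re}(s)>1$. The natural autocorrelation of a uniformly discrete set $S\subset\mathbb{R}^2$ is $$\gamma=\lim_{R\to\infty}\frac{1}{\pi R^2}\sum_{\mathbf{x},\mathbf{y}\in S,\ |\mathbf{x}|,|\mathbf{y}|<R}\delta_{\mathbf{x}-\mathbf{y}},$$ the limit taken in the weak*-topology on the space of tempered distributions (if it exists), where $\delta_{\mathbf{x}}$ is the Dirac distribution at $\mathbf{x}$. *)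

theory Defs
  imports
    "HOL-Analysis.Analysis"
    "HOL-Computational_Algebra.Primes"
    "HOL-Library.Landau_Symbols"
begin

section \<open>Planar lattices and visible points\<close>

text \<open>The condition \<open>b1 \<noteq> b2\<close> is needed because \<open>independent\<close> is a predicate on sets.\<close>

definition lattice_basis :: "real^2 \<Rightarrow> real^2 \<Rightarrow> (real^2) set \<Rightarrow> bool" where
  "lattice_basis b1 b2 \<Gamma> \<longleftrightarrow>
     b1 \<noteq> b2 \<and> independent {b1, b2} \<and>
     \<Gamma> = {of_int m *\<^sub>R b1 + of_int n *\<^sub>R b2 | m n :: int. True}"

definition is_lattice :: "(real^2) set \<Rightarrow> bool" where
  "is_lattice \<Gamma> \<longleftrightarrow> (\<exists>b1 b2. lattice_basis b1 b2 \<Gamma>)"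

text \<open>The description is well defined, see \<open>dens_eq\<close> below.\<close>

definition dens :: "(real^2) set \<Rightarrow> real" where
  "dens \<Gamma> = (THE d. \<exists>b1 b2. lattice_basis b1 b2 \<Gamma> \<and> d = 1 / \<bar>det (vector [b1, b2] :: real^2^2)\<bar>)"

definition cont :: "(real^2) set \<Rightarrow> real^2 \<Rightarrow> enat" where
  "cont \<Gamma> x =
     (if x = 0 then \<infinity> else enat (Max {l :: nat. l > 0 \<and> x \<in> (\<lambda>y. real l *\<^sub>R y) ` \<Gamma>}))"

definition visible_points :: "(real^2) set \<Rightarrow> (real^2) set" where
  "visible_points \<Gamma> = {x \<in> \<Gamma>. cont \<Gamma> x = 1}"

text \<open>
  Divisibility in the semiring \<open>enat\<close> extends divisibility on \<open>nat\<close> and already obeys the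
  convention that every prime divides \<open>\<infinity>\<close>.
\<close>

lemma enat_dvd_enat_iff: "enat m dvd enat n \<longleftrightarrow> m dvd n"
proof
  assume "enat m dvd enat n"
  then obtain k where k: "enat n = enat m * k" by (rule dvdE)
  show "m dvd n"
  proof (cases k)
    case (enat j)
    then show ?thesis using k by simp
  next
    case infinity
    then show ?thesis using k by (cases "m = 0") (auto simp: zero_enat_def)
  qed
next
  assume "m dvd n"
  then obtain j where "n = m * j" by (rule dvdE)
  then have "enat n = enat m * enat j" by simp
  then show "enat m dvd enat n" by (rule dvdI)
qed

lemma prime_dvd_infinity: "prime p \<Longrightarrow> enat p dvd \<infinity>"
  by (rule dvdI[of _ _ \<infinity>]) (auto simp: prime_gt_0_nat)

lemma lattice_basis_det_nz:
  assumes "lattice_basis b1 b2 \<Gamma>"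
  shows "det (vector [b1, b2] :: real^2^2) \<noteq> 0"
proof
  assume "det (vector [b1, b2] :: real^2^2) = 0"
  then have d: "b1$1 * b2$2 = b1$2 * b2$1" by (simp add: det_2)
  have ne: "b1 \<noteq> b2" and ind: "independent {b1, b2}"
    using assms by (auto simp: lattice_basis_def)
  have zero: "u = 0 \<and> v = 0" if "u *\<^sub>R b1 + v *\<^sub>R b2 = 0" for u v
  proof -
    define f where "f = (\<lambda>x. if x = b1 then u else v)"
    have "(\<Sum>x\<in>{b1, b2}. f x *\<^sub>R x) = 0" using that ne by (simp add: f_def)
    then have "\<forall>x\<in>{b1, b2}. f x = 0"
      using ind independent_explicit[of "{b1, b2}"] by blast
    then show ?thesis using ne by (auto simp: f_def)
  qed
  have "b2$1 *\<^sub>R b1 + (- b1$1) *\<^sub>R b2 = 0"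
    using d by (simp add: vec_eq_iff forall_2 algebra_simps)
  moreover have "b2$2 *\<^sub>R b1 + (- b1$2) *\<^sub>R b2 = 0"
    using d by (simp add: vec_eq_iff forall_2 algebra_simps)
  ultimately have "b2$1 = 0 \<and> - b1$1 = 0" "b2$2 = 0 \<and> - b1$2 = 0"
    by (blast dest: zero)+
  then have "b1 = b2" by (simp add: vec_eq_iff forall_2)
  then show False using ne by blast
qed

lemma lattice_basis_det_dvd:
  assumes "lattice_basis b1 b2 \<Gamma>" "c1 \<in> \<Gamma>" "c2 \<in> \<Gamma>"
  shows "\<exists>k :: int. det (vector [c1, c2] :: real^2^2) = of_int k * det (vector [b1, b2] :: real^2^2)"
proof -
  obtain m n m' n' :: int where
    c: "c1 = of_int m *\<^sub>R b1 + of_int n *\<^sub>R b2" "c2 = of_int m' *\<^sub>R b1 + of_int n' *\<^sub>R b2"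
    using assms unfolding lattice_basis_def by blast
  have "det (vector [c1, c2] :: real^2^2) =
          of_int (m * n' - n * m') * det (vector [b1, b2] :: real^2^2)"
    by (simp add: c det_2 algebra_simps)
  then show ?thesis by blast
qed

lemma lattice_basis_mem:
  assumes "lattice_basis b1 b2 \<Gamma>"
  shows "b1 \<in> \<Gamma>" "b2 \<in> \<Gamma>"
proof -
  have "b1 = of_int 1 *\<^sub>R b1 + of_int 0 *\<^sub>R b2" "b2 = of_int 0 *\<^sub>R b1 + of_int 1 *\<^sub>R b2" by simp_all
  then show "b1 \<in> \<Gamma>" "b2 \<in> \<Gamma>" using assms unfolding lattice_basis_def by blast+
qed

lemma dens_eq:
  assumes b: "lattice_basis b1 b2 \<Gamma>"
  shows "dens \<Gamma> = 1 / \<bar>det (vector [b1, b2] :: real^2^2)\<bar>"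
  unfolding dens_def
proof (rule the_equality)
  show "\<exists>c1 c2. lattice_basis c1 c2 \<Gamma> \<and>
          1 / \<bar>det (vector [b1, b2] :: real^2^2)\<bar> = 1 / \<bar>det (vector [c1, c2] :: real^2^2)\<bar>"
    using b by blast
next
  fix d assume "\<exists>c1 c2. lattice_basis c1 c2 \<Gamma> \<and> d = 1 / \<bar>det (vector [c1, c2] :: real^2^2)\<bar>"
  then obtain c1 c2 where c: "lattice_basis c1 c2 \<Gamma>"
    and d: "d = 1 / \<bar>det (vector [c1, c2] :: real^2^2)\<bar>" by blast
  define B where "B = det (vector [b1, b2] :: real^2^2)"
  define C where "C = det (vector [c1, c2] :: real^2^2)"
  obtain k where k: "C = of_int k * B"
    using lattice_basis_det_dvd[OF b lattice_basis_mem[OF c]] by (auto simp: B_def C_def)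
  obtain l where l: "B = of_int l * C"
    using lattice_basis_det_dvd[OF c lattice_basis_mem[OF b]] by (auto simp: B_def C_def)
  have "B \<noteq> 0" using lattice_basis_det_nz[OF b] by (simp add: B_def)
  moreover have "B = of_int (l * k) * B" by (metis k l mult.assoc of_int_mult)
  ultimately have "real_of_int (l * k) = 1" by simp
  then have "l * k = 1" by linarith
  then have "\<bar>k\<bar> = 1" by (auto simp: zmult_eq_1_iff)
  then have "\<bar>real_of_int k\<bar> = 1" by linarith
  then have "\<bar>C\<bar> = \<bar>B\<bar>" using k by (simp add: abs_mult)
  then show "d = 1 / \<bar>det (vector [b1, b2] :: real^2^2)\<bar>" using d by (simp add: B_def C_def)
qed


section \<open>Products over primes\<close>

definition prime_prod :: "(nat \<Rightarrow> bool) \<Rightarrow> (nat \<Rightarrow> 'a::{t2_space, comm_semiring_1}) \<Rightarrow> 'a" where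
  "prime_prod P f = (\<Prod>p. if prime p \<and> P p then f p else 1)"

text \<open>
  The type class covers both \<open>complex\<close> and \<open>real\<close>; only arguments with real part greater than
  \<open>1\<close> are meaningful.
\<close>

definition xi :: "'a::{ln, real_normed_field} \<Rightarrow> 'a" where
  "xi s = prime_prod (\<lambda>p. True) (\<lambda>p. 1 - 2 / of_nat p powr s)"


section \<open>Schwartz functions and tempered distributions\<close>

type_synonym 'n testfun = "real^'n \<Rightarrow> complex"

definition partial_deriv :: "'n::finite \<Rightarrow> 'n testfun \<Rightarrow> 'n testfun" where
  "partial_deriv i \<phi> x = frechet_derivative \<phi> (at x) (axis i 1)"

text \<open>A list of indices encodes an iterated partial derivative.\<close>

definition iter_deriv :: "'n::finite list \<Rightarrow> 'n testfun \<Rightarrow> 'n testfun" where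
  "iter_deriv is \<phi> = foldr partial_deriv is \<phi>"

text \<open>
  Differentiability of all iterated partial derivatives forces their continuity, so this is
  the class of infinitely differentiable functions.
\<close>

definition smooth :: "'n::finite testfun \<Rightarrow> bool" where
  "smooth \<phi> \<longleftrightarrow> (\<forall>is. iter_deriv is \<phi> differentiable_on UNIV)"

definition schwartz :: "'n::finite testfun set" where
  "schwartz = {\<phi>. smooth \<phi> \<and>
     (\<forall>k is. bdd_above (range (\<lambda>x. (1 + norm x) ^ k * norm (iter_deriv is \<phi> x))))}"

definition schwartz_seminorm :: "nat \<Rightarrow> 'n::finite list \<Rightarrow> 'n testfun \<Rightarrow> real" where
  "schwartz_seminorm k is \<phi> = (SUP x. (1 + norm x) ^ k * norm (iter_deriv is \<phi> x))"

definition schwartz_topology :: "'n::finite testfun topology" where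
  "schwartz_topology = topology_generated_by
     {{\<psi> \<in> schwartz. schwartz_seminorm k is (\<lambda>x. \<psi> x - \<phi> x) < \<epsilon>} | k is \<phi> \<epsilon>.
        \<phi> \<in> schwartz \<and> 0 < \<epsilon>}"

text \<open>
  Functionals are taken to be \<open>extensional\<close>, that is \<open>undefined\<close> off the Schwartz space, so
  that equality of tempered distributions is equality in HOL.
\<close>

definition tempered_distributions :: "('n::finite testfun \<Rightarrow> complex) set" where
  "tempered_distributions = {T \<in> extensional schwartz.
     (\<forall>\<phi>\<in>schwartz. \<forall>\<psi>\<in>schwartz. T (\<lambda>x. \<phi> x + \<psi> x) = T \<phi> + T \<psi>) \<and>
     (\<forall>c. \<forall>\<phi>\<in>schwartz. T (\<lambda>x. c * \<phi> x) = c * T \<phi>) \<and>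
     continuous_map schwartz_topology euclidean T}"

text \<open>
  The weak*-topology is the coarsest one making all evaluations continuous: the trace of the
  product topology.
\<close>

definition weak_star :: "('n::finite testfun \<Rightarrow> complex) topology" where
  "weak_star = subtopology (product_topology (\<lambda>_. euclidean) schwartz) tempered_distributions"

definition dirac :: "real^'n::finite \<Rightarrow> 'n testfun \<Rightarrow> complex" where
  "dirac a = (\<lambda>\<phi>\<in>schwartz. \<phi> a)"

text \<open>
  \<open>T\<close> is the sum of the \<open>w a\<close>-multiples of \<open>dirac a\<close> over \<open>a \<in> A\<close>, the (unordered) sum
  being convergent in the weak*-topology.
\<close>

definition is_dirac_comb ::
    "('n::finite testfun \<Rightarrow> complex) \<Rightarrow> (real^'n) set \<Rightarrow> (real^'n \<Rightarrow> real) \<Rightarrow> bool" where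
  "is_dirac_comb T A w \<longleftrightarrow>
     limitin weak_star (\<lambda>F. \<lambda>\<phi>\<in>schwartz. \<Sum>a\<in>F. of_real (w a) * dirac a \<phi>) T
       (finite_subsets_at_top A)"


section \<open>Natural autocorrelation\<close>

definition autocorrelation_approx :: "(real^2) set \<Rightarrow> real \<Rightarrow> 2 testfun \<Rightarrow> complex" where
  "autocorrelation_approx S R = (\<lambda>\<phi>\<in>schwartz.
     of_real (1 / (pi * R\<^sup>2)) *
     (\<Sum>(x, y) \<in> {(x, y). x \<in> S \<and> y \<in> S \<and> norm x < R \<and> norm y < R}. dirac (x - y) \<phi>))"

definition is_natural_autocorrelation ::
    "(real^2) set \<Rightarrow> (2 testfun \<Rightarrow> complex) \<Rightarrow> bool" where
  "is_natural_autocorrelation S \<gamma> \<longleftrightarrow>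
     uniform_discrete S \<and> limitin weak_star (autocorrelation_approx S) \<gamma> at_top"

end

theory Submission
  imports Defs "HOL-Computational_Algebra.Squarefree"
begin

text \<open>
  Write \<open>c x\<close> for the content of a lattice point \<open>x\<close>, the largest \<open>l\<close> with \<open>x \<in> l\<Gamma>\<close>. The coefficient
  of the point mass at \<open>a\<close> counts the points \<open>x\<close> of a disc of radius \<open>R\<close> for which no prime divides
  \<open>c x\<close> or \<open>c (x - a)\<close>. Detecting both conditions by the Moebius function turns the count into a
  sum of \<open>\<mu>(l) \<mu>(m)\<close> times the number of points \<open>x\<close> of the disc with \<open>l\<close> dividing \<open>c x\<close> and \<open>m\<close>
  dividing \<open>c (x - a)\<close>. By the Chinese remainder theorem these points form one residue class
  modulo \<open>lcm l m\<close> if \<open>gcd l m\<close> divides \<open>c a\<close>, and none exist otherwise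
  (\<open>lattice_chinese_remainder\<close>); tiling the plane by parallelograms shows that a residue class
  modulo \<open>L\<close> has \<open>\<pi> R\<^sup>2 dens \<Gamma> / L\<^sup>2 + O(R / L + 1)\<close> points in the disc (\<open>residue_class_count\<close>).

  Summing the error \<open>O(1)\<close> over all \<open>l\<close> and \<open>m\<close> up to a multiple of \<open>R\<close> would be of the order of
  the main term, so the two sums are treated differently. The sum over \<open>l\<close> is kept complete, which
  needs \<open>l\<close> only up to a multiple of \<open>R\<close>. The sum over \<open>m\<close> is cut at \<open>y\<close>: as the exact visibility
  of \<open>x\<close> is a factor bounded by 1, the cut costs at most the number of pairs of a point \<open>x \<noteq> a\<close>
  and a number \<open>m > y\<close> with \<open>x - a \<in> m\<Gamma>\<close>, which is \<open>O(R\<^sup>2 / y)\<close> because there are \<open>O(R\<^sup>2 / m\<^sup>2)\<close>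
  such \<open>x\<close> for each \<open>m\<close> (\<open>visible_pair_truncation\<close>). Only \<open>O(R y)\<close> summands remain, so their constant
  errors add up to \<open>O(R y)\<close>, and the terms \<open>R / L\<close> add up to \<open>O(R y + R \<surd>R)\<close>
  (\<open>truncated_count_asymptotic\<close>). The choice \<open>y = \<surd>R\<close> balances these errors and gives the relative error
  \<open>O(1 / \<surd>R)\<close>.

  The constant of the main term is the absolutely convergent double series of
  \<open>\<mu>(l) \<mu>(m) / (lcm l m)\<^sup>2\<close> over the pairs with \<open>gcd l m\<close> dividing \<open>c a\<close>. It factors into an Euler
  product (\<open>infsum_pair_density\<close>) whose factor at \<open>p\<close> is the proportion of lattice points that
  avoid the classes of \<open>0\<close> and \<open>a\<close> modulo \<open>p\<close>: this is \<open>1 - 2 / p\<^sup>2\<close>, or \<open>1 - 1 / p\<^sup>2\<close> if the two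
  classes coincide. For \<open>a = 0\<close> the second condition repeats the first and is dropped;
  expanding it as well would leave the greatest common divisors unbounded.

  The measures converge in the weak*-topology by dominated convergence. The coefficients are
  bounded uniformly in \<open>a\<close> and \<open>R\<close> and converge for each \<open>a\<close>, while a Schwartz function decays
  fast enough to be summable over the lattice (\<open>limitin_weighted_comb\<close>).
\<close>

section \<open>Lattice points in discs\<close>

definition lattice_coords :: "real^2 \<Rightarrow> real^2 \<Rightarrow> real^2 \<Rightarrow> real^2" where
  "lattice_coords b1 b2 v = v$1 *\<^sub>R b1 + v$2 *\<^sub>R b2"

lemma linear_lattice_coords: "linear (lattice_coords b1 b2)"
  by (rule linearI) (simp_all add: lattice_coords_def algebra_simps)

lemma det_lattice_coords:
  "det (matrix (lattice_coords b1 b2)) = det (vector [b1, b2] :: real^2^2)"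
  by (simp add: det_2 matrix_def lattice_coords_def axis_def algebra_simps)

text \<open>
  By Cramer's rule the coordinates of a vector depend linearly on it, so they are bounded by a
  multiple of its norm. Uniqueness of coordinates, discreteness of the lattice and convergence of
  series over it all come from this one estimate.
\<close>

lemma coords_le_norm:
  assumes "lattice_basis b1 b2 \<Gamma>"
  obtains \<kappa> where "\<kappa> > 0" "\<And>s t. \<kappa> * \<bar>s\<bar> \<le> norm (s *\<^sub>R b1 + t *\<^sub>R b2)"
    "\<And>s t. \<kappa> * \<bar>t\<bar> \<le> norm (s *\<^sub>R b1 + t *\<^sub>R b2)"
proof -
  define D where "D = det (vector [b1, b2] :: real^2^2)"
  define M where "M = 1 + \<bar>b1$1\<bar> + \<bar>b1$2\<bar> + \<bar>b2$1\<bar> + \<bar>b2$2\<bar>"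
  have D: "D \<noteq> 0" using lattice_basis_det_nz[OF assms] by (simp add: D_def)
  have M: "M > 0" by (simp add: M_def)
  have D_eq: "D = b1$1 * b2$2 - b1$2 * b2$1" by (simp add: D_def det_2)
  have bound: "\<bar>u * x$1 - v * x$2\<bar> \<le> M * norm x"
    if "\<bar>u\<bar> + \<bar>v\<bar> \<le> M" for u v :: real and x :: "real^2"
  proof -
    have "\<bar>u * x$1 - v * x$2\<bar> \<le> \<bar>u\<bar> * \<bar>x$1\<bar> + \<bar>v\<bar> * \<bar>x$2\<bar>"
      by (metis abs_mult abs_triangle_ineq4)
    also have "\<dots> \<le> \<bar>u\<bar> * norm x + \<bar>v\<bar> * norm x"
      by (intro add_mono mult_left_mono component_le_norm_cart) auto
    also have "\<dots> = (\<bar>u\<bar> + \<bar>v\<bar>) * norm x" by (simp add: algebra_simps)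
    also have "\<dots> \<le> M * norm x" using that by (rule mult_right_mono) simp
    finally show ?thesis .
  qed
  have s: "\<bar>D\<bar> / M * \<bar>s\<bar> \<le> norm (s *\<^sub>R b1 + t *\<^sub>R b2)" for s t
  proof -
    have "D * s = b2$2 * (s *\<^sub>R b1 + t *\<^sub>R b2)$1 - b2$1 * (s *\<^sub>R b1 + t *\<^sub>R b2)$2"
      by (simp add: D_eq algebra_simps)
    then have "\<bar>D * s\<bar> \<le> M * norm (s *\<^sub>R b1 + t *\<^sub>R b2)"
      by (simp only:) (rule bound, simp add: M_def)
    then show ?thesis using M by (simp add: field_simps abs_mult)
  qed
  have t: "\<bar>D\<bar> / M * \<bar>t\<bar> \<le> norm (s *\<^sub>R b1 + t *\<^sub>R b2)" for s t
  proof -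
    have "- (D * t) = b1$2 * (s *\<^sub>R b1 + t *\<^sub>R b2)$1 - b1$1 * (s *\<^sub>R b1 + t *\<^sub>R b2)$2"
      by (simp add: D_eq algebra_simps)
    then have "\<bar>- (D * t)\<bar> \<le> M * norm (s *\<^sub>R b1 + t *\<^sub>R b2)"
      by (simp only:) (rule bound, simp add: M_def)
    then show ?thesis using M by (simp add: field_simps abs_mult)
  qed
  show ?thesis using that[of "\<bar>D\<bar> / M"] D M s t by simp
qed

lemma lattice_add:
  assumes "is_lattice \<Gamma>" "x \<in> \<Gamma>" "y \<in> \<Gamma>"
  shows "x + y \<in> \<Gamma>"
proof -
  obtain b1 b2 where \<Gamma>: "\<Gamma> = {of_int m *\<^sub>R b1 + of_int n *\<^sub>R b2 | m n :: int. True}"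
    using assms(1) unfolding is_lattice_def lattice_basis_def by blast
  obtain m n m' n' :: int where "x = of_int m *\<^sub>R b1 + of_int n *\<^sub>R b2"
    "y = of_int m' *\<^sub>R b1 + of_int n' *\<^sub>R b2" using assms(2,3) unfolding \<Gamma> by blast
  then have "x + y = of_int (m + m') *\<^sub>R b1 + of_int (n + n') *\<^sub>R b2"
    by (simp add: algebra_simps)
  then show ?thesis unfolding \<Gamma> by blast
qed

lemma lattice_scale:
  assumes "is_lattice \<Gamma>" "x \<in> \<Gamma>"
  shows "of_int k *\<^sub>R x \<in> \<Gamma>"
proof -
  obtain b1 b2 where \<Gamma>: "\<Gamma> = {of_int m *\<^sub>R b1 + of_int n *\<^sub>R b2 | m n :: int. True}"
    using assms(1) unfolding is_lattice_def lattice_basis_def by blast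
  obtain m n :: int where "x = of_int m *\<^sub>R b1 + of_int n *\<^sub>R b2"
    using assms(2) unfolding \<Gamma> by blast
  then have "of_int k *\<^sub>R x = of_int (k * m) *\<^sub>R b1 + of_int (k * n) *\<^sub>R b2"
    by (simp add: algebra_simps)
  then show ?thesis unfolding \<Gamma> by blast
qed

lemma lattice_diff: "is_lattice \<Gamma> \<Longrightarrow> x \<in> \<Gamma> \<Longrightarrow> y \<in> \<Gamma> \<Longrightarrow> x - y \<in> \<Gamma>"
  using lattice_add[of \<Gamma> x "- y"] lattice_scale[of \<Gamma> y "-1"] by simp

lemma lattice_zero: "is_lattice \<Gamma> \<Longrightarrow> 0 \<in> \<Gamma>"
  using lattice_diff lattice_basis_mem unfolding is_lattice_def by (metis diff_self)

lemma lattice_min_norm: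
  assumes "is_lattice \<Gamma>"
  obtains \<mu> where "\<mu> > 0" "\<And>x. x \<in> \<Gamma> \<Longrightarrow> x \<noteq> 0 \<Longrightarrow> \<mu> \<le> norm x"
proof -
  obtain b1 b2 where b: "lattice_basis b1 b2 \<Gamma>" using assms unfolding is_lattice_def by blast
  obtain \<kappa> where k: "\<kappa> > 0" "\<And>s t. \<kappa> * \<bar>s\<bar> \<le> norm (s *\<^sub>R b1 + t *\<^sub>R b2)"
    "\<And>s t. \<kappa> * \<bar>t\<bar> \<le> norm (s *\<^sub>R b1 + t *\<^sub>R b2)" using coords_le_norm[OF b] by blast
  have "\<kappa> \<le> norm x" if x: "x \<in> \<Gamma>" "x \<noteq> 0" for x
  proof -
    obtain m n :: int where mn: "x = of_int m *\<^sub>R b1 + of_int n *\<^sub>R b2"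
      using x b unfolding lattice_basis_def by blast
    have "m \<noteq> 0 \<or> n \<noteq> 0" using x mn by auto
    then have "\<bar>of_int m :: real\<bar> \<ge> 1 \<or> \<bar>of_int n :: real\<bar> \<ge> 1" by linarith
    then show ?thesis
    proof
      assume "\<bar>of_int m :: real\<bar> \<ge> 1"
      then have "\<kappa> * 1 \<le> \<kappa> * \<bar>of_int m\<bar>" using k(1) by (intro mult_left_mono) auto
      then show ?thesis using k(2)[of "of_int m" "of_int n"] mn by simp
    next
      assume "\<bar>of_int n :: real\<bar> \<ge> 1"
      then have "\<kappa> * 1 \<le> \<kappa> * \<bar>of_int n\<bar>" using k(1) by (intro mult_left_mono) auto
      then show ?thesis using k(3)[of "of_int n" "of_int m"] mn by simp
    qed
  qed
  then show ?thesis using that k(1) by blast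
qed

lemma uniform_discrete_lattice:
  assumes "is_lattice \<Gamma>"
  shows "uniform_discrete \<Gamma>"
proof -
  obtain \<mu> where mu: "\<mu> > 0" "\<And>x. x \<in> \<Gamma> \<Longrightarrow> x \<noteq> 0 \<Longrightarrow> \<mu> \<le> norm x"
    using lattice_min_norm[OF assms] by blast
  show ?thesis unfolding uniform_discrete_def
  proof (intro exI[of _ \<mu>] conjI ballI impI mu(1))
    fix x y assume "x \<in> \<Gamma>" "y \<in> \<Gamma>" "dist x y < \<mu>"
    then show "x = y" using mu(2)[of "x - y"] lattice_diff[OF assms] by (force simp: dist_norm)
  qed
qed

lemma finite_lattice_ball:
  assumes "is_lattice \<Gamma>"
  shows "finite {x \<in> \<Gamma>. norm (x - q) < r}"
proof -
  have "finite {x \<in> \<Gamma>. norm x < r'}" for r'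
  proof -
    obtain b1 b2 where b: "lattice_basis b1 b2 \<Gamma>" using assms unfolding is_lattice_def by blast
    obtain \<kappa> where k: "\<kappa> > 0" "\<And>s t. \<kappa> * \<bar>s\<bar> \<le> norm (s *\<^sub>R b1 + t *\<^sub>R b2)"
      "\<And>s t. \<kappa> * \<bar>t\<bar> \<le> norm (s *\<^sub>R b1 + t *\<^sub>R b2)" using coords_le_norm[OF b] by blast
    define N where "N = \<lceil>r' / \<kappa>\<rceil>"
    have "{x \<in> \<Gamma>. norm x < r'} \<subseteq>
        (\<lambda>(m, n). of_int m *\<^sub>R b1 + of_int n *\<^sub>R b2) ` ({-N..N} \<times> {-N..N})"
    proof
      fix x assume x: "x \<in> {x \<in> \<Gamma>. norm x < r'}"
      then obtain m n :: int where mn: "x = of_int m *\<^sub>R b1 + of_int n *\<^sub>R b2"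
        using b unfolding lattice_basis_def by blast
      have "\<kappa> * \<bar>of_int m\<bar> < r'" "\<kappa> * \<bar>of_int n\<bar> < r'"
        using k(2)[of "of_int m" "of_int n"] k(3)[of "of_int n" "of_int m"] x mn by simp_all
      then have "\<bar>of_int m\<bar> \<le> r' / \<kappa>" "\<bar>of_int n\<bar> \<le> r' / \<kappa>"
        using k(1) by (simp_all add: field_simps)
      then have "\<bar>m\<bar> \<le> N" "\<bar>n\<bar> \<le> N" unfolding N_def by linarith+
      then show "x \<in> (\<lambda>(m, n). of_int m *\<^sub>R b1 + of_int n *\<^sub>R b2) ` ({-N..N} \<times> {-N..N})"
        using mn by force
    qed
    then show ?thesis by (rule finite_subset) simp
  qed
  then have "finite {x \<in> \<Gamma>. norm x < r + norm q}" .
  moreover have "norm x < r + norm q" if "norm (x - q) < r" for x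
    using that norm_triangle_ineq[of "x - q" q] by simp
  ultimately show ?thesis by (elim finite_subset[rotated]) auto
qed

text \<open>
  The translates of the fundamental parallelogram by lattice points tile the plane. With \<open>\<delta>\<close> a
  bound for the diameter of the parallelogram, the tiles based at the lattice points of a disc of
  radius \<open>r\<close> stay inside the concentric disc of radius \<open>r + \<delta>\<close> and cover the one of radius \<open>r - \<delta>\<close>;
  comparing areas gives the count. The bound is uniform in the centre because residue classes of
  the lattice will be rescaled to the whole lattice seen from a shifted centre.
\<close>

lemma lattice_count_disc:
  assumes "is_lattice \<Gamma>"
  obtains C where "C > 0" "\<And>q r. r \<ge> 0 \<Longrightarrow>
    \<bar>real (card {u \<in> \<Gamma>. norm (u - q) < r}) - pi * r\<^sup>2 * dens \<Gamma>\<bar> \<le> C * (r + 1)"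
proof -
  obtain b1 b2 where b: "lattice_basis b1 b2 \<Gamma>" using assms unfolding is_lattice_def by blast
  obtain \<kappa> where k: "\<kappa> > 0" "\<And>s t. \<kappa> * \<bar>s\<bar> \<le> norm (s *\<^sub>R b1 + t *\<^sub>R b2)"
    "\<And>s t. \<kappa> * \<bar>t\<bar> \<le> norm (s *\<^sub>R b1 + t *\<^sub>R b2)" using coords_le_norm[OF b] by blast
  define D where "D = \<bar>det (vector [b1, b2] :: real^2^2)\<bar>"
  have D: "D > 0" using lattice_basis_det_nz[OF b] by (simp add: D_def)
  have dens: "dens \<Gamma> = 1 / D" using dens_eq[OF b] by (simp add: D_def)
  define f where "f = lattice_coords b1 b2"
  define \<delta> where "\<delta> = norm b1 + norm b2"
  have \<delta>: "\<delta> \<ge> 0" by (simp add: \<delta>_def)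
  \<comment> \<open>Open tiles are disjoint and bound the count from above, closed tiles cover and bound it from below.\<close>
  define P where "P u = (+) u ` f ` box 0 1" for u
  define Q where "Q u = (+) u ` f ` cbox 0 1" for u
  have unit_cbox: "measure lebesgue (cbox 0 (1 :: real^2)) = 1"
    by (simp add: content_cbox_if_cart interval_eq_empty_cart)
  then have unit_box: "measure lebesgue (box 0 (1 :: real^2)) = 1"
    by (simp add: measure_lborel_box_eq measure_lborel_cbox_eq)
  have lin: "linear f" by (simp add: f_def linear_lattice_coords)
  have P_meas: "P u \<in> lmeasurable" "measure lebesgue (P u) = D" for u
    unfolding P_def using measurable_linear_image[OF lin, of "box 0 1"]
      measure_linear_image[OF lin, of "box 0 1"]
    by (auto simp: measurable_translation measure_translation D_def f_def det_lattice_coords unit_box unit_cbox)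
  have Q_meas: "Q u \<in> lmeasurable" "measure lebesgue (Q u) = D" for u
    unfolding Q_def using measurable_linear_image[OF lin, of "cbox 0 1"]
      measure_linear_image[OF lin, of "cbox 0 1"]
    by (auto simp: measurable_translation measure_translation D_def f_def det_lattice_coords unit_box unit_cbox)
  have f_small: "norm (f v) \<le> \<delta>" if "v \<in> cbox 0 1" for v
  proof -
    have v: "0 \<le> v$1" "v$1 \<le> 1" "0 \<le> v$2" "v$2 \<le> 1" using that by (auto simp: mem_box_cart)
    have "norm (f v) \<le> \<bar>v$1\<bar> * norm b1 + \<bar>v$2\<bar> * norm b2"
      unfolding f_def lattice_coords_def by (rule order.trans[OF norm_triangle_ineq]) simp
    also have "\<dots> \<le> 1 * norm b1 + 1 * norm b2" using v by (intro add_mono mult_right_mono) auto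
    finally show ?thesis by (simp add: \<delta>_def)
  qed
  have P_disj: "disjnt (P u) (P u')" if u: "u \<in> \<Gamma>" "u' \<in> \<Gamma>" "u \<noteq> u'" for u u'
  proof (rule ccontr)
    assume "\<not> disjnt (P u) (P u')"
    then obtain v v' where v: "v \<in> box 0 1" "v' \<in> box 0 1" "u + f v = u' + f v'"
      by (auto simp: P_def disjnt_def)
    obtain m n :: int where mn: "u = of_int m *\<^sub>R b1 + of_int n *\<^sub>R b2"
      using u b unfolding lattice_basis_def by blast
    obtain m' n' :: int where mn': "u' = of_int m' *\<^sub>R b1 + of_int n' *\<^sub>R b2"
      using u b unfolding lattice_basis_def by blast
    define i where "i = of_int m - of_int m' + v$1 - v'$1"
    define j where "j = of_int n - of_int n' + v$2 - v'$2"
    have "i *\<^sub>R b1 + j *\<^sub>R b2 = 0"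
      using v(3) by (simp add: i_def j_def mn mn' f_def lattice_coords_def algebra_simps)
    then have "\<kappa> * \<bar>i\<bar> \<le> 0" "\<kappa> * \<bar>j\<bar> \<le> 0" using k(2)[of i j] k(3)[of j i] by simp_all
    then have ij: "i = 0" "j = 0" using k(1) by (simp_all add: mult_le_0_iff)
    have "0 < v$1" "v$1 < 1" "0 < v$2" "v$2 < 1" "0 < v'$1" "v'$1 < 1" "0 < v'$2" "v'$2 < 1"
      using v(1,2) by (auto simp: mem_box_cart)
    then have "m = m'" "n = n'" using ij unfolding i_def j_def by linarith+
    then show False using u mn mn' by simp
  qed
  have Q_cover: "\<exists>u\<in>\<Gamma>. z \<in> Q u" for z
  proof -
    define E where "E = b1$1 * b2$2 - b1$2 * b2$1"
    define s where "s = (b2$2 * z$1 - b2$1 * z$2) / E"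
    define t where "t = (b1$1 * z$2 - b1$2 * z$1) / E"
    have E: "E \<noteq> 0" using lattice_basis_det_nz[OF b] by (simp add: E_def det_2)
    have "E *\<^sub>R z = (E * s) *\<^sub>R b1 + (E * t) *\<^sub>R b2" using E
      by (simp add: s_def t_def) (simp add: vec_eq_iff forall_2 E_def algebra_simps)
    then have "E *\<^sub>R z = E *\<^sub>R (s *\<^sub>R b1 + t *\<^sub>R b2)" by (simp add: algebra_simps)
    then have z: "z = s *\<^sub>R b1 + t *\<^sub>R b2" using E by (simp only: scaleR_cancel_left) simp
    define v :: "real^2" where "v = vector [frac s, frac t]"
    have "v \<in> cbox 0 1"
      by (auto simp: mem_box_cart forall_2 v_def frac_lt_1 less_imp_le)
    moreover have "of_int \<lfloor>s\<rfloor> *\<^sub>R b1 + of_int \<lfloor>t\<rfloor> *\<^sub>R b2 \<in> \<Gamma>"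
      using b unfolding lattice_basis_def by blast
    moreover have "z = (of_int \<lfloor>s\<rfloor> *\<^sub>R b1 + of_int \<lfloor>t\<rfloor> *\<^sub>R b2) + f v"
      unfolding z by (simp add: f_def lattice_coords_def v_def frac_def algebra_simps)
    ultimately show ?thesis unfolding Q_def by blast
  qed
  define C where "C = pi * (2 * \<delta> + \<delta>\<^sup>2 + 1) / D"
  have "C > 0" unfolding C_def using D \<delta> by (intro divide_pos_pos mult_pos_pos add_nonneg_pos) auto
  moreover have "\<bar>real (card {u \<in> \<Gamma>. norm (u - q) < r}) - pi * r\<^sup>2 * dens \<Gamma>\<bar> \<le> C * (r + 1)"
    if r: "r \<ge> 0" for q r
  proof -
    define U where "U = {u \<in> \<Gamma>. norm (u - q) < r}"
    have fin: "finite U" unfolding U_def by (rule finite_lattice_ball[OF assms])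
    have ball: "measure lebesgue (ball q s) = s\<^sup>2 * pi" if "s \<ge> 0" for s
      using circle_area[OF that, of q] by simp
    have "card U * D = (\<Sum>u\<in>U. measure lebesgue (P u))" by (simp add: P_meas)
    also have "\<dots> = measure lebesgue (\<Union>u\<in>U. P u)"
      by (rule measure_UNION'[symmetric]) (use fin P_meas P_disj in \<open>auto simp: pairwise_def U_def\<close>)
    also have "\<dots> \<le> measure lebesgue (ball q (r + \<delta>))"
    proof (rule measure_mono_fmeasurable)
      show "(\<Union>u\<in>U. P u) \<subseteq> ball q (r + \<delta>)"
      proof clarify
        fix u z assume u: "u \<in> U" "z \<in> P u"
        then obtain v where v: "v \<in> box 0 1" "z = u + f v" unfolding P_def by blast
        then have "norm (f v) \<le> \<delta>" using f_small box_subset_cbox by blast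
        then have "norm (z - q) < r + \<delta>"
          using u norm_triangle_ineq[of "u - q" "f v"] v(2) by (simp add: U_def algebra_simps)
        then show "z \<in> ball q (r + \<delta>)" by (simp add: dist_norm norm_minus_commute)
      qed
    qed (use fin P_meas in \<open>auto intro!: sets.finite_UN fmeasurableD\<close>)
    finally have up: "card U * D \<le> (r + \<delta>)\<^sup>2 * pi" using ball r \<delta> by simp
    have low: "pi * r\<^sup>2 - pi * (2 * \<delta> * r + \<delta>\<^sup>2) \<le> card U * D"
    proof (cases "r \<ge> \<delta>")
      case True
      have "(r - \<delta>)\<^sup>2 * pi = measure lebesgue (ball q (r - \<delta>))" using ball True by simp
      also have "\<dots> \<le> measure lebesgue (\<Union>u\<in>U. Q u)"
      proof (rule measure_mono_fmeasurable)
        show "ball q (r - \<delta>) \<subseteq> (\<Union>u\<in>U. Q u)"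
        proof
          fix z assume z: "z \<in> ball q (r - \<delta>)"
          obtain u v where u: "u \<in> \<Gamma>" "v \<in> cbox 0 1" "z = u + f v"
            using Q_cover[of z] unfolding Q_def by blast
          have "norm (u - q) \<le> norm (z - q) + norm (f v)"
            using norm_triangle_ineq4[of "z - q" "f v"] u(3) by (simp add: algebra_simps)
          then have "u \<in> U" using f_small[OF u(2)] z u(1)
            by (simp add: U_def dist_norm norm_minus_commute)
          then show "z \<in> (\<Union>u\<in>U. Q u)" using u unfolding Q_def by blast
        qed
        show "(\<Union>u\<in>U. Q u) \<in> lmeasurable"
          using fin Q_meas by (intro fmeasurable.finite_UN) auto
      qed simp
      also have "\<dots> \<le> (\<Sum>u\<in>U. measure lebesgue (Q u))"
        by (rule measure_UNION_le) (use fin Q_meas in \<open>auto intro!: fmeasurableD\<close>)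
      also have "\<dots> = card U * D" by (simp add: Q_meas)
      finally have "(r - \<delta>)\<^sup>2 * pi \<le> card U * D" .
      moreover have "(r - \<delta>)\<^sup>2 * pi = pi * r\<^sup>2 - pi * (2 * \<delta> * r + \<delta>\<^sup>2) + 2 * pi * \<delta>\<^sup>2"
        by (simp add: power2_eq_square algebra_simps)
      ultimately show ?thesis using zero_le_power2[of \<delta>] pi_gt_zero
        by (smt (verit) mult_nonneg_nonneg)
    next
      case False
      then have "pi * r\<^sup>2 \<le> pi * \<delta>\<^sup>2" using r by (intro mult_left_mono power_mono) auto
      then have "pi * r\<^sup>2 - pi * (2 * \<delta> * r + \<delta>\<^sup>2) \<le> 0"
        using mult_nonneg_nonneg[OF mult_nonneg_nonneg[OF pi_ge_zero \<delta>] r]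
        unfolding distrib_left by linarith
      also have "0 \<le> card U * D" using D by simp
      finally show ?thesis .
    qed
    have "\<bar>card U * D - pi * r\<^sup>2\<bar> \<le> pi * (2 * \<delta> * r + \<delta>\<^sup>2)"
      using up low by (simp add: abs_le_iff power2_eq_square algebra_simps)
    also have "\<dots> \<le> pi * ((2 * \<delta> + \<delta>\<^sup>2 + 1) * (r + 1))"
      using r \<delta> by (intro mult_left_mono) (auto simp: algebra_simps)
    finally have "\<bar>card U * D - pi * r\<^sup>2\<bar> / D \<le> pi * ((2 * \<delta> + \<delta>\<^sup>2 + 1) * (r + 1)) / D"
      using D by (intro divide_right_mono) auto
    moreover have "\<bar>card U * D - pi * r\<^sup>2\<bar> / D = \<bar>card U - pi * r\<^sup>2 * dens \<Gamma>\<bar>"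
    proof -
      have "\<bar>card U * D - pi * r\<^sup>2\<bar> / D = \<bar>(card U * D - pi * r\<^sup>2) / D\<bar>" using D by simp
      also have "(card U * D - pi * r\<^sup>2) / D = card U - pi * r\<^sup>2 * dens \<Gamma>"
        using D by (simp add: dens field_simps)
      finally show ?thesis .
    qed
    ultimately show ?thesis unfolding U_def C_def by simp
  qed
  ultimately show ?thesis using that by blast
qed

section \<open>Divisibility of lattice points\<close>

text \<open>
  The content of the origin is \<open>0\<close> rather than \<open>\<infinity>\<close>: since every number divides \<open>0\<close>,
  divisibility of the content by \<open>l\<close> then means membership in \<open>l\<Gamma>\<close> for all lattice points alike.
\<close>

definition lattice_content :: "(real^2) set \<Rightarrow> real^2 \<Rightarrow> nat" where
  "lattice_content \<Gamma> x = (case cont \<Gamma> x of enat n \<Rightarrow> n | \<infinity> \<Rightarrow> 0)"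

lemma lattice_coords_unique:
  assumes "lattice_basis b1 b2 \<Gamma>" "s *\<^sub>R b1 + t *\<^sub>R b2 = s' *\<^sub>R b1 + t' *\<^sub>R b2"
  shows "s = s'" "t = t'"
proof -
  obtain \<kappa> where k: "\<kappa> > 0" "\<And>s t. \<kappa> * \<bar>s\<bar> \<le> norm (s *\<^sub>R b1 + t *\<^sub>R b2)"
    "\<And>s t. \<kappa> * \<bar>t\<bar> \<le> norm (s *\<^sub>R b1 + t *\<^sub>R b2)" using coords_le_norm[OF assms(1)] by blast
  define i j where "i = s - s'" "j = t - t'"
  have "i *\<^sub>R b1 + j *\<^sub>R b2 = 0" using assms(2) by (simp add: i_j_def algebra_simps)
  then have "\<kappa> * \<bar>i\<bar> \<le> 0" "\<kappa> * \<bar>j\<bar> \<le> 0" using k(2)[of i j] k(3)[of j i] by simp_all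
  then show "s = s'" "t = t'" using k(1) by (simp_all add: mult_le_0_iff i_j_def)
qed

lemma multiple_iff_coords:
  assumes b: "lattice_basis b1 b2 \<Gamma>" and "l > 0"
  shows "of_int m *\<^sub>R b1 + of_int n *\<^sub>R b2 \<in> (\<lambda>y. real l *\<^sub>R y) ` \<Gamma> \<longleftrightarrow> int l dvd m \<and> int l dvd n"
proof
  assume "of_int m *\<^sub>R b1 + of_int n *\<^sub>R b2 \<in> (\<lambda>y. real l *\<^sub>R y) ` \<Gamma>"
  then obtain i j :: int where
    "of_int m *\<^sub>R b1 + of_int n *\<^sub>R b2 = real l *\<^sub>R (of_int i *\<^sub>R b1 + of_int j *\<^sub>R b2)"
    using b unfolding lattice_basis_def by blast
  then have "of_int m *\<^sub>R b1 + of_int n *\<^sub>R b2 =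
      of_int (int l * i) *\<^sub>R b1 + of_int (int l * j) *\<^sub>R b2" by (simp add: algebra_simps)
  from lattice_coords_unique[OF b this] show "int l dvd m \<and> int l dvd n"
    unfolding of_int_eq_iff by simp
next
  assume "int l dvd m \<and> int l dvd n"
  then obtain i j where ij: "m = int l * i" "n = int l * j" by (auto elim!: dvdE)
  have "of_int i *\<^sub>R b1 + of_int j *\<^sub>R b2 \<in> \<Gamma>" using b unfolding lattice_basis_def by blast
  moreover have "of_int m *\<^sub>R b1 + of_int n *\<^sub>R b2 = real l *\<^sub>R (of_int i *\<^sub>R b1 + of_int j *\<^sub>R b2)"
    by (simp add: ij algebra_simps)
  ultimately show "of_int m *\<^sub>R b1 + of_int n *\<^sub>R b2 \<in> (\<lambda>y. real l *\<^sub>R y) ` \<Gamma>" by blast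
qed

lemma dvd_nat_gcd_iff: "l dvd nat (gcd m n) \<longleftrightarrow> int l dvd m \<and> int l dvd n"
proof -
  have "l dvd nat (gcd m n) \<longleftrightarrow> int l dvd int (nat (gcd m n))" by (simp only: int_dvd_int_iff)
  then show ?thesis by simp
qed

lemma cont_coords:
  assumes b: "lattice_basis b1 b2 \<Gamma>" and x: "x = of_int m *\<^sub>R b1 + of_int n *\<^sub>R b2"
  shows "x \<noteq> 0 \<Longrightarrow> cont \<Gamma> x = enat (nat (gcd m n))" "lattice_content \<Gamma> x = nat (gcd m n)"
proof -
  have z: "x = 0 \<longleftrightarrow> gcd m n = 0"
    using lattice_coords_unique[OF b, of "of_int m" "of_int n" 0 0] x by auto
  show *: "cont \<Gamma> x = enat (nat (gcd m n))" if nz: "x \<noteq> 0"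
  proof -
    have g: "gcd m n > 0" using nz z by (simp add: order_less_le)
    have "{l. l > 0 \<and> x \<in> (\<lambda>y. real l *\<^sub>R y) ` \<Gamma>} = {l. l dvd nat (gcd m n)}"
    proof (rule Collect_cong)
      fix l show "l > 0 \<and> x \<in> (\<lambda>y. real l *\<^sub>R y) ` \<Gamma> \<longleftrightarrow> l dvd nat (gcd m n)"
        using g multiple_iff_coords[OF b, of l m n] x
        by (cases "l = 0") (simp_all add: dvd_nat_gcd_iff)
    qed
    moreover have "Max {l. l dvd nat (gcd m n)} = nat (gcd m n)"
      using g by (intro Max_eqI) (auto intro!: finite_divisors_nat dvd_imp_le)
    ultimately show ?thesis using nz by (simp add: cont_def)
  qed
  show "lattice_content \<Gamma> x = nat (gcd m n)"
  proof (cases "x = 0")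
    case True
    then show ?thesis using z by (simp add: lattice_content_def cont_def)
  next
    case False
    then show ?thesis using * by (simp add: lattice_content_def)
  qed
qed

lemma multiple_iff_content:
  assumes "is_lattice \<Gamma>" "x \<in> \<Gamma>" "l > 0"
  shows "l dvd lattice_content \<Gamma> x \<longleftrightarrow> (\<exists>y\<in>\<Gamma>. x = real l *\<^sub>R y)"
proof -
  obtain b1 b2 where b: "lattice_basis b1 b2 \<Gamma>" using assms unfolding is_lattice_def by blast
  then obtain m n :: int where x: "x = of_int m *\<^sub>R b1 + of_int n *\<^sub>R b2"
    using assms(2) unfolding lattice_basis_def by blast
  show ?thesis using multiple_iff_coords[OF b assms(3), of m n] cont_coords(2)[OF b x] x
    by (simp add: dvd_nat_gcd_iff image_iff)
qed

lemma cont_eq_content: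
  assumes "is_lattice \<Gamma>" "x \<in> \<Gamma>"
  shows "cont \<Gamma> x = (if x = 0 then \<infinity> else enat (lattice_content \<Gamma> x))"
    and "lattice_content \<Gamma> x = 0 \<longleftrightarrow> x = 0"
proof -
  obtain b1 b2 where b: "lattice_basis b1 b2 \<Gamma>" using assms unfolding is_lattice_def by blast
  then obtain m n :: int where x: "x = of_int m *\<^sub>R b1 + of_int n *\<^sub>R b2"
    using assms(2) unfolding lattice_basis_def by blast
  show "cont \<Gamma> x = (if x = 0 then \<infinity> else enat (lattice_content \<Gamma> x))"
    using cont_coords[OF b x] by (simp add: cont_def)
  show "lattice_content \<Gamma> x = 0 \<longleftrightarrow> x = 0"
    using cont_coords(2)[OF b x] lattice_coords_unique[OF b, of "of_int m" "of_int n" 0 0] x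
    by (auto simp: nat_eq_iff)
qed

lemma visible_iff:
  assumes "is_lattice \<Gamma>"
  shows "x \<in> visible_points \<Gamma> \<longleftrightarrow> x \<in> \<Gamma> \<and> lattice_content \<Gamma> x = 1"
  using cont_eq_content[OF assms, of x] by (auto simp: visible_points_def one_enat_def)

lemma dvd_cont_iff:
  assumes "is_lattice \<Gamma>" "x \<in> \<Gamma>" "prime p"
  shows "enat p dvd cont \<Gamma> x \<longleftrightarrow> p dvd lattice_content \<Gamma> x"
  using cont_eq_content[OF assms(1,2)] prime_dvd_infinity[OF assms(3)]
  by (auto simp: enat_dvd_enat_iff)

lemma dvd_content_add:
  assumes "is_lattice \<Gamma>" "x \<in> \<Gamma>" "y \<in> \<Gamma>" "l > 0"
    "l dvd lattice_content \<Gamma> x" "l dvd lattice_content \<Gamma> y"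
  shows "l dvd lattice_content \<Gamma> (x + y)"
proof -
  obtain u v where "u \<in> \<Gamma>" "v \<in> \<Gamma>" "x = real l *\<^sub>R u" "y = real l *\<^sub>R v"
    using assms multiple_iff_content by metis
  then have "u + v \<in> \<Gamma>" "x + y = real l *\<^sub>R (u + v)"
    using assms(1) by (auto simp: lattice_add algebra_simps)
  then show ?thesis using multiple_iff_content assms lattice_add by metis
qed

lemma dvd_content_scale:
  assumes "is_lattice \<Gamma>" "x \<in> \<Gamma>" "l > 0"
  shows "l dvd lattice_content \<Gamma> ((of_int k * real l) *\<^sub>R x)"
proof -
  have "(of_int k * real l) *\<^sub>R x = real l *\<^sub>R (of_int k *\<^sub>R x)" by (simp add: mult.commute)
  moreover have "(of_int k * real l) *\<^sub>R x \<in> \<Gamma>"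
    using lattice_scale[OF assms(1,2), of "k * int l"] by simp
  ultimately show ?thesis
    using multiple_iff_content[OF assms(1) _ assms(3)] lattice_scale[OF assms(1,2)] by metis
qed

lemma dvd_content_diff:
  assumes "is_lattice \<Gamma>" "x \<in> \<Gamma>" "y \<in> \<Gamma>" "l > 0"
    "l dvd lattice_content \<Gamma> x" "l dvd lattice_content \<Gamma> y"
  shows "l dvd lattice_content \<Gamma> (x - y)"
proof -
  obtain u v where "u \<in> \<Gamma>" "v \<in> \<Gamma>" "x = real l *\<^sub>R u" "y = real l *\<^sub>R v"
    using assms multiple_iff_content by metis
  then have "u - v \<in> \<Gamma>" "x - y = real l *\<^sub>R (u - v)"
    using assms(1) by (auto simp: lattice_diff algebra_simps)
  then show ?thesis using multiple_iff_content assms lattice_diff by metis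
qed

text \<open>
  If \<open>a = (gcd l m) a'\<close> and \<open>u l + v m = gcd l m\<close>, then \<open>c = u l a'\<close> lies in \<open>l\<Gamma>\<close> while
  \<open>c - a = - v m a'\<close> lies in \<open>m\<Gamma>\<close>. The two conditions on \<open>x\<close> therefore say that \<open>x - c\<close> lies in
  both \<open>l\<Gamma>\<close> and \<open>m\<Gamma>\<close>.
\<close>

lemma lattice_chinese_remainder:
  assumes lat: "is_lattice \<Gamma>" and a: "a \<in> \<Gamma>" and l: "l > 0" and m: "m > 0"
    and g: "gcd l m dvd lattice_content \<Gamma> a"
  obtains c where "c \<in> \<Gamma>" "\<And>x. x \<in> \<Gamma> \<Longrightarrow>
    l dvd lattice_content \<Gamma> x \<and> m dvd lattice_content \<Gamma> (x - a) \<longleftrightarrow>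
    lcm l m dvd lattice_content \<Gamma> (x - c)"
proof -
  have "gcd l m > 0" using l by simp
  then obtain a' where a': "a' \<in> \<Gamma>" "a = real (gcd l m) *\<^sub>R a'"
    using g multiple_iff_content[OF lat a] by blast
  obtain u v :: int where uv: "u * int l + v * int m = int (gcd l m)"
    using bezout_int[of "int l" "int m"] by auto
  define c where "c = (of_int u * real l) *\<^sub>R a'"
  have "real (gcd l m) = of_int (u * int l + v * int m)" using uv by simp
  then have ca: "c - a = (of_int (- v) * real m) *\<^sub>R a'"
    by (simp add: c_def a'(2) algebra_simps)
  have cG: "c \<in> \<Gamma>" using lattice_scale[OF lat a'(1), of "u * int l"] by (simp add: c_def)
  have lc: "l dvd lattice_content \<Gamma> c" unfolding c_def by (rule dvd_content_scale[OF lat a'(1) l])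
  have mc: "m dvd lattice_content \<Gamma> (c - a)" unfolding ca by (rule dvd_content_scale[OF lat a'(1) m])
  have "l dvd lattice_content \<Gamma> x \<and> m dvd lattice_content \<Gamma> (x - a) \<longleftrightarrow>
      lcm l m dvd lattice_content \<Gamma> (x - c)" if x: "x \<in> \<Gamma>" for x
  proof -
    have "l dvd lattice_content \<Gamma> x \<longleftrightarrow> l dvd lattice_content \<Gamma> (x - c)"
      using dvd_content_diff[OF lat x cG l _ lc]
        dvd_content_add[OF lat lattice_diff[OF lat x cG] cG l _ lc] by auto
    moreover have "m dvd lattice_content \<Gamma> (x - a) \<longleftrightarrow> m dvd lattice_content \<Gamma> (x - c)"
      using dvd_content_diff[OF lat lattice_diff[OF lat x a] lattice_diff[OF lat cG a] m _ mc]
        dvd_content_add[OF lat lattice_diff[OF lat x cG] lattice_diff[OF lat cG a] m _ mc] by auto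
    ultimately show ?thesis by simp
  qed
  with cG show ?thesis by (rule that)
qed

lemma gcd_dvd_content:
  assumes lat: "is_lattice \<Gamma>" and a: "a \<in> \<Gamma>" and x: "x \<in> \<Gamma>" and l: "l > 0"
    and "l dvd lattice_content \<Gamma> x" "m dvd lattice_content \<Gamma> (x - a)"
  shows "gcd l m dvd lattice_content \<Gamma> a"
proof -
  have "gcd l m > 0" using l by simp
  then have "gcd l m dvd lattice_content \<Gamma> (x - (x - a))"
    by (rule dvd_content_diff[OF lat x lattice_diff[OF lat x a]])
       (use assms(5,6) in \<open>auto intro: dvd_trans[OF gcd_dvd1] dvd_trans[OF gcd_dvd2]\<close>)
  then show ?thesis by simp
qed

text \<open>
  The points \<open>x = c + L u\<close> with \<open>norm x < R\<close> correspond to the lattice points \<open>u\<close> at distance less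
  than \<open>R / L\<close> from \<open>- c / L\<close>.
\<close>

lemma residue_class_count:
  assumes lat: "is_lattice \<Gamma>"
  obtains C where "C > 0" "\<And>c L R. c \<in> \<Gamma> \<Longrightarrow> L > 0 \<Longrightarrow> R \<ge> 0 \<Longrightarrow>
    \<bar>real (card {x \<in> \<Gamma>. norm x < R \<and> L dvd lattice_content \<Gamma> (x - c)})
       - pi * R\<^sup>2 * dens \<Gamma> / (real L)\<^sup>2\<bar> \<le> C * (R / real L + 1)"
proof -
  obtain C where C: "C > 0" "\<And>q r. r \<ge> 0 \<Longrightarrow>
    \<bar>real (card {u \<in> \<Gamma>. norm (u - q) < r}) - pi * r\<^sup>2 * dens \<Gamma>\<bar> \<le> C * (r + 1)"
    using lattice_count_disc[OF lat] by blast
  have "\<bar>real (card {x \<in> \<Gamma>. norm x < R \<and> L dvd lattice_content \<Gamma> (x - c)})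
       - pi * R\<^sup>2 * dens \<Gamma> / (real L)\<^sup>2\<bar> \<le> C * (R / real L + 1)"
    if c: "c \<in> \<Gamma>" and L: "L > 0" and R: "R \<ge> 0" for c L R
  proof -
    define q where "q = - (1 / real L) *\<^sub>R c"
    define h where "h u = c + real L *\<^sub>R u" for u :: "real^2"
    have "{x \<in> \<Gamma>. norm x < R \<and> L dvd lattice_content \<Gamma> (x - c)} =
        h ` {u \<in> \<Gamma>. norm (u - q) < R / real L}" (is "?X = h ` ?U")
    proof -
      have n: "norm (h u) < R \<longleftrightarrow> norm (u - q) < R / real L" for u
      proof -
        have "h u = real L *\<^sub>R (u - q)" using L by (simp add: h_def q_def algebra_simps)
        then have "norm (h u) = real L * norm (u - q)" by simp
        then show ?thesis using L by (simp add: field_simps)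
      qed
      have "x \<in> h ` ?U" if x: "x \<in> ?X" for x
      proof -
        obtain u where u: "u \<in> \<Gamma>" "x - c = real L *\<^sub>R u"
          using x multiple_iff_content[OF lat lattice_diff[OF lat _ c] L] by blast
        then have "x = h u" by (simp add: h_def algebra_simps)
        then show ?thesis using u n x by blast
      qed
      moreover have "h u \<in> ?X" if u: "u \<in> ?U" for u
      proof -
        have "real L *\<^sub>R u \<in> \<Gamma>" using lattice_scale[OF lat, of u "int L"] u by simp
        then show ?thesis
          using u n c lat multiple_iff_content[OF lat _ L, of "real L *\<^sub>R u"]
          by (auto simp: h_def lattice_add)
      qed
      ultimately show ?thesis by blast
    qed
    moreover have "inj_on h ?U" using L by (auto simp: h_def inj_on_def)
    ultimately have "card ?X = card ?U" by (simp add: card_image)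
    then show ?thesis using C(2)[of "R / real L" q] R by (simp add: power_divide)
  qed
  with C(1) show ?thesis by (rule that)
qed

text \<open>
  A nonzero point of \<open>l\<Gamma>\<close> has norm at least \<open>l\<close> times the minimal norm of the lattice. Hence
  either \<open>R / l\<close> is bounded below, and the boundary term of the count is dominated by the area
  term, or there is no point at all. Without the boundary term the bound can be summed over \<open>l\<close>.
\<close>

lemma short_multiple_count:
  assumes lat: "is_lattice \<Gamma>"
  obtains C where "C > 0" "\<And>l R. l > 0 \<Longrightarrow> R \<ge> 0 \<Longrightarrow>
    real (card {x \<in> \<Gamma>. x \<noteq> 0 \<and> norm x < R \<and> l dvd lattice_content \<Gamma> x}) \<le> C * (R / real l)\<^sup>2"
    "\<And>l x. l > 0 \<Longrightarrow> x \<in> \<Gamma> \<Longrightarrow> x \<noteq> 0 \<Longrightarrow> l dvd lattice_content \<Gamma> x \<Longrightarrow> real l \<le> C * norm x"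
proof -
  obtain C where C: "C > 0" "\<And>c L R. c \<in> \<Gamma> \<Longrightarrow> L > 0 \<Longrightarrow> R \<ge> 0 \<Longrightarrow>
    \<bar>real (card {x \<in> \<Gamma>. norm x < R \<and> L dvd lattice_content \<Gamma> (x - c)})
       - pi * R\<^sup>2 * dens \<Gamma> / (real L)\<^sup>2\<bar> \<le> C * (R / real L + 1)"
    using residue_class_count[OF lat] by blast
  obtain \<mu> where mu: "\<mu> > 0" "\<And>x. x \<in> \<Gamma> \<Longrightarrow> x \<noteq> 0 \<Longrightarrow> \<mu> \<le> norm x"
    using lattice_min_norm[OF lat] by blast
  have short: "\<mu> * real l \<le> norm x"
    if x: "l > 0" "x \<in> \<Gamma>" "x \<noteq> 0" "l dvd lattice_content \<Gamma> x" for l x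
  proof -
    obtain y where y: "y \<in> \<Gamma>" "x = real l *\<^sub>R y" using x multiple_iff_content[OF lat, of x l] by blast
    then show ?thesis using mu(2)[of y] x by (auto simp: mult.commute mult_left_mono)
  qed
  define K where "K = pi * \<bar>dens \<Gamma>\<bar> + C / \<mu> + C / \<mu>\<^sup>2"
  have K: "K \<ge> 0" unfolding K_def using C(1) mu(1) by (intro add_nonneg_nonneg) auto
  have count: "real (card {x \<in> \<Gamma>. x \<noteq> 0 \<and> norm x < R \<and> l dvd lattice_content \<Gamma> x}) \<le> K * (R / real l)\<^sup>2"
    if l: "l > 0" and R: "R \<ge> 0" for l R
  proof (cases "\<mu> < R / real l")
    case True
    define r where "r = R / real l"
    have r: "r > \<mu>" using True by (simp add: r_def)
    have "card {x \<in> \<Gamma>. x \<noteq> 0 \<and> norm x < R \<and> l dvd lattice_content \<Gamma> x} \<le>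
        card {x \<in> \<Gamma>. norm x < R \<and> l dvd lattice_content \<Gamma> (x - 0)}"
      by (intro card_mono finite_subset[OF _ finite_lattice_ball[OF lat, of 0 R]]) auto
    then have "real (card {x \<in> \<Gamma>. x \<noteq> 0 \<and> norm x < R \<and> l dvd lattice_content \<Gamma> x}) \<le>
        pi * r\<^sup>2 * dens \<Gamma> + C * (r + 1)"
      using C(2)[OF lattice_zero[OF lat] l R] by (simp add: r_def power_divide)
    also have "\<dots> \<le> pi * r\<^sup>2 * \<bar>dens \<Gamma>\<bar> + C * (r * (r / \<mu>) + (r / \<mu>)\<^sup>2)"
    proof (intro add_mono mult_left_mono)
      have 1: "1 \<le> r / \<mu>" using r mu(1) by simp
      then show "1 \<le> (r / \<mu>)\<^sup>2" by simp
      show "r \<le> r * (r / \<mu>)" using mult_left_mono[OF 1, of r] r mu(1) by simp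
    qed (use C(1) in auto)
    also have "\<dots> = K * r\<^sup>2" using mu(1) by (simp add: K_def power2_eq_square field_simps)
    finally show ?thesis by (simp add: r_def)
  next
    case False
    have e: "{x \<in> \<Gamma>. x \<noteq> 0 \<and> norm x < R \<and> l dvd lattice_content \<Gamma> x} = {}"
    proof -
      have False if x: "x \<in> \<Gamma>" "x \<noteq> 0" "norm x < R" "l dvd lattice_content \<Gamma> x" for x
        using short[OF l x(1,2,4)] False l x(3) by (simp add: field_simps)
      then show ?thesis by blast
    qed
    then show ?thesis unfolding e using K by simp
  qed
  have "real (card {x \<in> \<Gamma>. x \<noteq> 0 \<and> norm x < R \<and> l dvd lattice_content \<Gamma> x}) \<le>
      (K + 1 / \<mu>) * (R / real l)\<^sup>2" if lR: "l > 0" "R \<ge> 0" for l R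
  proof -
    have "K * (R / real l)\<^sup>2 \<le> (K + 1 / \<mu>) * (R / real l)\<^sup>2"
      using mu(1) by (intro mult_right_mono) auto
    with count[OF lR] show ?thesis by linarith
  qed
  moreover have "real l \<le> (K + 1 / \<mu>) * norm x"
    if "l > 0" "x \<in> \<Gamma>" "x \<noteq> 0" "l dvd lattice_content \<Gamma> x" for l x
  proof -
    have "real l \<le> 1 / \<mu> * norm x" using short[OF that] mu(1) by (simp add: field_simps)
    also have "\<dots> \<le> (K + 1 / \<mu>) * norm x" using K by (intro mult_right_mono) auto
    finally show ?thesis .
  qed
  ultimately show ?thesis using that[of "K + 1 / \<mu>"] K mu(1) by (simp add: add_nonneg_pos)
qed

lemma summable_lattice_decay:
  assumes lat: "is_lattice \<Gamma>"
  shows "(\<lambda>a. 1 / (1 + norm a) ^ 4) summable_on \<Gamma>"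
proof -
  obtain b1 b2 where b: "lattice_basis b1 b2 \<Gamma>" using lat unfolding is_lattice_def by blast
  obtain \<kappa> where k: "\<kappa> > 0" "\<And>s t. \<kappa> * \<bar>s\<bar> \<le> norm (s *\<^sub>R b1 + t *\<^sub>R b2)"
    "\<And>s t. \<kappa> * \<bar>t\<bar> \<le> norm (s *\<^sub>R b1 + t *\<^sub>R b2)" using coords_le_norm[OF b] by blast
  define e where "e = (\<lambda>(m, n). of_int m *\<^sub>R b1 + of_int n *\<^sub>R b2)"
  have \<Gamma>: "\<Gamma> = e ` UNIV" using b unfolding lattice_basis_def e_def by auto
  have inj: "inj e"
  proof (rule injI)
    fix z z' assume "e z = e z'"
    then show "z = z'"
      using lattice_coords_unique[OF b, of "of_int (fst z)" "of_int (snd z)" "of_int (fst z')" "of_int (snd z')"]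
      by (simp add: e_def case_prod_beta prod_eq_iff)
  qed
  define g where "g m = 1 / (1 + \<kappa> * \<bar>of_int m\<bar>)\<^sup>2" for m :: int
  have g0: "g m \<ge> 0" for m by (simp add: g_def)
  have gs: "g summable_on UNIV"
  proof -
    have "summable (\<lambda>n. g (int n))"
    proof (rule summable_comparison_test')
      show "summable (\<lambda>n. 1 / \<kappa>\<^sup>2 * inverse (real n ^ 2))"
        by (intro summable_mult inverse_power_summable) simp
      fix n :: nat assume n: "n \<ge> 1"
      then have "(\<kappa> * real n)\<^sup>2 \<le> (1 + \<kappa> * real n)\<^sup>2" using k(1) by (intro power_mono) auto
      then have "1 / (1 + \<kappa> * real n)\<^sup>2 \<le> 1 / (\<kappa> * real n)\<^sup>2"
        using n k(1) by (intro divide_left_mono mult_pos_pos zero_less_power) (auto intro: add_pos_nonneg)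
      then show "norm (g (int n)) \<le> 1 / \<kappa>\<^sup>2 * inverse (real n ^ 2)"
        by (simp add: g_def field_simps)
    qed
    then have nat: "(\<lambda>n. g (int n)) summable_on UNIV"
      by (simp add: summable_on_UNIV_nonneg_real_iff g0)
    have 1: "g summable_on range int"
      using nat by (subst summable_on_reindex) (auto simp: o_def)
    have 2: "g summable_on range (\<lambda>n. - int n)"
      using nat by (subst summable_on_reindex) (auto simp: o_def inj_def g_def)
    have "(UNIV :: int set) = range int \<union> range (\<lambda>n. - int n)"
      using int_cases by blast
    then show ?thesis using summable_on_union[OF 1 2] by simp
  qed
  have "(\<lambda>(m, n). g m * g n) summable_on UNIV \<times> UNIV"
  proof (rule summable_on_SigmaI[where g = "\<lambda>m. g m * infsum g UNIV"])
    fix m show "((\<lambda>n. case (m, n) of (m, n) \<Rightarrow> g m * g n) has_sum g m * infsum g UNIV) UNIV"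
      using gs by (simp add: has_sum_cmult_right)
    show "(\<lambda>m. g m * infsum g UNIV) summable_on UNIV"
      using gs by (rule summable_on_cmult_left)
  qed (auto simp: g0)
  then have "((\<lambda>a. 1 / (1 + norm a) ^ 4) \<circ> e) summable_on UNIV"
    unfolding UNIV_Times_UNIV
  proof (rule summable_on_comparison_test)
    fix z :: "int \<times> int"
    obtain m n where z: "z = (m, n)" by (cases z)
    have "\<kappa> * \<bar>of_int m\<bar> \<le> norm (e z)" "\<kappa> * \<bar>of_int n\<bar> \<le> norm (e z)"
      using k(2)[of "of_int m" "of_int n"] k(3)[of "of_int n" "of_int m"] by (simp_all add: z e_def)
    then have "(1 + \<kappa> * \<bar>of_int m\<bar>)\<^sup>2 * (1 + \<kappa> * \<bar>of_int n\<bar>)\<^sup>2 \<le> (1 + norm (e z))\<^sup>2 * (1 + norm (e z))\<^sup>2"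
      using k(1) by (intro mult_mono power_mono) auto
    also have "\<dots> = (1 + norm (e z)) ^ 4" by (simp flip: power_add)
    finally show "((\<lambda>a. 1 / (1 + norm a) ^ 4) \<circ> e) z \<le> (case z of (m, n) \<Rightarrow> g m * g n)"
      using k(1) by (auto simp: z g_def intro!: divide_left_mono mult_pos_pos zero_less_power
          add_pos_nonneg)
  qed simp
  then show ?thesis unfolding \<Gamma> by (subst summable_on_reindex[OF inj])
qed

section \<open>The Moebius function and an Euler product in two variables\<close>

definition moebius_mu :: "nat \<Rightarrow> real" where
  "moebius_mu n = (if squarefree n then (-1) ^ card (prime_factors n) else 0)"

lemma moebius_mu_1 [simp]: "moebius_mu (Suc 0) = 1"
  by (simp add: moebius_mu_def flip: One_nat_def)

lemma abs_moebius_mu_le: "\<bar>moebius_mu n\<bar> \<le> 1"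
  by (simp add: moebius_mu_def power_abs)

lemma squarefree_prime_times_iff:
  fixes p n :: nat
  assumes "prime p" "\<not> p dvd n"
  shows "squarefree (p * n) \<longleftrightarrow> squarefree n"
proof
  show "squarefree n" if "squarefree (p * n)" using that by (rule squarefree_multD)
  show "squarefree (p * n)" if "squarefree n"
    using prime_imp_coprime[OF assms] squarefree_prime[OF assms(1)] that
    by (rule squarefree_mult_coprime)
qed

lemma moebius_mu_prime_times:
  assumes "prime p" "\<not> p dvd n"
  shows "moebius_mu (p * n) = - moebius_mu n"
proof (cases "squarefree n")
  case True
  have n: "n \<noteq> 0" using assms(2) by (intro notI) simp
  have "prime_factors (p * n) = insert p (prime_factors n)"
    using assms n by (subst prime_factors_product) (auto simp: prime_prime_factors)
  moreover have "p \<notin> prime_factors n" using assms by auto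
  ultimately show ?thesis using True assms by (simp add: moebius_mu_def squarefree_prime_times_iff)
qed (use assms in \<open>simp add: moebius_mu_def squarefree_prime_times_iff\<close>)

definition squarefree_divisors :: "nat \<Rightarrow> nat set" where
  "squarefree_divisors n = {d. squarefree d \<and> d dvd n}"

lemma finite_squarefree_divisors [simp]: "n > 0 \<Longrightarrow> finite (squarefree_divisors n)"
  by (simp add: squarefree_divisors_def)

text \<open>
  Sums over divisors that vanish off the squarefree numbers can be evaluated by splitting off one
  prime at a time; this serves both the Moebius identity and the Euler product.
\<close>

lemma squarefree_divisors_prime_power_times:
  assumes p: "prime p" and k: "k > 0" and m: "\<not> p dvd m"
  shows "squarefree_divisors (p ^ k * m) = squarefree_divisors m \<union> (*) p ` squarefree_divisors m"
proof (intro equalityI subsetI)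
  fix d assume d: "d \<in> squarefree_divisors (p ^ k * m)"
  show "d \<in> squarefree_divisors m \<union> (*) p ` squarefree_divisors m"
  proof (cases "p dvd d")
    case False
    then have "coprime p d" using p by (intro prime_imp_coprime)
    then have "coprime d (p ^ k)" by (simp add: coprime_commute[of d p])
    then show ?thesis using d by (auto simp: squarefree_divisors_def coprime_dvd_mult_right_iff)
  next
    case True
    then obtain e where e: "d = p * e" by blast
    have "\<not> p dvd e"
    proof
      assume "p dvd e"
      then have "p\<^sup>2 dvd d" by (simp add: e power2_eq_square mult_dvd_mono)
      moreover have "\<not> p dvd 1" using p not_prime_unit by blast
      ultimately have "\<not> squarefree d" by (rule not_squarefreeI)
      then show False using d by (simp add: squarefree_divisors_def)
    qed
    moreover from this have "coprime p e" using p by (intro prime_imp_coprime)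
    then have "coprime e (p ^ k)" by (simp add: coprime_commute[of e p])
    moreover have "e dvd p ^ k * m" using d dvd_mult_right by (auto simp: e squarefree_divisors_def)
    ultimately have "e \<in> squarefree_divisors m"
      using d squarefree_prime_times_iff[OF p]
      by (auto simp: squarefree_divisors_def e coprime_dvd_mult_right_iff)
    then show ?thesis using e by blast
  qed
next
  fix d assume "d \<in> squarefree_divisors m \<union> (*) p ` squarefree_divisors m"
  then show "d \<in> squarefree_divisors (p ^ k * m)"
  proof
    assume "d \<in> (*) p ` squarefree_divisors m"
    then obtain e where e: "d = p * e" "squarefree e" "e dvd m"
      by (auto simp: squarefree_divisors_def)
    moreover have "\<not> p dvd e" using m e by (meson dvd_trans)
    moreover have "p dvd p ^ k" using k by (simp add: dvd_power)
    ultimately show ?thesis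
      using squarefree_prime_times_iff[OF p] by (auto simp: squarefree_divisors_def intro: mult_dvd_mono)
  qed (auto simp: squarefree_divisors_def)
qed

lemma sum_squarefree_divisors_prime_power_times:
  fixes f :: "nat \<Rightarrow> 'a :: comm_monoid_add"
  assumes p: "prime p" and k: "k > 0" and m: "\<not> p dvd m"
  shows "sum f (squarefree_divisors (p ^ k * m)) =
    (\<Sum>d\<in>squarefree_divisors m. f d + f (p * d))"
proof -
  have "m > 0" using m by (auto intro: Nat.gr0I)
  then have "sum f (squarefree_divisors m \<union> (*) p ` squarefree_divisors m) =
      sum f (squarefree_divisors m) + sum f ((*) p ` squarefree_divisors m)"
    using m by (intro sum.union_disjoint)
      (auto simp: squarefree_divisors_def intro: dvd_trans[OF dvd_triv_left])
  also have "sum f ((*) p ` squarefree_divisors m) = (\<Sum>d\<in>squarefree_divisors m. f (p * d))"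
    using p by (subst sum.reindex) (auto simp: inj_on_def)
  finally show ?thesis
    by (simp add: squarefree_divisors_prime_power_times[OF assms] sum.distrib)
qed

lemma sum_moebius_mu_divisors:
  assumes "n > 0"
  shows "(\<Sum>d | d dvd n. moebius_mu d) = (if n = 1 then 1 else 0)"
proof -
  have "(\<Sum>d | d dvd n. moebius_mu d) = sum moebius_mu (squarefree_divisors n)"
    using assms by (intro sum.mono_neutral_right) (auto simp: squarefree_divisors_def moebius_mu_def)
  also have "\<dots> = (if n = 1 then 1 else 0)"
  proof (cases "n = 1")
    case True
    then have "squarefree_divisors n = {1}" by (auto simp: squarefree_divisors_def)
    then show ?thesis using True by simp
  next
    case False
    then obtain p where p: "prime p" "p dvd n" using prime_factor_nat by blast
    obtain m where m: "n = p ^ multiplicity p n * m" "\<not> p dvd m"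
      using multiplicity_decompose'[of n p] assms p by (metis not_prime_unit gr_implies_not0)
    have "multiplicity p n > 0" using p assms prime_multiplicity_gt_zero_iff by auto
    from sum_squarefree_divisors_prime_power_times[OF p(1) this m(2), of moebius_mu]
    have "sum moebius_mu (squarefree_divisors n) =
        (\<Sum>d\<in>squarefree_divisors m. moebius_mu d + moebius_mu (p * d))" using m(1) by simp
    also have "\<dots> = 0"
    proof (intro sum.neutral ballI)
      fix d assume "d \<in> squarefree_divisors m"
      then have "\<not> p dvd d" using m(2) dvd_trans[of p d m] by (auto simp: squarefree_divisors_def)
      then show "moebius_mu d + moebius_mu (p * d) = 0" by (simp add: moebius_mu_prime_times[OF p(1)])
    qed
    finally show ?thesis using False by simp
  qed
  finally show ?thesis .
qed

text \<open>
  The weights that detect visibility of \<open>x - a\<close>, where \<open>q\<close> is the content of \<open>a\<close>. If \<open>a = 0\<close>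
  this condition is implied by the visibility of \<open>x\<close>, and the trivial weight expresses that it is
  omitted. With it, \<open>gcd l m\<close> stays bounded over all pairs that contribute
  (\<open>gcd_le_content_bound\<close>).
\<close>

definition shift_weight :: "nat \<Rightarrow> nat \<Rightarrow> real" where
  "shift_weight q m = (if q = 0 then (if m = 1 then 1 else 0) else moebius_mu m)"

lemma abs_shift_weight_le: "\<bar>shift_weight q m\<bar> \<le> 1"
  using abs_moebius_mu_le by (simp add: shift_weight_def)

lemma sum_shift_weight_divisors:
  assumes "n > 0"
  shows "(\<Sum>d | d dvd n. shift_weight q d) = (if q = 0 \<or> n = 1 then 1 else 0)"
proof (cases "q = 0")
  case True
  have "(\<Sum>d | d dvd n. shift_weight q d) = (\<Sum>d | d dvd n. if d = 1 then 1 else 0)"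
    using True by (simp add: shift_weight_def)
  also have "\<dots> = 1" using assms by (subst sum.delta) auto
  finally show ?thesis using True by simp
qed (use sum_moebius_mu_divisors[OF assms] in \<open>simp add: shift_weight_def\<close>)

lemma shift_weight_prime_times:
  assumes "prime p" "\<not> p dvd m"
  shows "shift_weight q (p * m) = (if q = 0 then 0 else - shift_weight q m)"
  using assms by (auto simp: shift_weight_def moebius_mu_prime_times)

text \<open>
  The weighted relative density of the lattice points \<open>x\<close> with \<open>x \<in> l\<Gamma>\<close> and \<open>x - a \<in> m\<Gamma>\<close>, where
  \<open>q\<close> is the content of \<open>a\<close>: these points form one class modulo \<open>lcm l m\<close> or the empty set.
\<close>

definition pair_density :: "nat \<Rightarrow> nat \<times> nat \<Rightarrow> real" where
  "pair_density q = (\<lambda>(l, m). if gcd l m dvd q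
     then moebius_mu l * shift_weight q m / (real (lcm l m))\<^sup>2 else 0)"

lemma pair_density_prime_times:
  assumes p: "prime p" and l: "\<not> p dvd l" and m: "\<not> p dvd m"
  shows "pair_density q (p * l, m) = - pair_density q (l, m) / (real p)\<^sup>2"
    and "pair_density q (l, p * m) = (if q = 0 then 0 else - pair_density q (l, m) / (real p)\<^sup>2)"
    and "pair_density q (p * l, p * m) =
      (if q \<noteq> 0 \<and> p dvd q then pair_density q (l, m) / (real p)\<^sup>2 else 0)"
proof -
  have cl: "coprime p l" "coprime p m" using p l m by (auto intro: prime_imp_coprime)
  have g1: "gcd (p * l) m = gcd l m" "gcd l (p * m) = gcd l m"
    using cl by (simp_all add: gcd_mult_left_left_cancel gcd_mult_right_left_cancel coprime_commute)
  have l1: "lcm (p * l) m = p * lcm l m" "lcm l (p * m) = p * lcm l m"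
    using g1 by (simp_all add: lcm_nat_def div_mult_swap mult.assoc mult.left_commute)
  have g2: "gcd (p * l) (p * m) = p * gcd l m" "lcm (p * l) (p * m) = p * lcm l m"
    by (simp_all add: gcd_mult_left lcm_mult_left)
  have cg: "coprime p (gcd l m)" using cl by (meson coprime_divisors dvd_refl gcd_dvd1)
  have gq: "p * gcd l m dvd q \<longleftrightarrow> p dvd q \<and> gcd l m dvd q"
    using cg by (meson divides_mult dvd_mult_left dvd_mult_right)
  show "pair_density q (p * l, m) = - pair_density q (l, m) / (real p)\<^sup>2"
    using moebius_mu_prime_times[OF p l]
    by (simp add: pair_density_def g1 l1 power_mult_distrib)
  show "pair_density q (l, p * m) = (if q = 0 then 0 else - pair_density q (l, m) / (real p)\<^sup>2)"
    using shift_weight_prime_times[OF p m]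
    by (simp add: pair_density_def g1 l1 power_mult_distrib)
  show "pair_density q (p * l, p * m) =
      (if q \<noteq> 0 \<and> p dvd q then pair_density q (l, m) / (real p)\<^sup>2 else 0)"
    using shift_weight_prime_times[OF p m] moebius_mu_prime_times[OF p l]
    by (simp add: pair_density_def g2 gq power_mult_distrib)
qed

text \<open>
  The proportion of the \<open>p\<^sup>2\<close> classes modulo \<open>p\<close> that differ from the classes of \<open>0\<close> and of \<open>a\<close>.
\<close>

definition local_density :: "nat \<Rightarrow> nat \<Rightarrow> real" where
  "local_density q p = 1 - 2 / (real p)\<^sup>2 + (if p dvd q then 1 / (real p)\<^sup>2 else 0)"

text \<open>
  Adjoining a prime \<open>p\<close> replaces every pair \<open>(l, m)\<close> by the four pairs in which \<open>l\<close> and \<open>m\<close> are or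
  are not multiplied by \<open>p\<close>, and their densities add up to the density of \<open>(l, m)\<close> times the local
  factor.
\<close>

lemma sum_pair_density_finite_euler:
  assumes "finite A" "\<And>p. p \<in> A \<Longrightarrow> prime p"
  shows "(\<Sum>z\<in>squarefree_divisors (\<Prod>A) \<times> squarefree_divisors (\<Prod>A). pair_density q z) =
    (\<Prod>p\<in>A. local_density q p)"
  using assms
proof (induction A rule: finite_induct)
  case empty
  have "squarefree_divisors 1 = {1}" by (auto simp: squarefree_divisors_def)
  then show ?case by (simp add: pair_density_def shift_weight_def)
next
  case (insert p A)
  define N where "N = \<Prod>A"
  have p: "prime p" using insert by simp
  have pN: "\<not> p dvd N"
  proof
    assume "p dvd N"
    then obtain r where "r \<in> A" "p dvd r" using p insert(1) by (auto simp: N_def prime_dvd_prod_iff)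
    then show False using insert p primes_dvd_imp_eq by blast
  qed
  have not_dvd: "\<not> p dvd d" if "d \<in> squarefree_divisors N" for d
    using that pN by (auto simp: squarefree_divisors_def dest: dvd_trans)
  have split: "sum f (squarefree_divisors (p * N)) = (\<Sum>d\<in>squarefree_divisors N. f d + f (p * d))"
    for f :: "nat \<Rightarrow> real"
    using sum_squarefree_divisors_prime_power_times[OF p _ pN, of 1 f] by simp
  have "(\<Sum>z\<in>squarefree_divisors (p * N) \<times> squarefree_divisors (p * N). pair_density q z) =
      (\<Sum>l\<in>squarefree_divisors N. \<Sum>m\<in>squarefree_divisors N.
        pair_density q (l, m) + pair_density q (l, p * m) +
        (pair_density q (p * l, m) + pair_density q (p * l, p * m)))"
    by (simp add: sum.cartesian_product' split sum.distrib)
  also have "\<dots> = (\<Sum>l\<in>squarefree_divisors N. \<Sum>m\<in>squarefree_divisors N.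
        local_density q p * pair_density q (l, m))"
  proof (intro sum.cong refl)
    fix l m assume lm: "l \<in> squarefree_divisors N" "m \<in> squarefree_divisors N"
    show "pair_density q (l, m) + pair_density q (l, p * m) +
        (pair_density q (p * l, m) + pair_density q (p * l, p * m)) =
        local_density q p * pair_density q (l, m)"
      unfolding pair_density_prime_times[OF p not_dvd[OF lm(1)] not_dvd[OF lm(2)]] local_density_def
      by (auto simp: algebra_simps)
  qed
  also have "\<dots> = local_density q p *
      (\<Sum>z\<in>squarefree_divisors N \<times> squarefree_divisors N. pair_density q z)"
    by (simp add: sum.cartesian_product' sum_distrib_left)
  also have "\<dots> = local_density q p * (\<Prod>p\<in>A. local_density q p)"
    using insert by (simp add: N_def)
  finally show ?case using insert by (simp add: N_def)
qed

text \<open>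
  The sum telescopes after \<open>1 / n\<^sup>2\<close> is bounded by \<open>1 / (n - 1) - 1 / n\<close>.
\<close>

lemma sum_inverse_squares_le:
  assumes "k \<ge> 1"
  shows "(\<Sum>n=Suc k..N. 1 / (real n)\<^sup>2) \<le> 1 / real k"
proof -
  have "(\<Sum>n=Suc k..N. 1 / (real n)\<^sup>2) \<le> 1 / real k - 1 / real (max k N)"
  proof (induction N)
    case (Suc N)
    show ?case
    proof (cases "k \<le> N")
      case True
      have N: "real N \<ge> 1" using True assms by simp
      have "(\<Sum>n=Suc k..Suc N. 1 / (real n)\<^sup>2) \<le> 1 / real k - 1 / real N + 1 / (real (Suc N))\<^sup>2"
        using Suc True by (simp add: max_def split: if_splits)
      also have "1 / (real (Suc N))\<^sup>2 \<le> 1 / (real N * real (Suc N))"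
        using N by (intro divide_left_mono) (auto simp: power2_eq_square)
      also have "1 / (real N * real (Suc N)) = 1 / real N - 1 / real (Suc N)"
        using N by (simp add: field_simps)
      finally show ?thesis using True by (simp add: max_def)
    next
      case False
      then show ?thesis by (cases "k = Suc N") auto
    qed
  qed simp
  also have "\<dots> \<le> 1 / real k" by simp
  finally show ?thesis .
qed

definition content_bound :: "nat \<Rightarrow> real" where
  "content_bound q = real (max 1 q)"

lemma gcd_le_content_bound:
  assumes "gcd l m dvd q" "shift_weight q m \<noteq> 0"
  shows "real (gcd l m) \<le> content_bound q"
proof (cases "q = 0")
  case True
  then have "m = 1" using assms by (simp add: shift_weight_def split: if_splits)
  then show ?thesis by (simp add: content_bound_def)
next
  case False
  then have "gcd l m \<le> q" using assms by (intro dvd_imp_le) auto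
  then show ?thesis by (simp add: content_bound_def)
qed

lemma abs_pair_density_le:
  "\<bar>pair_density q (l, m)\<bar> \<le> (content_bound q)\<^sup>2 * (1 / (real l)\<^sup>2 * (1 / (real m)\<^sup>2))"
proof (cases "l > 0 \<and> m > 0 \<and> gcd l m dvd q \<and> shift_weight q m \<noteq> 0")
  case True
  have K: "real (gcd l m) \<le> content_bound q" using True gcd_le_content_bound by blast
  have "real l * real m = real (gcd l m) * real (lcm l m)"
    by (metis of_nat_mult prod_gcd_lcm_nat)
  then have "real l * real m \<le> content_bound q * real (lcm l m)" using K by (simp add: mult_right_mono)
  then have "(real l * real m)\<^sup>2 \<le> (content_bound q * real (lcm l m))\<^sup>2" by (intro power_mono) auto
  moreover have "real (lcm l m) > 0" using True by (simp add: lcm_pos_nat)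
  ultimately have "1 / (real (lcm l m))\<^sup>2 \<le> (content_bound q)\<^sup>2 * (1 / (real l)\<^sup>2 * (1 / (real m)\<^sup>2))"
    using True by (simp add: field_simps)
  moreover have "\<bar>pair_density q (l, m)\<bar> = \<bar>moebius_mu l\<bar> * \<bar>shift_weight q m\<bar> * (1 / (real (lcm l m))\<^sup>2)"
    using True by (simp add: pair_density_def abs_mult)
  moreover have "\<bar>moebius_mu l\<bar> * \<bar>shift_weight q m\<bar> * (1 / (real (lcm l m))\<^sup>2) \<le> 1 * 1 * (1 / (real (lcm l m))\<^sup>2)"
    using abs_moebius_mu_le abs_shift_weight_le by (intro mult_mono) auto
  ultimately show ?thesis by simp
next
  case False
  then have "pair_density q (l, m) = 0" by (auto simp: pair_density_def)
  then show ?thesis by simp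
qed

text \<open>
  The square of the series of inverse squares, arranged over pairs, is the majorant of the double
  series of densities.
\<close>

lemma has_sum_inverse_square_pairs:
  defines "Z \<equiv> infsum (\<lambda>n. 1 / (real n)\<^sup>2) UNIV"
  shows "((\<lambda>n. 1 / (real n)\<^sup>2) has_sum Z) UNIV" "0 \<le> Z"
    "((\<lambda>(l, m). 1 / (real l)\<^sup>2 * (1 / (real m)\<^sup>2)) has_sum Z * Z) UNIV"
    "\<And>k. k \<ge> 1 \<Longrightarrow> Z - (\<Sum>n=1..k. 1 / (real n)\<^sup>2) \<le> 1 / real k"
proof -
  have "summable (\<lambda>n. 1 / (real n)\<^sup>2)"
    using inverse_power_summable[of 2] by (simp add: field_simps)
  then have Z: "((\<lambda>n. 1 / (real n)\<^sup>2) has_sum Z) UNIV"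
    unfolding Z_def by (intro has_sum_infsum) (simp add: summable_on_UNIV_nonneg_real_iff)
  have Z0: "0 \<le> Z" using Z by (rule has_sum_nonneg) simp
  have 2: "((\<lambda>(l, m). 1 / (real l)\<^sup>2 * (1 / (real m)\<^sup>2)) has_sum Z * Z) (UNIV \<times> UNIV)"
  proof (rule has_sum_SigmaI[where g = "\<lambda>l. 1 / (real l)\<^sup>2 * Z"])
    show "((\<lambda>m. case (l, m) of (l, m) \<Rightarrow> 1 / (real l)\<^sup>2 * (1 / (real m)\<^sup>2)) has_sum 1 / (real l)\<^sup>2 * Z) UNIV"
      for l using has_sum_cmult_right[OF Z, of "1 / (real l)\<^sup>2"] by simp
    show "((\<lambda>l. 1 / (real l)\<^sup>2 * Z) has_sum Z * Z) UNIV"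
      by (rule has_sum_cmult_left[OF Z])
    have "(\<lambda>(l, m). 1 / (real l)\<^sup>2 * (1 / (real m)\<^sup>2)) summable_on UNIV \<times> UNIV"
      by (rule summable_on_SigmaI[where g = "\<lambda>l. 1 / (real l)\<^sup>2 * Z"])
         (simp_all only: case_prod_conv has_sum_cmult_right[OF Z]
            has_sum_imp_summable[OF has_sum_cmult_left[OF Z]], simp)
    then show "(\<lambda>(l, m). 1 / (real l)\<^sup>2 * (1 / (real m)\<^sup>2)) summable_on UNIV \<times> UNIV" .
  qed
  have 3: "Z - (\<Sum>n=1..k. 1 / (real n)\<^sup>2) \<le> 1 / real k" if k: "k \<ge> 1" for k
  proof -
    have "Z \<le> (\<Sum>n=1..k. 1 / (real n)\<^sup>2) + 1 / real k"
    proof (rule has_sum_le_finite_sums[OF Z])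
      fix F :: "nat set" assume F: "finite F"
      define N where "N = max k (Max (insert 0 F))"
      have "F \<subseteq> {0..N}" using F by (auto simp: N_def le_max_iff_disj)
      then have "(\<Sum>n\<in>F. 1 / (real n)\<^sup>2) \<le> (\<Sum>n=0..N. 1 / (real n)\<^sup>2)"
        by (intro sum_mono2) auto
      also have "\<dots> = (\<Sum>n=1..N. 1 / (real n)\<^sup>2)"
        by (intro sum.mono_neutral_right) auto
      also have "{1..N} = {1..k} \<union> {Suc k..N}" using k by (auto simp: N_def)
      also have "(\<Sum>n\<in>{1..k} \<union> {Suc k..N}. 1 / (real n)\<^sup>2) =
          (\<Sum>n=1..k. 1 / (real n)\<^sup>2) + (\<Sum>n=Suc k..N. 1 / (real n)\<^sup>2)"
        by (intro sum.union_disjoint) auto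
      finally show "(\<Sum>n\<in>F. 1 / (real n)\<^sup>2) \<le> (\<Sum>n=1..k. 1 / (real n)\<^sup>2) + 1 / real k"
        using sum_inverse_squares_le[OF k, of N] by linarith
    qed
    then show ?thesis by linarith
  qed
  show "((\<lambda>n. 1 / (real n)\<^sup>2) has_sum Z) UNIV" "0 \<le> Z"
    "((\<lambda>(l, m). 1 / (real l)\<^sup>2 * (1 / (real m)\<^sup>2)) has_sum Z * Z) UNIV"
    "\<And>k. k \<ge> 1 \<Longrightarrow> Z - (\<Sum>n=1..k. 1 / (real n)\<^sup>2) \<le> 1 / real k"
    using Z Z0 2 3 by simp_all
qed

lemma pair_density_summable: "(\<lambda>z. norm (pair_density q z)) summable_on UNIV"
proof -
  show ?thesis
  proof (rule summable_on_comparison_test)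
    show "(\<lambda>z. (content_bound q)\<^sup>2 * (case z of (l, m) \<Rightarrow> 1 / (real l)\<^sup>2 * (1 / (real m)\<^sup>2))) summable_on UNIV"
      using has_sum_imp_summable[OF has_sum_inverse_square_pairs(3)] by (rule summable_on_cmult_right)
  qed (use abs_pair_density_le in auto)
qed

text \<open>
  Off the box, the majorant sums to \<open>Z * Z\<close> minus the product of two partial sums of \<open>Z\<close>, which
  is at most \<open>Z\<close> times the sum of the two tails.
\<close>

lemma pair_density_tail:
  obtains C where "C \<ge> 0" "\<And>T y. T \<ge> 1 \<Longrightarrow> y \<ge> 1 \<Longrightarrow>
    \<bar>infsum (pair_density q) UNIV - (\<Sum>z\<in>{1..T} \<times> {1..y}. pair_density q z)\<bar> \<le> C * (1 / real T + 1 / real y)"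
proof -
  define Z where "Z = infsum (\<lambda>n. 1 / (real n)\<^sup>2) UNIV"
  note Z = has_sum_inverse_square_pairs[folded Z_def]
  define K where "K = (content_bound q)\<^sup>2"
  define G where "G = (\<lambda>(l, m). 1 / (real l)\<^sup>2 * (1 / (real m)\<^sup>2))"
  have "\<bar>infsum (pair_density q) UNIV - (\<Sum>z\<in>{1..T} \<times> {1..y}. pair_density q z)\<bar> \<le>
      K * Z * (1 / real T + 1 / real y)" if T: "T \<ge> 1" and y: "y \<ge> 1" for T y
  proof -
    define B where "B = {1..T} \<times> {1..y}"
    define S where "S k = (\<Sum>n=1..k. 1 / (real n)\<^sup>2)" for k :: nat
    have sF: "pair_density q summable_on UNIV"
      by (rule abs_summable_summable[OF pair_density_summable])
    have GU: "(G has_sum Z * Z) UNIV" using Z(3) by (simp add: G_def)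
    have GB: "(\<Sum>z\<in>B. G z) = S T * S y"
      by (simp add: B_def G_def S_def sum.cartesian_product' sum_product)
    have fin: "finite B" by (simp add: B_def)
    have "infsum (pair_density q) UNIV = infsum (pair_density q) (B \<union> - B)" by simp
    also have "\<dots> = infsum (pair_density q) B + infsum (pair_density q) (- B)"
      using sF fin by (intro infsum_Un_disjoint) (auto intro: summable_on_subset_banach)
    finally have "infsum (pair_density q) UNIV - sum (pair_density q) B = infsum (pair_density q) (- B)"
      using fin by simp
    moreover have "\<bar>infsum (pair_density q) (- B)\<bar> \<le> K * (Z * Z - S T * S y)"
    proof -
      have "infsum G UNIV = infsum G (B \<union> - B)" by simp
      also have "\<dots> = infsum G B + infsum G (- B)"
        using has_sum_imp_summable[OF GU] fin
        by (intro infsum_Un_disjoint) (auto intro: summable_on_subset_banach)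
      finally have GC: "infsum G (- B) = Z * Z - S T * S y"
        using fin GB infsumI[OF GU] by simp
      have GCs: "G summable_on (- B)"
        using has_sum_imp_summable[OF GU] by (rule summable_on_subset_banach) simp
      have "norm (infsum (pair_density q) (- B)) \<le> infsum (\<lambda>z. K * G z) (- B)"
      proof (rule norm_infsum_le[OF has_sum_infsum has_sum_infsum])
        show "pair_density q summable_on - B" using sF by (rule summable_on_subset_banach) simp
        show "(\<lambda>z. K * G z) summable_on - B" using GCs by (rule summable_on_cmult_right)
        show "norm (pair_density q z) \<le> K * G z" for z
          using abs_pair_density_le by (cases z) (simp add: G_def K_def)
      qed
      also have "\<dots> = K * infsum G (- B)" by (rule infsum_cmult_right')
      finally show ?thesis by (simp add: GC)
    qed
    moreover have "K * (Z * Z - S T * S y) \<le> K * (Z * (1 / real T + 1 / real y))"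
    proof (rule mult_left_mono)
      have S: "0 \<le> S k" "S k \<le> Z" for k
      proof -
        show "0 \<le> S k" by (simp add: S_def sum_nonneg)
        show "S k \<le> Z" unfolding S_def by (rule finite_sum_le_has_sum[OF Z(1)]) auto
      qed
      have "Z * Z - S T * S y = Z * (Z - S y) + S y * (Z - S T)" by (simp add: algebra_simps)
      also have "\<dots> \<le> Z * (1 / real y) + Z * (1 / real T)"
        using Z(2) Z(4)[OF T] Z(4)[OF y] S by (intro add_mono mult_mono) (auto simp: S_def)
      finally show "Z * Z - S T * S y \<le> Z * (1 / real T + 1 / real y)" by (simp add: algebra_simps)
    qed (simp add: K_def)
    ultimately show ?thesis by (simp add: B_def mult.assoc)
  qed
  moreover have "0 \<le> K * Z" using Z(2) by (simp add: K_def)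
  ultimately show ?thesis using that by blast
qed

lemma convergent_prod_primes:
  fixes f :: "nat \<Rightarrow> real"
  assumes "\<And>p. prime p \<Longrightarrow> P p \<Longrightarrow> \<bar>f p - 1\<bar> \<le> 2 / (real p)\<^sup>2" "\<And>p. prime p \<Longrightarrow> P p \<Longrightarrow> f p > 0"
  shows "convergent_prod (\<lambda>p. if prime p \<and> P p then f p else 1)"
proof -
  have "convergent_prod (\<lambda>p. 1 + (if prime p \<and> P p then f p - 1 else 0))"
  proof (rule summable_imp_convergent_prod_real)
    show "summable (\<lambda>p. \<bar>if prime p \<and> P p then f p - 1 else 0\<bar>)"
    proof (rule summable_comparison_test')
      show "summable (\<lambda>n. 2 * inverse (real n ^ 2))" by (intro summable_mult inverse_power_summable) simp
    qed (use assms(1) in \<open>auto simp: field_simps\<close>)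
    show "(if prime p \<and> P p then f p - 1 else 0) \<noteq> - 1" for p using assms(2)[of p] by auto
  qed
  moreover have "(\<lambda>p. 1 + (if prime p \<and> P p then f p - 1 else 0)) =
      (\<lambda>p. if prime p \<and> P p then f p else 1)" by auto
  ultimately show ?thesis by simp
qed

lemma prime_inverse_square_bounds:
  assumes "prime p"
  shows "0 < 1 / (real p)\<^sup>2" "1 / (real p)\<^sup>2 \<le> 1 / 4"
proof -
  have "2 \<le> real p" using prime_ge_2_nat[OF assms] by linarith
  from power_mono[OF this, of 2] have "4 \<le> (real p)\<^sup>2" by simp
  then show "0 < 1 / (real p)\<^sup>2" "1 / (real p)\<^sup>2 \<le> 1 / 4" using divide_left_mono[of 4 "(real p)\<^sup>2" 1] \<open>2 \<le> real p\<close> by simp_all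
qed

lemma local_density_bounds:
  assumes "prime p"
  shows "\<bar>local_density q p - 1\<bar> \<le> 2 / (real p)\<^sup>2" "local_density q p > 0"
proof -
  define t where "t = 1 / (real p)\<^sup>2"
  have "0 < t" "t \<le> 1 / 4" using prime_inverse_square_bounds[OF assms] by (simp_all add: t_def)
  moreover have "local_density q p = 1 - 2 * t + (if p dvd q then t else 0)"
    by (simp add: local_density_def t_def)
  moreover have "2 / (real p)\<^sup>2 = 2 * t" by (simp add: t_def)
  ultimately show "\<bar>local_density q p - 1\<bar> \<le> 2 / (real p)\<^sup>2" "local_density q p > 0" by auto
qed

text \<open>
  The summands live on pairs of squarefree numbers, and these are exhausted by the pairs of
  divisors of the product of all primes up to \<open>n\<close>. Along this exhaustion the finite sums are the
  partial products.
\<close>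

lemma infsum_pair_density:
  "infsum (pair_density q) UNIV = prime_prod (\<lambda>p. True) (local_density q)"
proof -
  define f where "f p = (if prime p \<and> True then local_density q p else 1)" for p
  define P where "P n = \<Prod>{p. prime p \<and> p \<le> n}" for n :: nat
  define A where "A n = squarefree_divisors (P n) \<times> squarefree_divisors (P n)" for n
  define Q :: "(nat \<times> nat) set" where "Q = {(l, m). squarefree l \<and> squarefree m}"
  have fin: "finite {p. prime p \<and> p \<le> n}" for n :: nat by simp
  have P0: "P n > 0" for n unfolding P_def by (intro prod_pos) (auto simp: prime_gt_0_nat)
  have sum_A: "(\<Sum>z\<in>A n. pair_density q z) = (\<Prod>p\<le>n. f p)" for n
  proof -
    have "(\<Sum>z\<in>A n. pair_density q z) = (\<Prod>p | prime p \<and> p \<le> n. local_density q p)"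
      unfolding A_def P_def using sum_pair_density_finite_euler[OF fin] by simp
    also have "\<dots> = (\<Prod>p | prime p \<and> p \<le> n. f p)" by (intro prod.cong) (auto simp: f_def)
    also have "\<dots> = (\<Prod>p\<le>n. f p)" by (intro prod.mono_neutral_left) (auto simp: f_def)
    finally show ?thesis .
  qed
  have dvdP: "d \<in> squarefree_divisors (P n)" if d: "squarefree d" "d \<le> n" for d n
  proof -
    have d0: "d \<noteq> 0" using d by (metis not_squarefree_0)
    have "d = \<Prod>(prime_factors d)"
    proof -
      have "d = (\<Prod>p\<in>prime_factors d. p ^ multiplicity p d)"
        using d0 by (simp add: prod_prime_factors)
      also have "\<dots> = (\<Prod>p\<in>prime_factors d. p)"
        using d(1) squarefree_factorial_semiring'[OF d0] by (intro prod.cong) auto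
      finally show ?thesis .
    qed
    moreover have "prime_factors d \<subseteq> {p. prime p \<and> p \<le> n}"
      using d d0 by (auto dest!: dvd_imp_le)
    ultimately have "d dvd P n" unfolding P_def by (metis prod_dvd_prod_subset fin)
    then show ?thesis using d by (simp add: squarefree_divisors_def)
  qed
  have "filterlim A (finite_subsets_at_top Q) sequentially"
    unfolding filterlim_finite_subsets_at_top
  proof (intro allI impI)
    fix X assume X: "finite X \<and> X \<subseteq> Q"
    define n0 where "n0 = Max (insert 0 (fst ` X \<union> snd ` X))"
    have "finite (A n) \<and> X \<subseteq> A n \<and> A n \<subseteq> Q" if n: "n \<ge> n0" for n
    proof (intro conjI subsetI)
      show "finite (A n)" using P0 by (simp add: A_def)
      fix z assume z: "z \<in> X"
      then have "fst z \<le> n0" "snd z \<le> n0" using X by (auto simp: n0_def intro!: Max_ge)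
      then show "z \<in> A n"
        using z X n dvdP[of "fst z" n] dvdP[of "snd z" n] by (auto simp: A_def Q_def)
    next
      fix z assume "z \<in> A n"
      then show "z \<in> Q" by (auto simp: A_def Q_def squarefree_divisors_def)
    qed
    then show "\<forall>\<^sub>F n in sequentially. finite (A n) \<and> X \<subseteq> A n \<and> A n \<subseteq> Q"
      using eventually_sequentially by blast
  qed
  moreover have "(pair_density q has_sum infsum (pair_density q) UNIV) Q"
  proof -
    have "pair_density q (l, m) = 0" if "\<not> squarefree l \<or> \<not> squarefree m" for l m
      using that by (auto simp: pair_density_def moebius_mu_def shift_weight_def)
    then have "pair_density q z = 0" if "z \<in> UNIV - Q" for z
      using that by (cases z) (auto simp: Q_def)
    moreover have "(pair_density q has_sum infsum (pair_density q) UNIV) UNIV"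
      by (rule has_sum_infsum[OF abs_summable_summable[OF pair_density_summable]])
    ultimately show ?thesis by (subst has_sum_cong_neutral[where T = UNIV]) auto
  qed
  ultimately have "(\<lambda>n. \<Sum>z\<in>A n. pair_density q z) \<longlonglongrightarrow> infsum (pair_density q) UNIV"
    unfolding has_sum_def using filterlim_compose by blast
  moreover have "(\<lambda>n. \<Sum>z\<in>A n. pair_density q z) \<longlonglongrightarrow> prodinf f"
  proof -
    have "convergent_prod f" unfolding f_def
      by (rule convergent_prod_primes) (auto simp: local_density_bounds)
    then show ?thesis unfolding sum_A by (rule convergent_prod_LIMSEQ)
  qed
  ultimately show ?thesis
    unfolding prime_prod_def f_def[abs_def, symmetric] by (rule LIMSEQ_unique)
qed

text \<open>
  For \<open>p\<close> dividing \<open>q\<close> the identity \<open>(1 - 2/p\<^sup>2) (1 + 1/(p\<^sup>2 - 2)) = 1 - 1/p\<^sup>2\<close> holds. The proof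
  works with \<open>t = 1/p\<^sup>2\<close>, which lies in \<open>(0, 1/4]\<close>.
\<close>

lemma prime_prod_local_density:
  assumes "\<And>p. prime p \<Longrightarrow> P p \<longleftrightarrow> p dvd q"
  shows "prime_prod (\<lambda>p. True) (local_density q) =
    xi 2 * prime_prod P (\<lambda>p. 1 + 1 / ((real p)\<^sup>2 - 2))"
proof -
  define t where "t p = 1 / (real p)\<^sup>2" for p
  have t: "0 < t p" "t p \<le> 1 / 4" if "prime p" for p
    using prime_inverse_square_bounds[OF that] by (simp_all add: t_def)
  have dvd_factor: "1 / ((real p)\<^sup>2 - 2) = t p / (1 - 2 * t p)" if "prime p" for p
  proof -
    have "t p \<noteq> 0" using t[OF that] by simp
    moreover have "(real p)\<^sup>2 = 1 / t p" by (simp add: t_def)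
    ultimately have "(real p)\<^sup>2 - 2 = (1 - 2 * t p) / t p" by (simp add: field_simps)
    then show ?thesis by simp
  qed
  have dvd_bounds: "0 < t p / (1 - 2 * t p)" "t p / (1 - 2 * t p) \<le> 2 * t p" if "prime p" for p
  proof -
    have pos: "0 < 1 - 2 * t p" using t[OF that] by linarith
    show "0 < t p / (1 - 2 * t p)" using t[OF that] pos by simp
    have "t p \<le> 2 * t p * (1 - 2 * t p)"
      using mult_left_mono[of "t p" "1 / 4" "4 * t p"] t[OF that] by (simp add: algebra_simps)
    then show "t p / (1 - 2 * t p) \<le> 2 * t p" using pos by (simp add: pos_divide_le_eq)
  qed
  have two_t: "2 / (real p)\<^sup>2 = 2 * t p" for p by (simp add: t_def)
  have c1: "convergent_prod (\<lambda>p. if prime p \<and> True then 1 - 2 / (real p)\<^sup>2 else 1)"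
  proof (rule convergent_prod_primes)
    fix p :: nat assume "prime p"
    from t[OF this] show "\<bar>1 - 2 / (real p)\<^sup>2 - 1\<bar> \<le> 2 / (real p)\<^sup>2" "1 - 2 / (real p)\<^sup>2 > 0"
      unfolding two_t by auto
  qed
  have c2: "convergent_prod (\<lambda>p. if prime p \<and> P p then 1 + 1 / ((real p)\<^sup>2 - 2) else 1)"
  proof (rule convergent_prod_primes)
    fix p :: nat assume p: "prime p"
    show "\<bar>1 + 1 / ((real p)\<^sup>2 - 2) - 1\<bar> \<le> 2 / (real p)\<^sup>2" "1 + 1 / ((real p)\<^sup>2 - 2) > 0"
      using dvd_bounds[OF p] unfolding two_t dvd_factor[OF p] by linarith+
  qed
  have "xi (2::real) = (\<Prod>p. if prime p \<and> True then 1 - 2 / (real p)\<^sup>2 else 1)"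
    unfolding xi_def prime_prod_def
    by (intro prodinf_cong) (auto simp: powr_numeral dest: prime_gt_0_nat)
  then have "xi 2 * prime_prod P (\<lambda>p. 1 + 1 / ((real p)\<^sup>2 - 2)) =
      (\<Prod>p. (if prime p \<and> True then 1 - 2 / (real p)\<^sup>2 else 1) *
        (if prime p \<and> P p then 1 + 1 / ((real p)\<^sup>2 - 2) else 1))"
    unfolding prime_prod_def using prodinf_mult[OF c1 c2] by simp
  also have "\<dots> = prime_prod (\<lambda>p. True) (local_density q)"
    unfolding prime_prod_def
  proof (intro prodinf_cong)
    fix p :: nat
    show "(if prime p \<and> True then 1 - 2 / (real p)\<^sup>2 else 1) *
        (if prime p \<and> P p then 1 + 1 / ((real p)\<^sup>2 - 2) else 1) =
        (if prime p \<and> True then local_density q p else 1)"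
    proof (cases "prime p")
      case True
      have "1 - 2 * t p \<noteq> 0" using t[OF True] by linarith
      then have "(1 - 2 / (real p)\<^sup>2) * (1 + 1 / ((real p)\<^sup>2 - 2)) = 1 - 2 / (real p)\<^sup>2 + 1 / (real p)\<^sup>2"
        unfolding dvd_factor[OF True] two_t t_def[symmetric] by (simp add: field_simps)
      then show ?thesis using True assms[OF True] by (simp add: local_density_def)
    qed simp
  qed
  finally show ?thesis ..
qed

section \<open>Counting visible pairs\<close>

definition visible_pair_count :: "(real^2) set \<Rightarrow> real^2 \<Rightarrow> real \<Rightarrow> nat" where
  "visible_pair_count \<Gamma> a R = card {x \<in> visible_points \<Gamma>. x - a \<in> visible_points \<Gamma> \<and> norm x < R}"

text \<open>
  The Moebius expansion of \<open>visible_pair_count\<close> (expanded only in \<open>l\<close> if \<open>a = 0\<close>), with the divisors \<open>l\<close> of the content of \<open>x\<close> cut at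
  \<open>T\<close> and the divisors \<open>m\<close> of the content of \<open>x - a\<close> cut at \<open>y\<close>.
\<close>

definition truncated_count :: "(real^2) set \<Rightarrow> real^2 \<Rightarrow> real \<Rightarrow> nat \<Rightarrow> nat \<Rightarrow> real" where
  "truncated_count \<Gamma> a R T y = (\<Sum>l=1..T. \<Sum>m=1..y.
     moebius_mu l * shift_weight (lattice_content \<Gamma> a) m *
     real (card {x \<in> \<Gamma>. norm x < R \<and> l dvd lattice_content \<Gamma> x \<and> m dvd lattice_content \<Gamma> (x - a)}))"

lemma truncated_count_eq_sum:
  assumes "is_lattice \<Gamma>"
  shows "truncated_count \<Gamma> a R T y = (\<Sum>x | x \<in> \<Gamma> \<and> norm x < R.
    (\<Sum>l | l \<in> {1..T} \<and> l dvd lattice_content \<Gamma> x. moebius_mu l) *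
    (\<Sum>m | m \<in> {1..y} \<and> m dvd lattice_content \<Gamma> (x - a). shift_weight (lattice_content \<Gamma> a) m))"
proof -
  define X where "X = {x \<in> \<Gamma>. norm x < R}"
  have X: "finite X" using finite_lattice_ball[OF assms, of 0 R] by (simp add: X_def)
  define u where "u l x = (if l dvd lattice_content \<Gamma> x then 1 else 0 :: real)" for l x
  define v where "v m x = (if m dvd lattice_content \<Gamma> (x - a) then 1 else 0 :: real)" for m x
  define \<alpha> where "\<alpha> = shift_weight (lattice_content \<Gamma> a)"
  have card: "real (card {x \<in> \<Gamma>. norm x < R \<and> l dvd lattice_content \<Gamma> x \<and> m dvd lattice_content \<Gamma> (x - a)})
      = (\<Sum>x\<in>X. u l x * v m x)" for l m
  proof -
    have "(\<Sum>x\<in>X. u l x * v m x) =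
        (\<Sum>x\<in>X. if l dvd lattice_content \<Gamma> x \<and> m dvd lattice_content \<Gamma> (x - a) then 1 else 0)"
      by (intro sum.cong) (auto simp: u_def v_def)
    also have "\<dots> = real (card {x \<in> X. l dvd lattice_content \<Gamma> x \<and> m dvd lattice_content \<Gamma> (x - a)})"
      using X by (simp add: sum.If_cases Int_def)
    finally show ?thesis by (simp add: X_def conj_assoc)
  qed
  have "truncated_count \<Gamma> a R T y = (\<Sum>l=1..T. \<Sum>m=1..y. \<Sum>x\<in>X. (moebius_mu l * u l x) * (\<alpha> m * v m x))"
    unfolding truncated_count_def card \<alpha>_def by (simp add: sum_distrib_left mult_ac)
  also have "\<dots> = (\<Sum>l=1..T. \<Sum>x\<in>X. \<Sum>m=1..y. (moebius_mu l * u l x) * (\<alpha> m * v m x))"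
    by (intro sum.cong refl sum.swap)
  also have "\<dots> = (\<Sum>x\<in>X. \<Sum>l=1..T. \<Sum>m=1..y. (moebius_mu l * u l x) * (\<alpha> m * v m x))"
    by (rule sum.swap)
  also have "\<dots> = (\<Sum>x\<in>X. (\<Sum>l=1..T. moebius_mu l * u l x) * (\<Sum>m=1..y. \<alpha> m * v m x))"
    by (simp add: sum_product)
  also have "\<dots> = (\<Sum>x\<in>X. (\<Sum>l | l \<in> {1..T} \<and> l dvd lattice_content \<Gamma> x. moebius_mu l) *
      (\<Sum>m | m \<in> {1..y} \<and> m dvd lattice_content \<Gamma> (x - a). \<alpha> m))"
  proof -
    have "(\<Sum>l=1..T. moebius_mu l * u l x) = (\<Sum>l | l \<in> {1..T} \<and> l dvd lattice_content \<Gamma> x. moebius_mu l)" for x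
      by (rule sum.mono_neutral_cong_right) (auto simp: u_def)
    moreover have "(\<Sum>m=1..y. \<alpha> m * v m x) = (\<Sum>m | m \<in> {1..y} \<and> m dvd lattice_content \<Gamma> (x - a). \<alpha> m)" for x
      by (rule sum.mono_neutral_cong_right) (auto simp: v_def)
    ultimately show ?thesis by simp
  qed
  finally show ?thesis by (simp add: X_def \<alpha>_def)
qed

lemma abs_sum_le_card:
  fixes f :: "'a \<Rightarrow> real"
  assumes "\<And>x. \<bar>f x\<bar> \<le> 1"
  shows "\<bar>sum f A\<bar> \<le> real (card A)"
proof -
  have "\<bar>sum f A\<bar> \<le> (\<Sum>x\<in>A. 1)" by (rule order.trans[OF sum_abs sum_mono]) (rule assms)
  then show ?thesis by simp
qed

text \<open>
  Once \<open>T\<close> exceeds \<open>B * R\<close>, the sum over \<open>l\<close> contains all divisors and is exactly the indicator of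
  visibility of \<open>x\<close>, unless \<open>x = 0\<close>. As this indicator is at most 1, the divisors \<open>m > y\<close> contribute
  no more than their number, and summed over \<open>x\<close> this is a sum over \<open>m > y\<close> of counts of short
  nonzero points of \<open>m\<Gamma>\<close>. This fails at \<open>x = 0\<close> and \<open>x = a\<close>, where \<open>x\<close> or \<open>x - a\<close> is divisible by
  every number; each of these two points contributes at most \<open>T * y\<close>.
\<close>

lemma visible_pair_truncation:
  assumes lat: "is_lattice \<Gamma>" and a: "a \<in> \<Gamma>"
  obtains B C where "B > 0" "C > 0" "\<And>R T y. R \<ge> 1 \<Longrightarrow> B * R \<le> real T \<Longrightarrow> y \<ge> 1 \<Longrightarrow>
    \<bar>real (visible_pair_count \<Gamma> a R) - truncated_count \<Gamma> a R T y\<bar> \<le> C * (R\<^sup>2 / real y + real T * real y)"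
proof -
  define ct where "ct = lattice_content \<Gamma>"
  define q where "q = ct a"
  have ct0: "ct x = 0 \<longleftrightarrow> x = 0" if "x \<in> \<Gamma>" for x
    using cont_eq_content(2)[OF lat that] by (simp add: ct_def)
  have q0: "q = 0 \<longleftrightarrow> a = 0" using ct0[OF a] by (simp add: q_def)
  obtain B where B: "B > 0" "\<And>l R. l > 0 \<Longrightarrow> R \<ge> 0 \<Longrightarrow>
      real (card {x \<in> \<Gamma>. x \<noteq> 0 \<and> norm x < R \<and> l dvd lattice_content \<Gamma> x}) \<le> B * (R / real l)\<^sup>2"
    "\<And>l x. l > 0 \<Longrightarrow> x \<in> \<Gamma> \<Longrightarrow> x \<noteq> 0 \<Longrightarrow> l dvd lattice_content \<Gamma> x \<Longrightarrow> real l \<le> B * norm x"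
    using short_multiple_count[OF lat] by blast
  define C where "C = B * (1 + norm a)\<^sup>2 + 2"
  have C: "C > 0" unfolding C_def using B(1) by (intro add_nonneg_pos) auto
  have "\<bar>real (visible_pair_count \<Gamma> a R) - truncated_count \<Gamma> a R T y\<bar> \<le> C * (R\<^sup>2 / real y + real T * real y)"
    if R: "R \<ge> 1" and T: "B * R \<le> real T" and y: "y \<ge> 1" for R T y
  proof -
    define X where "X = {x \<in> \<Gamma>. norm x < R}"
    define X' where "X' = X - {0, a}"
    have X: "finite X" using finite_lattice_ball[OF lat, of 0 R] by (simp add: X_def)
    then have X': "finite X'" by (simp add: X'_def)
    \<comment> \<open>Indicators \<open>u\<close>, \<open>v\<close> of the two conditions, and their truncated Moebius sums \<open>f\<close>, \<open>g\<close>.\<close>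
    define u where "u x = (if ct x = 1 then 1 else 0 :: real)" for x
    define v where "v x = (if q = 0 \<or> ct (x - a) = 1 then 1 else 0 :: real)" for x
    define f where "f x = (\<Sum>l | l \<in> {1..T} \<and> l dvd ct x. moebius_mu l)" for x
    define g where "g x = (\<Sum>m | m \<in> {1..y} \<and> m dvd ct (x - a). shift_weight q m)" for x
    have N: "real (visible_pair_count \<Gamma> a R) = (\<Sum>x\<in>X'. u x * v x)"
    proof -
      have "(\<Sum>x\<in>X'. u x * v x) = (\<Sum>x\<in>X. u x * v x)"
        using X ct0[OF lattice_zero[OF lat]] q0
        by (intro sum.mono_neutral_left) (auto simp: X'_def u_def v_def)
      also have "\<dots> = (\<Sum>x\<in>X. if ct x = 1 \<and> (q = 0 \<or> ct (x - a) = 1) then 1 else 0)"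
        by (intro sum.cong) (auto simp: u_def v_def)
      also have "\<dots> = real (card {x \<in> X. ct x = 1 \<and> (q = 0 \<or> ct (x - a) = 1)})"
        using X by (simp add: sum.If_cases Int_def)
      also have "{x \<in> X. ct x = 1 \<and> (q = 0 \<or> ct (x - a) = 1)} =
          {x \<in> visible_points \<Gamma>. x - a \<in> visible_points \<Gamma> \<and> norm x < R}"
        using q0 a lattice_diff[OF lat] by (auto simp: visible_iff[OF lat] X_def ct_def)
      finally show ?thesis by (simp add: visible_pair_count_def)
    qed
    have S: "truncated_count \<Gamma> a R T y = (\<Sum>x\<in>X. f x * g x)"
      unfolding truncated_count_eq_sum[OF lat] by (simp add: X_def f_def g_def q_def ct_def)
    have fu: "f x = u x" if x: "x \<in> X'" for x
    proof -
      have x': "x \<in> \<Gamma>" "x \<noteq> 0" "norm x < R" using x by (auto simp: X'_def X_def)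
      have pos: "ct x > 0" using ct0 x' by auto
      have "l \<le> T" if "l dvd ct x" for l
      proof -
        have "l > 0" using that pos by (auto intro: Nat.gr0I)
        then have "real l \<le> B * norm x" using B(3) x' that by (simp add: ct_def)
        also have "\<dots> \<le> B * R" using B(1) x' by (intro mult_left_mono) auto
        finally show ?thesis using T by linarith
      qed
      then have "{l. l \<in> {1..T} \<and> l dvd ct x} = {l. l dvd ct x}"
        using pos by (auto simp: Suc_le_eq intro: Nat.gr0I)
      then show ?thesis using sum_moebius_mu_divisors[OF pos] by (simp add: f_def u_def)
    qed
    \<comment> \<open>All divisors of the content of \<open>x - a\<close> are at most \<open>M\<close>, so \<open>e x\<close> counts those that were cut off.\<close>
    define M where "M = nat \<lceil>B * (R + norm a)\<rceil>"
    define e where "e x = real (card {m \<in> {Suc y..M}. m dvd ct (x - a)})" for x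
    have vg: "\<bar>v x - g x\<bar> \<le> e x" if x: "x \<in> X'" for x
    proof -
      have x': "x - a \<in> \<Gamma>" "x - a \<noteq> 0" "norm x < R"
        using x lattice_diff[OF lat _ a] by (auto simp: X'_def X_def)
      have pos: "ct (x - a) > 0" using ct0[OF x'(1)] x' by auto
      have le_M: "m \<le> M" if "m dvd ct (x - a)" for m
      proof -
        have "m > 0" using that pos by (auto intro: Nat.gr0I)
        then have "real m \<le> B * norm (x - a)" using B(3) x' that by (simp add: ct_def)
        also have "\<dots> \<le> B * (R + norm a)"
          using B(1) x' norm_triangle_ineq4[of x a] by (intro mult_left_mono) auto
        finally show ?thesis unfolding M_def by linarith
      qed
      define small large where "small = {m. m \<in> {1..y} \<and> m dvd ct (x - a)}"
        and "large = {m \<in> {Suc y..M}. m dvd ct (x - a)}"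
      have sl: "{d. d dvd ct (x - a)} = small \<union> large"
      proof (intro equalityI subsetI)
        fix d assume "d \<in> {d. d dvd ct (x - a)}"
        then show "d \<in> small \<union> large"
          using pos le_M[of d] by (cases "d = 0") (auto simp: small_def large_def)
      qed (auto simp: small_def large_def)
      have "finite small" "finite large" "small \<inter> large = {}" by (auto simp: small_def large_def)
      from sum.union_disjoint[OF this, of "shift_weight q"]
      have "(\<Sum>d | d dvd ct (x - a). shift_weight q d) =
          g x + (\<Sum>m\<in>{m \<in> {Suc y..M}. m dvd ct (x - a)}. shift_weight q m)"
        unfolding sl g_def small_def large_def .
      then have "v x - g x = (\<Sum>m\<in>{m \<in> {Suc y..M}. m dvd ct (x - a)}. shift_weight q m)"
        using sum_shift_weight_divisors[OF pos, of q] by (simp add: v_def)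
      then show ?thesis unfolding e_def using abs_sum_le_card[OF abs_shift_weight_le] by simp
    qed
    have fg_le: "\<bar>f x * g x\<bar> \<le> real T * real y" for x
    proof -
      have "\<bar>f x\<bar> \<le> real (card {l. l \<in> {1..T} \<and> l dvd ct x})" "\<bar>g x\<bar> \<le> real (card {m. m \<in> {1..y} \<and> m dvd ct (x - a)})"
        unfolding f_def g_def by (intro abs_sum_le_card abs_moebius_mu_le abs_shift_weight_le)+
      moreover have "card {l. l \<in> {1..T} \<and> l dvd ct x} \<le> card {1..T}" "card {m. m \<in> {1..y} \<and> m dvd ct (x - a)} \<le> card {1..y}"
        by (intro card_mono; auto)+
      ultimately have "\<bar>f x\<bar> \<le> real T" "\<bar>g x\<bar> \<le> real y" by simp_all
      then show ?thesis unfolding abs_mult by (intro mult_mono) auto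
    qed
    have split: "\<bar>(\<Sum>x\<in>X. f x * g x) - (\<Sum>x\<in>X'. f x * g x)\<bar> \<le> 2 * (real T * real y)"
    proof -
      have "(\<Sum>x\<in>X. f x * g x) - (\<Sum>x\<in>X'. f x * g x) = (\<Sum>x\<in>X \<inter> {0, a}. f x * g x)"
        using sum.Int_Diff[OF X, of "\<lambda>x. f x * g x" "{0, a}"] by (simp add: X'_def)
      also have "\<bar>\<dots>\<bar> \<le> (\<Sum>x\<in>X \<inter> {0, a}. real T * real y)"
        by (rule order.trans[OF sum_abs sum_mono]) (rule fg_le)
      also have "\<dots> = real (card (X \<inter> {0, a})) * (real T * real y)" by simp
      also have "\<dots> \<le> 2 * (real T * real y)"
      proof (rule mult_right_mono)
        have "card (X \<inter> {0, a}) \<le> card {0, a}" by (rule card_mono) auto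
        also have "\<dots> \<le> 2" by (cases "a = 0") auto
        finally show "real (card (X \<inter> {0, a})) \<le> 2" by simp
      qed simp
      finally show ?thesis .
    qed
    have "\<bar>(\<Sum>x\<in>X'. u x * v x) - (\<Sum>x\<in>X'. f x * g x)\<bar> = \<bar>\<Sum>x\<in>X'. u x * (v x - g x)\<bar>"
      by (simp add: fu sum_subtractf right_diff_distrib)
    also have "\<dots> \<le> (\<Sum>x\<in>X'. e x)"
    proof (rule order.trans[OF sum_abs sum_mono])
      fix x assume "x \<in> X'"
      then show "\<bar>u x * (v x - g x)\<bar> \<le> e x" using vg[of x] by (auto simp: u_def)
    qed
    also have "\<dots> = (\<Sum>m=Suc y..M. real (card {x \<in> X'. m dvd ct (x - a)}))"
    proof -
      have "(\<Sum>x\<in>X'. e x) = (\<Sum>x\<in>X'. \<Sum>m=Suc y..M. if m dvd ct (x - a) then 1 else 0)"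
        by (simp add: e_def sum.If_cases Int_def)
      also have "\<dots> = (\<Sum>m=Suc y..M. \<Sum>x\<in>X'. if m dvd ct (x - a) then 1 else 0)" by (rule sum.swap)
      also have "\<dots> = (\<Sum>m=Suc y..M. real (card {x \<in> X'. m dvd ct (x - a)}))"
        using X' by (simp add: sum.If_cases Int_def)
      finally show ?thesis .
    qed
    also have "\<dots> \<le> (\<Sum>m=Suc y..M. B * (R + norm a)\<^sup>2 * (1 / (real m)\<^sup>2))"
    proof (rule sum_mono)
      fix m assume m: "m \<in> {Suc y..M}"
      define Z where "Z = {z \<in> \<Gamma>. z \<noteq> 0 \<and> norm z < R + norm a \<and> m dvd lattice_content \<Gamma> z}"
      have "finite Z"
        unfolding Z_def by (rule finite_subset[OF _ finite_lattice_ball[OF lat, of 0 "R + norm a"]]) auto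
      moreover have "(\<lambda>x. x - a) ` {x \<in> X'. m dvd ct (x - a)} \<subseteq> Z"
      proof clarify
        fix x assume x: "x \<in> X'" "m dvd ct (x - a)"
        then show "x - a \<in> Z"
          using lattice_diff[OF lat _ a, of x] norm_triangle_ineq4[of x a]
          by (auto simp: Z_def X'_def X_def ct_def)
      qed
      ultimately have "card {x \<in> X'. m dvd ct (x - a)} \<le> card Z"
        by (intro card_inj_on_le[of "\<lambda>x. x - a"]) (auto simp: inj_on_def)
      also have "real (card Z) \<le> B * ((R + norm a) / real m)\<^sup>2"
        unfolding Z_def using m R by (intro B(2)) auto
      finally show "real (card {x \<in> X'. m dvd ct (x - a)}) \<le> B * (R + norm a)\<^sup>2 * (1 / (real m)\<^sup>2)"
        by (simp add: power_divide)
    qed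
    also have "\<dots> = B * (R + norm a)\<^sup>2 * (\<Sum>m=Suc y..M. 1 / (real m)\<^sup>2)"
      by (simp only: sum_distrib_left)
    also have "\<dots> \<le> B * (R + norm a)\<^sup>2 * (1 / real y)"
      using B(1) by (intro mult_left_mono sum_inverse_squares_le y) auto
    also have "\<dots> \<le> B * ((1 + norm a) * R)\<^sup>2 * (1 / real y)"
    proof (intro mult_right_mono mult_left_mono power_mono)
      show "R + norm a \<le> (1 + norm a) * R"
        using mult_left_mono[OF R norm_ge_zero[of a]] by (simp add: algebra_simps)
    qed (use R B(1) in auto)
    also have "\<dots> = B * (1 + norm a)\<^sup>2 * (R\<^sup>2 / real y)" by (simp add: power_mult_distrib)
    finally have "\<bar>(\<Sum>x\<in>X'. u x * v x) - (\<Sum>x\<in>X'. f x * g x)\<bar> \<le> B * (1 + norm a)\<^sup>2 * (R\<^sup>2 / real y)" .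
    then have "\<bar>real (visible_pair_count \<Gamma> a R) - truncated_count \<Gamma> a R T y\<bar> \<le>
        B * (1 + norm a)\<^sup>2 * (R\<^sup>2 / real y) + 2 * (real T * real y)"
      unfolding N S using split by linarith
    also have "\<dots> \<le> C * (R\<^sup>2 / real y) + C * (real T * real y)"
      unfolding C_def using B(1) by (intro add_mono mult_right_mono) auto
    finally show ?thesis by (simp add: distrib_left)
  qed
  with B(1) C show ?thesis by (rule that)
qed

lemma sum_three_halves_bounded:
  obtains W where "W > 0" "\<And>N. (\<Sum>n=1..N. 1 / (real n * sqrt (real n))) \<le> W"
proof -
  have "summable (\<lambda>n. real n powr - (3 / 2))" by (simp add: summable_real_powr_iff)
  moreover have "real n powr - (3 / 2) = 1 / (real n * sqrt (real n))" for n
  proof (cases "n = 0")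
    case False
    have "real n powr (3 / 2) = real n powr (1 + 1 / 2)" by simp
    also have "\<dots> = real n * sqrt (real n)" using False by (simp only: powr_add) (simp add: powr_half_sqrt)
    finally show ?thesis by (simp only: powr_minus_divide)
  qed simp
  ultimately have s: "summable (\<lambda>n. 1 / (real n * sqrt (real n)))" by (simp only:)
  define W where "W = 1 + (\<Sum>n. 1 / (real n * sqrt (real n)))"
  have "(\<Sum>n=1..N. 1 / (real n * sqrt (real n))) \<le> W" for N
    using sum_le_suminf[OF s, of "{1..N}"] unfolding W_def by force
  moreover have "W > 0" unfolding W_def by (intro add_pos_nonneg suminf_nonneg s) auto
  ultimately show ?thesis using that by blast
qed

text \<open>
  Applied to \<open>t = R / (l m)\<close>, this trades the boundary error of a residue class, whose sum over
  \<open>l\<close> and \<open>m\<close> carries logarithms, for a constant and a term with a convergent double series.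
\<close>

lemma le_one_plus_three_halves:
  fixes t :: real
  assumes "t \<ge> 0"
  shows "t \<le> 1 + t * sqrt t"
proof (cases "t \<le> 1")
  case False
  then have "t * 1 \<le> t * sqrt t" by (intro mult_left_mono) auto
  then show ?thesis by simp
qed (use assms in \<open>simp add: add_increasing2\<close>)

text \<open>
  Each summand is the area term plus a boundary error of at most a multiple of
  \<open>1 + R / lcm l m\<close>, where \<open>lcm l m\<close> and \<open>l m\<close> agree up to the bounded factor \<open>gcd l m\<close>. Completing
  the sum of the area terms to the full series costs the tail of the double series.
\<close>

lemma truncated_count_asymptotic:
  assumes lat: "is_lattice \<Gamma>" and a: "a \<in> \<Gamma>"
  obtains C where "C > 0" "\<And>R T y. R \<ge> 1 \<Longrightarrow> T \<ge> 1 \<Longrightarrow> y \<ge> 1 \<Longrightarrow>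
    \<bar>truncated_count \<Gamma> a R T y - pi * R\<^sup>2 * dens \<Gamma> * infsum (pair_density (lattice_content \<Gamma> a)) UNIV\<bar>
      \<le> C * (R\<^sup>2 * (1 / real T + 1 / real y) + real T * real y + R * sqrt R)"
proof -
  define q where "q = lattice_content \<Gamma> a"
  define K where "K = content_bound q"
  have K: "K \<ge> 1" by (simp add: K_def content_bound_def)
  obtain C1 where C1: "C1 > 0" "\<And>c L R. c \<in> \<Gamma> \<Longrightarrow> L > 0 \<Longrightarrow> R \<ge> 0 \<Longrightarrow>
    \<bar>real (card {x \<in> \<Gamma>. norm x < R \<and> L dvd lattice_content \<Gamma> (x - c)})
       - pi * R\<^sup>2 * dens \<Gamma> / (real L)\<^sup>2\<bar> \<le> C1 * (R / real L + 1)"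
    using residue_class_count[OF lat] by blast
  obtain C2 where C2: "C2 \<ge> 0" "\<And>T y. T \<ge> 1 \<Longrightarrow> y \<ge> 1 \<Longrightarrow>
    \<bar>infsum (pair_density q) UNIV - (\<Sum>z\<in>{1..T} \<times> {1..y}. pair_density q z)\<bar> \<le> C2 * (1 / real T + 1 / real y)"
    using pair_density_tail[of q] by blast
  obtain W where W: "W > 0" "\<And>N. (\<Sum>n=1..N. 1 / (real n * sqrt (real n))) \<le> W"
    using sum_three_halves_bounded by blast
  define C where "C = pi * \<bar>dens \<Gamma>\<bar> * C2 + 2 * C1 * K + C1 * K * W\<^sup>2"
  have C: "C > 0" unfolding C_def using C1(1) C2(1) K W(1) by (intro add_nonneg_pos mult_pos_pos) auto
  have "\<bar>truncated_count \<Gamma> a R T y - pi * R\<^sup>2 * dens \<Gamma> * infsum (pair_density q) UNIV\<bar>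
      \<le> C * (R\<^sup>2 * (1 / real T + 1 / real y) + real T * real y + R * sqrt R)"
    if R: "R \<ge> 1" and T: "T \<ge> 1" and y: "y \<ge> 1" for R T y
  proof -
    define D where "D = pi * R\<^sup>2 * dens \<Gamma>"
    define n where "n l m = real (card {x \<in> \<Gamma>. norm x < R \<and> l dvd lattice_content \<Gamma> x \<and>
      m dvd lattice_content \<Gamma> (x - a)})" for l m
    define h where "h n = 1 / (real n * sqrt (real n))" for n
    have est: "\<bar>moebius_mu l * shift_weight q m * n l m - D * pair_density q (l, m)\<bar> \<le>
        C1 * K * (2 + R * sqrt R * (h l * h m))" (is "_ \<le> ?E") if l: "l > 0" and m: "m > 0" for l m
    proof -
      have E: "0 \<le> ?E" using C1(1) K R by (simp add: h_def)
      consider "shift_weight q m = 0" | "\<not> gcd l m dvd q" | "shift_weight q m \<noteq> 0" "gcd l m dvd q" by blast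
      then show ?thesis
      proof cases
        case 1
        then show ?thesis using E by (simp add: pair_density_def)
      next
        case 2
        then have "{x \<in> \<Gamma>. norm x < R \<and> l dvd lattice_content \<Gamma> x \<and> m dvd lattice_content \<Gamma> (x - a)} = {}"
          using gcd_dvd_content[OF lat a _ l] by (auto simp: q_def)
        then have "n l m = 0" by (simp only: n_def card.empty of_nat_0)
        then show ?thesis using E 2 by (simp add: pair_density_def)
      next
        case 3
        define L where "L = lcm l m"
        have L: "L > 0" using l m by (simp add: L_def lcm_pos_nat)
        obtain c where c: "c \<in> \<Gamma>" "\<And>x. x \<in> \<Gamma> \<Longrightarrow>
            l dvd lattice_content \<Gamma> x \<and> m dvd lattice_content \<Gamma> (x - a) \<longleftrightarrow>
            L dvd lattice_content \<Gamma> (x - c)"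
          using lattice_chinese_remainder[OF lat a l m] 3(2) unfolding q_def L_def by blast
        have "n l m = real (card {x \<in> \<Gamma>. norm x < R \<and> L dvd lattice_content \<Gamma> (x - c)})"
          unfolding n_def using c(2) by (intro arg_cong[where f = real] arg_cong[where f = card]) blast
        then have nL: "\<bar>n l m - D / (real L)\<^sup>2\<bar> \<le> C1 * (R / real L + 1)"
          using C1(2)[OF c(1) L, of R] R by (simp add: D_def)
        define t where "t = R / (real l * real m)"
        have t0: "t \<ge> 0" using R by (simp add: t_def)
        \<comment> \<open>The bound \<open>K\<close> for \<open>gcd l m\<close> lets \<open>l * m\<close> replace \<open>lcm l m\<close> in the error term.\<close>
        have "real l * real m = real (gcd l m) * real L"
          unfolding L_def by (metis of_nat_mult prod_gcd_lcm_nat)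
        then have "real l * real m \<le> K * real L"
          using gcd_le_content_bound[OF 3(2,1)] by (simp add: K_def mult_right_mono)
        then have "R / (K * real L) \<le> t"
          unfolding t_def using R l m L K by (intro divide_left_mono) auto
        then have "R / real L \<le> K * t" using K L by (simp add: field_simps)
        also have "\<dots> \<le> K * (1 + t * sqrt t)"
          using K le_one_plus_three_halves[OF t0] by (intro mult_left_mono) auto
        finally have "R / real L + 1 \<le> K * (2 + t * sqrt t)" using K by (simp add: algebra_simps)
        then have "C1 * (R / real L + 1) \<le> C1 * (K * (2 + t * sqrt t))"
          using C1(1) by (intro mult_left_mono) auto
        moreover have "t * sqrt t = R * sqrt R * (h l * h m)"
          by (simp add: t_def h_def real_sqrt_divide real_sqrt_mult)
        ultimately have E': "C1 * (R / real L + 1) \<le> ?E" by (simp add: mult.assoc)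
        have "moebius_mu l * shift_weight q m * n l m - D * pair_density q (l, m) =
            (moebius_mu l * shift_weight q m) * (n l m - D / (real L)\<^sup>2)"
          using 3 by (simp add: pair_density_def L_def algebra_simps)
        also have "\<bar>\<dots>\<bar> = (\<bar>moebius_mu l\<bar> * \<bar>shift_weight q m\<bar>) * \<bar>n l m - D / (real L)\<^sup>2\<bar>"
          by (simp add: abs_mult)
        also have "\<dots> \<le> (1 * 1) * (C1 * (R / real L + 1))"
          using nL abs_moebius_mu_le abs_shift_weight_le by (intro mult_mono) auto
        finally show ?thesis using E' by simp
      qed
    qed
    have "truncated_count \<Gamma> a R T y - D * (\<Sum>z\<in>{1..T} \<times> {1..y}. pair_density q z) =
        (\<Sum>l=1..T. \<Sum>m=1..y. moebius_mu l * shift_weight q m * n l m - D * pair_density q (l, m))"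
      by (simp add: truncated_count_def n_def q_def sum.cartesian_product' sum_subtractf sum_distrib_left)
    also have "\<bar>\<dots>\<bar> \<le> (\<Sum>l=1..T. \<Sum>m=1..y. C1 * K * (2 + R * sqrt R * (h l * h m)))"
      by (intro order.trans[OF sum_abs] sum_mono est) auto
    also have "\<dots> = C1 * K * (2 * (real T * real y) + R * sqrt R * ((\<Sum>l=1..T. h l) * (\<Sum>m=1..y. h m)))"
    proof -
      have "(\<Sum>l=1..T. \<Sum>m=1..y. C1 * K * (2 + R * sqrt R * (h l * h m))) =
          C1 * K * (\<Sum>l=1..T. \<Sum>m=1..y. 2 + R * sqrt R * (h l * h m))"
        by (simp only: sum_distrib_left)
      also have "(\<Sum>l=1..T. \<Sum>m=1..y. 2 + R * sqrt R * (h l * h m)) =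
          2 * (real T * real y) + R * sqrt R * (\<Sum>l=1..T. \<Sum>m=1..y. h l * h m)"
        by (simp add: sum.distrib flip: sum_distrib_left)
      finally show ?thesis by (simp only: sum_product)
    qed
    also have "\<dots> \<le> C1 * K * (2 * (real T * real y) + R * sqrt R * (W * W))"
      using C1(1) K R W by (intro mult_left_mono add_left_mono mult_mono)
        (auto simp: h_def intro!: sum_nonneg)
    finally have 1: "\<bar>truncated_count \<Gamma> a R T y - D * (\<Sum>z\<in>{1..T} \<times> {1..y}. pair_density q z)\<bar> \<le>
        2 * C1 * K * (real T * real y) + C1 * K * W\<^sup>2 * (R * sqrt R)"
      by (simp add: power2_eq_square algebra_simps)
    define G where "G = R\<^sup>2 * (1 / real T + 1 / real y)"
    have "\<bar>D * (\<Sum>z\<in>{1..T} \<times> {1..y}. pair_density q z) - D * infsum (pair_density q) UNIV\<bar> =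
        \<bar>D\<bar> * \<bar>infsum (pair_density q) UNIV - (\<Sum>z\<in>{1..T} \<times> {1..y}. pair_density q z)\<bar>"
      by (simp flip: right_diff_distrib add: abs_mult abs_minus_commute)
    also have "\<dots> \<le> \<bar>D\<bar> * (C2 * (1 / real T + 1 / real y))"
      using C2(2)[OF T y] by (rule mult_left_mono) simp
    also have "\<dots> = pi * \<bar>dens \<Gamma>\<bar> * C2 * G"
      by (simp add: D_def G_def abs_mult mult_ac)
    finally have 2: "\<bar>D * (\<Sum>z\<in>{1..T} \<times> {1..y}. pair_density q z) - D * infsum (pair_density q) UNIV\<bar>
        \<le> pi * \<bar>dens \<Gamma>\<bar> * C2 * G" .
    have pos: "0 \<le> pi * \<bar>dens \<Gamma>\<bar> * C2" "0 \<le> 2 * C1 * K" "0 \<le> C1 * K * W\<^sup>2"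
      using C1(1) C2(1) K by auto
    have "\<bar>truncated_count \<Gamma> a R T y - D * infsum (pair_density q) UNIV\<bar> \<le>
        pi * \<bar>dens \<Gamma>\<bar> * C2 * G + 2 * C1 * K * (real T * real y) + C1 * K * W\<^sup>2 * (R * sqrt R)"
      using 1 2 by linarith
    also have "\<dots> \<le> C * G + C * (real T * real y) + C * (R * sqrt R)"
      unfolding C_def using pos R by (intro add_mono mult_right_mono) (auto simp: G_def)
    finally show ?thesis by (simp add: D_def G_def distrib_left)
  qed
  with C show ?thesis using that unfolding q_def by blast
qed

text \<open>
  Cutting at \<open>T\<close> of order \<open>R\<close> and \<open>y\<close> of order \<open>\<surd>R\<close> makes all error terms \<open>O(R \<surd>R)\<close>.
\<close>

lemma visible_pair_count_asymptotic:
  assumes lat: "is_lattice \<Gamma>" and a: "a \<in> \<Gamma>"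
  obtains C where "C > 0" "\<And>R. R \<ge> 1 \<Longrightarrow>
    \<bar>real (visible_pair_count \<Gamma> a R)
       - pi * R\<^sup>2 * dens \<Gamma> * infsum (pair_density (lattice_content \<Gamma> a)) UNIV\<bar> \<le> C * (R * sqrt R)"
proof -
  obtain B C1 where C1: "B > 0" "C1 > 0" "\<And>R T y. R \<ge> 1 \<Longrightarrow> B * R \<le> real T \<Longrightarrow> y \<ge> 1 \<Longrightarrow>
    \<bar>real (visible_pair_count \<Gamma> a R) - truncated_count \<Gamma> a R T y\<bar> \<le> C1 * (R\<^sup>2 / real y + real T * real y)"
    using visible_pair_truncation[OF assms] by blast
  obtain C2 where C2: "C2 > 0" "\<And>R T y. R \<ge> 1 \<Longrightarrow> T \<ge> 1 \<Longrightarrow> y \<ge> 1 \<Longrightarrow>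
    \<bar>truncated_count \<Gamma> a R T y - pi * R\<^sup>2 * dens \<Gamma> * infsum (pair_density (lattice_content \<Gamma> a)) UNIV\<bar>
      \<le> C2 * (R\<^sup>2 * (1 / real T + 1 / real y) + real T * real y + R * sqrt R)"
    using truncated_count_asymptotic[OF assms] by blast
  define C where "C = C1 * (1 + (B + 2) * 2) + C2 * (2 + (B + 2) * 2 + 1)"
  have C: "C > 0" unfolding C_def using C1(1,2) C2(1) by (intro add_pos_pos mult_pos_pos) auto
  have "\<bar>real (visible_pair_count \<Gamma> a R)
       - pi * R\<^sup>2 * dens \<Gamma> * infsum (pair_density (lattice_content \<Gamma> a)) UNIV\<bar> \<le> C * (R * sqrt R)"
    if R: "R \<ge> 1" for R
  proof -
    define T where "T = nat \<lceil>max B 1 * R\<rceil>"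
    define y where "y = nat \<lceil>sqrt R\<rceil>"
    define Q where "Q = R * sqrt R"
    have sR: "1 \<le> sqrt R" using R by simp
    then have sRle: "sqrt R * 1 \<le> sqrt R * sqrt R" by (intro mult_left_mono) auto
    have sq: "sqrt R * sqrt R = R" using R by simp
    have BR: "B * R \<le> max B 1 * R" "1 * R \<le> max B 1 * R" "max B 1 * R \<le> (B + 1) * R"
      using R C1(1) by (intro mult_right_mono; simp)+
    have T: "max B 1 * R \<le> real T" "real T \<le> max B 1 * R + 1"
      unfolding T_def using BR(2) R by linarith+
    have y: "sqrt R \<le> real y" "real y \<le> 2 * sqrt R" "y \<ge> 1"
      unfolding y_def using sR by linarith+
    have T1: "B * R \<le> real T" "sqrt R \<le> real T" "real T \<le> (B + 2) * R" "T \<ge> 1"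
    proof -
      show "B * R \<le> real T" using T BR by linarith
      show "sqrt R \<le> real T" using T BR sRle sq by linarith
      then show "T \<ge> 1" using sR by linarith
      have "(B + 2) * R = (B + 1) * R + R" by (simp add: algebra_simps)
      then show "real T \<le> (B + 2) * R" using T BR R by linarith
    qed
    have div: "R\<^sup>2 * (1 / N) \<le> Q" if N: "sqrt R \<le> N" for N
    proof -
      have "R\<^sup>2 * (1 / N) \<le> R\<^sup>2 * (1 / sqrt R)"
        using N sR less_le_trans[of 0 "sqrt R" N]
        by (intro mult_left_mono divide_left_mono mult_pos_pos) auto
      also have "\<dots> = R * (R / sqrt R)" by (simp add: power2_eq_square)
      also have "R / sqrt R = sqrt R" using R by (intro real_div_sqrt) simp
      also have "R * sqrt R = Q" by (simp add: Q_def)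
      finally show ?thesis .
    qed
    have Ty: "real T * real y \<le> (B + 2) * 2 * Q"
    proof -
      have "real T * real y \<le> ((B + 2) * R) * (2 * sqrt R)"
        using T1 y R C1(1) by (intro mult_mono) auto
      then show ?thesis by (simp add: Q_def mult_ac)
    qed
    have "\<bar>real (visible_pair_count \<Gamma> a R) - truncated_count \<Gamma> a R T y\<bar> \<le> C1 * (R\<^sup>2 / real y + real T * real y)"
      by (rule C1(3)[OF R T1(1) y(3)])
    also have "\<dots> \<le> C1 * (Q + (B + 2) * 2 * Q)"
      using div[OF y(1)] Ty C1(2) by (intro mult_left_mono add_mono) auto
    also have "\<dots> = C1 * (1 + (B + 2) * 2) * Q" by (simp add: algebra_simps)
    finally have 1: "\<bar>real (visible_pair_count \<Gamma> a R) - truncated_count \<Gamma> a R T y\<bar> \<le> C1 * (1 + (B + 2) * 2) * Q" .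
    have "\<bar>truncated_count \<Gamma> a R T y - pi * R\<^sup>2 * dens \<Gamma> * infsum (pair_density (lattice_content \<Gamma> a)) UNIV\<bar>
      \<le> C2 * (R\<^sup>2 * (1 / real T + 1 / real y) + real T * real y + R * sqrt R)"
      by (rule C2(2)[OF R T1(4) y(3)])
    also have "\<dots> \<le> C2 * ((Q + Q) + (B + 2) * 2 * Q + Q)"
      unfolding distrib_left[of "R\<^sup>2"] using div[OF y(1)] div[OF T1(2)] Ty C2(1)
      by (intro mult_left_mono add_mono) (auto simp: Q_def)
    also have "\<dots> = C2 * (2 + (B + 2) * 2 + 1) * Q" by (simp add: algebra_simps)
    finally have 2: "\<bar>truncated_count \<Gamma> a R T y - pi * R\<^sup>2 * dens \<Gamma> *
      infsum (pair_density (lattice_content \<Gamma> a)) UNIV\<bar> \<le> C2 * (2 + (B + 2) * 2 + 1) * Q" .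
    have "C * Q = C1 * (1 + (B + 2) * 2) * Q + C2 * (2 + (B + 2) * 2 + 1) * Q"
      unfolding C_def by (rule distrib_right)
    then show ?thesis using 1 2 unfolding Q_def by linarith
  qed
  with C show ?thesis by (rule that)
qed

section \<open>Weighted point masses as tempered distributions\<close>

lemma iter_deriv_linear:
  assumes "smooth \<phi>" "smooth \<psi>"
  shows "iter_deriv is (\<lambda>x. \<phi> x + \<psi> x) = (\<lambda>x. iter_deriv is \<phi> x + iter_deriv is \<psi> x)"
    and "iter_deriv is (\<lambda>x. c * \<phi> x) = (\<lambda>x. c * iter_deriv is \<phi> x)"
proof (induction "is")
  case Nil
  show "iter_deriv [] (\<lambda>x. \<phi> x + \<psi> x) = (\<lambda>x. iter_deriv [] \<phi> x + iter_deriv [] \<psi> x)"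
    "iter_deriv [] (\<lambda>x. c * \<phi> x) = (\<lambda>x. c * iter_deriv [] \<phi> x)"
    by (simp_all add: iter_deriv_def)
next
  case (Cons i "is")
  have der: "(iter_deriv is \<theta> has_derivative frechet_derivative (iter_deriv is \<theta>) (at x)) (at x)"
    if "smooth \<theta>" for \<theta> x
    using that by (simp add: smooth_def differentiable_on_def frechet_derivative_works)
  have step: "iter_deriv (i # is) \<theta> = partial_deriv i (iter_deriv is \<theta>)" for \<theta>
    by (simp add: iter_deriv_def)
  show "iter_deriv (i # is) (\<lambda>x. \<phi> x + \<psi> x) =
      (\<lambda>x. iter_deriv (i # is) \<phi> x + iter_deriv (i # is) \<psi> x)"
    unfolding step Cons(1) partial_deriv_def
    using frechet_derivative_at[OF has_derivative_add[OF der[OF assms(1)] der[OF assms(2)]]]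
    by (metis (no_types, lifting))
  show "iter_deriv (i # is) (\<lambda>x. c * \<phi> x) = (\<lambda>x. c * iter_deriv (i # is) \<phi> x)"
    unfolding step Cons(2) partial_deriv_def
    using frechet_derivative_at[OF has_derivative_mult_right[OF der[OF assms(1)], of c]]
    by (metis (no_types, lifting))
qed

lemma schwartz_bound:
  assumes "\<phi> \<in> schwartz"
  obtains M where "\<And>x. (1 + norm x) ^ k * norm (iter_deriv is \<phi> x) \<le> M"
proof -
  have "bdd_above (range (\<lambda>x. (1 + norm x) ^ k * norm (iter_deriv is \<phi> x)))"
    using assms by (simp add: schwartz_def)
  then show ?thesis using that unfolding bdd_above_def by auto
qed

lemma schwartz_add:
  assumes "\<phi> \<in> schwartz" "\<psi> \<in> schwartz"
  shows "(\<lambda>x. \<phi> x + \<psi> x) \<in> schwartz"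
proof -
  have s: "smooth \<phi>" "smooth \<psi>" using assms by (auto simp: schwartz_def)
  note lin = iter_deriv_linear(1)[OF s]
  have "bdd_above (range (\<lambda>x. (1 + norm x) ^ k * norm (iter_deriv is \<phi> x + iter_deriv is \<psi> x)))" for k "is"
  proof -
    obtain M where M: "\<And>x. (1 + norm x) ^ k * norm (iter_deriv is \<phi> x) \<le> M"
      using schwartz_bound[OF assms(1)] by blast
    obtain N where N: "\<And>x. (1 + norm x) ^ k * norm (iter_deriv is \<psi> x) \<le> N"
      using schwartz_bound[OF assms(2)] by blast
    show ?thesis
    proof (rule bdd_aboveI2)
      fix x :: "real^'a"
      have "(1 + norm x) ^ k * norm (iter_deriv is \<phi> x + iter_deriv is \<psi> x) \<le>
          (1 + norm x) ^ k * (norm (iter_deriv is \<phi> x) + norm (iter_deriv is \<psi> x))"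
        by (intro mult_left_mono norm_triangle_ineq) auto
      also have "\<dots> \<le> M + N" using M[of x] N[of x] by (simp add: distrib_left)
      finally show "(1 + norm x) ^ k * norm (iter_deriv is \<phi> x + iter_deriv is \<psi> x) \<le> M + N" .
    qed
  qed
  then show ?thesis using s unfolding schwartz_def smooth_def mem_Collect_eq lin by auto
qed

lemma schwartz_cmult:
  assumes "\<phi> \<in> schwartz"
  shows "(\<lambda>x. c * \<phi> x) \<in> schwartz"
proof -
  have s: "smooth \<phi>" using assms by (auto simp: schwartz_def)
  note lin = iter_deriv_linear(2)[OF s s]
  have "bdd_above (range (\<lambda>x. (1 + norm x) ^ k * norm (c * iter_deriv is \<phi> x)))" for k "is"
  proof -
    obtain M where M: "\<And>x. (1 + norm x) ^ k * norm (iter_deriv is \<phi> x) \<le> M"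
      using schwartz_bound[OF assms] by blast
    show ?thesis
      using mult_left_mono[OF M norm_ge_zero[of c]]
      by (intro bdd_aboveI2[of _ _ "norm c * M"]) (simp add: norm_mult mult.left_commute)
  qed
  moreover have "(\<lambda>x. c * iter_deriv is \<phi> x) differentiable_on UNIV" for "is"
    using s unfolding smooth_def differentiable_on_def by (auto intro: differentiable_mult)
  ultimately show ?thesis unfolding schwartz_def smooth_def mem_Collect_eq lin by auto
qed

lemma schwartz_decay:
  assumes "\<phi> \<in> schwartz"
  obtains M where "\<And>x. norm (\<phi> x) \<le> M * (1 / (1 + norm x) ^ k)"
proof -
  obtain M where M: "\<And>x. (1 + norm x) ^ k * norm (iter_deriv [] \<phi> x) \<le> M"
    using schwartz_bound[OF assms] by blast
  have "norm (\<phi> x) \<le> M * (1 / (1 + norm x) ^ k)" for x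
  proof -
    have "0 < (1 + norm x) ^ k" by (intro zero_less_power add_pos_nonneg) auto
    then show ?thesis using M[of x] by (simp add: iter_deriv_def field_simps)
  qed
  then show ?thesis using that by blast
qed

text \<open>
  The only seminorms needed below are those without derivatives: they control point evaluations,
  with a decay of arbitrary polynomial order.
\<close>

lemma norm_diff_le_seminorm:
  assumes "\<phi> \<in> schwartz" "\<psi> \<in> schwartz"
  shows "norm (\<psi> x - \<phi> x) \<le> schwartz_seminorm k [] (\<lambda>x. \<psi> x - \<phi> x) * (1 / (1 + norm x) ^ k)"
proof -
  obtain M where M: "\<And>x. (1 + norm x) ^ k * norm (iter_deriv [] \<phi> x) \<le> M"
    using schwartz_bound[OF assms(1)] by blast
  obtain N where N: "\<And>x. (1 + norm x) ^ k * norm (iter_deriv [] \<psi> x) \<le> N"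
    using schwartz_bound[OF assms(2)] by blast
  have "bdd_above (range (\<lambda>x. (1 + norm x) ^ k * norm (iter_deriv [] (\<lambda>x. \<psi> x - \<phi> x) x)))"
  proof (rule bdd_aboveI2)
    fix x :: "real^'a"
    have "(1 + norm x) ^ k * norm (\<psi> x - \<phi> x) \<le> (1 + norm x) ^ k * (norm (\<psi> x) + norm (\<phi> x))"
      by (intro mult_left_mono norm_triangle_ineq4) auto
    also have "\<dots> \<le> N + M" using M[of x] N[of x] by (simp add: distrib_left iter_deriv_def)
    finally show "(1 + norm x) ^ k * norm (iter_deriv [] (\<lambda>x. \<psi> x - \<phi> x) x) \<le> N + M"
      by (simp add: iter_deriv_def)
  qed
  then have "(1 + norm x) ^ k * norm (iter_deriv [] (\<lambda>x. \<psi> x - \<phi> x) x) \<le>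
      schwartz_seminorm k [] (\<lambda>x. \<psi> x - \<phi> x)"
    unfolding schwartz_seminorm_def by (rule cSUP_upper[rotated]) simp
  moreover have "0 < (1 + norm x) ^ k" by (intro zero_less_power add_pos_nonneg) auto
  ultimately show ?thesis by (simp add: iter_deriv_def field_simps)
qed

definition weighted_comb :: "(real^'n::finite) set \<Rightarrow> (real^'n \<Rightarrow> real) \<Rightarrow> 'n testfun \<Rightarrow> complex" where
  "weighted_comb A c = (\<lambda>\<phi>\<in>schwartz. \<Sum>\<^sub>\<infinity>a\<in>A. of_real (c a) * \<phi> a)"

lemma weighted_comb_summable:
  assumes "\<phi> \<in> schwartz" and "(\<lambda>a. \<bar>c a\<bar> * (1 / (1 + norm a) ^ k)) summable_on A"
  shows "(\<lambda>a. norm (of_real (c a) * \<phi> a)) summable_on A"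
    and "(\<lambda>a. of_real (c a) * \<phi> a) summable_on A"
proof -
  obtain M where M: "\<And>x. norm (\<phi> x) \<le> M * (1 / (1 + norm x) ^ k)"
    using schwartz_decay[OF assms(1)] by blast
  show "(\<lambda>a. norm (of_real (c a) * \<phi> a)) summable_on A"
  proof (rule summable_on_comparison_test)
    show "(\<lambda>a. M * (\<bar>c a\<bar> * (1 / (1 + norm a) ^ k))) summable_on A"
      using assms(2) by (rule summable_on_cmult_right)
    fix a
    have "norm (of_real (c a) * \<phi> a) \<le> \<bar>c a\<bar> * (M * (1 / (1 + norm a) ^ k))"
      using mult_left_mono[OF M[of a] abs_ge_zero[of "c a"]] by (simp add: norm_mult)
    then show "norm (of_real (c a) * \<phi> a) \<le> M * (\<bar>c a\<bar> * (1 / (1 + norm a) ^ k))"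
      by (simp only: mult.left_commute)
  qed simp
  then show "(\<lambda>a. of_real (c a) * \<phi> a) summable_on A" by (rule abs_summable_summable)
qed

text \<open>
  Continuity: the difference of the values at two test functions is at most
  \<open>\<Sum>\<bar>c a\<bar> / (1 + norm a)\<^sup>k\<close> times one seminorm of their difference, so the preimage of a disc
  contains a generating open set around each of its points.
\<close>

lemma weighted_comb_tempered:
  assumes s: "(\<lambda>a. \<bar>c a\<bar> * (1 / (1 + norm a) ^ k)) summable_on A"
  shows "weighted_comb A c \<in> tempered_distributions"
proof -
  define T where "T = weighted_comb A c"
  define W where "W = (\<Sum>\<^sub>\<infinity>a\<in>A. \<bar>c a\<bar> * (1 / (1 + norm a) ^ k))"
  have W: "W \<ge> 0" unfolding W_def by (rule infsum_nonneg) simp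
  have T: "T \<phi> = (\<Sum>\<^sub>\<infinity>a\<in>A. of_real (c a) * \<phi> a)" if "\<phi> \<in> schwartz" for \<phi>
    using that by (simp add: T_def weighted_comb_def)
  have "T \<in> extensional schwartz" by (simp add: T_def weighted_comb_def)
  moreover have "T (\<lambda>x. \<phi> x + \<psi> x) = T \<phi> + T \<psi>" if f: "\<phi> \<in> schwartz" "\<psi> \<in> schwartz" for \<phi> \<psi>
  proof -
    have "T (\<lambda>x. \<phi> x + \<psi> x) = (\<Sum>\<^sub>\<infinity>a\<in>A. of_real (c a) * \<phi> a + of_real (c a) * \<psi> a)"
      using T[OF schwartz_add[OF f]] by (simp add: distrib_left)
    also have "\<dots> = T \<phi> + T \<psi>"
      unfolding T[OF f(1)] T[OF f(2)]
      by (rule infsum_add[OF weighted_comb_summable(2)[OF f(1) s] weighted_comb_summable(2)[OF f(2) s]])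
    finally show ?thesis .
  qed
  moreover have "T (\<lambda>x. z * \<phi> x) = z * T \<phi>" if f: "\<phi> \<in> schwartz" for \<phi> z
  proof -
    have "T (\<lambda>x. z * \<phi> x) = (\<Sum>\<^sub>\<infinity>a\<in>A. z * (of_real (c a) * \<phi> a))"
      using T[OF schwartz_cmult[OF f]] by (simp add: mult.left_commute)
    also have "\<dots> = z * T \<phi>" unfolding T[OF f] by (rule infsum_cmult_right')
    finally show ?thesis .
  qed
  moreover have "continuous_map schwartz_topology euclidean T"
    unfolding continuous_map_def
  proof (intro conjI allI impI)
    show "T \<in> topspace schwartz_topology \<rightarrow> topspace euclidean" by simp
    fix U :: "complex set" assume "openin euclidean U"
    then have U: "open U" by simp
    show "openin schwartz_topology {\<phi> \<in> topspace schwartz_topology. T \<phi> \<in> U}"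
    proof (subst openin_subopen, intro ballI)
      fix \<phi> assume "\<phi> \<in> {\<phi> \<in> topspace schwartz_topology. T \<phi> \<in> U}"
      then have f: "\<phi> \<in> schwartz" "T \<phi> \<in> U"
        by (auto simp: schwartz_topology_def topology_generated_by_topspace)
      obtain e where e: "e > 0" "ball (T \<phi>) e \<subseteq> U" using U f(2) open_contains_ball by blast
      define N where "N = {\<psi> \<in> schwartz. schwartz_seminorm k [] (\<lambda>x. \<psi> x - \<phi> x) < e / (W + 1)}"
      have "openin schwartz_topology N"
        unfolding schwartz_topology_def
      proof (rule topology_generated_by_Basis)
        have "0 < e / (W + 1)" using e W by simp
        then show "N \<in> {{\<psi> \<in> schwartz. schwartz_seminorm k is (\<lambda>x. \<psi> x - \<phi> x) < \<epsilon>} | k is \<phi> \<epsilon>.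
            \<phi> \<in> schwartz \<and> 0 < \<epsilon>}"
          unfolding N_def using f(1) by blast
      qed
      moreover have "\<phi> \<in> N"
        using f e W by (simp add: N_def schwartz_seminorm_def iter_deriv_def)
      moreover have "T \<psi> \<in> U" if psi: "\<psi> \<in> N" for \<psi>
      proof -
        define q where "q = schwartz_seminorm k [] (\<lambda>x. \<psi> x - \<phi> x)"
        have p: "\<psi> \<in> schwartz" "q < e / (W + 1)" using psi by (auto simp: N_def q_def)
        have "((\<lambda>a. of_real (c a) * \<psi> a - of_real (c a) * \<phi> a) has_sum (T \<psi> - T \<phi>)) A"
          using has_sum_add[OF has_sum_infsum[OF weighted_comb_summable(2)[OF p(1) s]]
              has_sum_uminusI[OF has_sum_infsum[OF weighted_comb_summable(2)[OF f(1) s]]]]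
          by (simp add: T[OF f(1)] T[OF p(1)])
        moreover have "((\<lambda>a. q * (\<bar>c a\<bar> * (1 / (1 + norm a) ^ k))) has_sum q * W) A"
          unfolding W_def by (intro has_sum_cmult_right has_sum_infsum s)
        ultimately have "norm (T \<psi> - T \<phi>) \<le> q * W"
        proof (rule norm_infsum_le)
          fix a
          have "norm (of_real (c a) * \<psi> a - of_real (c a) * \<phi> a) = \<bar>c a\<bar> * norm (\<psi> a - \<phi> a)"
            by (simp flip: right_diff_distrib add: norm_mult)
          also have "\<dots> \<le> \<bar>c a\<bar> * (q * (1 / (1 + norm a) ^ k))"
            unfolding q_def by (intro mult_left_mono norm_diff_le_seminorm f p) simp
          finally show "norm (of_real (c a) * \<psi> a - of_real (c a) * \<phi> a) \<le>
              q * (\<bar>c a\<bar> * (1 / (1 + norm a) ^ k))" by (simp only: mult.left_commute)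
        qed
        also have "\<dots> \<le> e / (W + 1) * W" using p W by (intro mult_right_mono) auto
        also have "\<dots> < e" using e W by (simp add: field_simps)
        finally have "T \<psi> \<in> ball (T \<phi>) e" by (simp add: dist_norm norm_minus_commute)
        then show ?thesis using e by blast
      qed
      moreover have "N \<subseteq> topspace schwartz_topology"
        using \<open>openin schwartz_topology N\<close> by (rule openin_subset)
      ultimately show "\<exists>N. openin schwartz_topology N \<and> \<phi> \<in> N \<and>
          N \<subseteq> {\<phi> \<in> topspace schwartz_topology. T \<phi> \<in> U}" by blast
    qed
  qed
  ultimately show ?thesis by (simp add: tempered_distributions_def flip: T_def)
qed

lemma limitin_weak_star_iff:
  "limitin weak_star f T F \<longleftrightarrow> T \<in> tempered_distributions \<and>
    eventually (\<lambda>x. f x \<in> tempered_distributions) F \<and> (\<forall>\<phi>\<in>schwartz. ((\<lambda>x. f x \<phi>) \<longlongrightarrow> T \<phi>) F)"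
proof -
  have ext: "T \<in> extensional schwartz" if "T \<in> tempered_distributions" for T
    using that by (simp add: tempered_distributions_def)
  have "eventually (\<lambda>x. f x \<in> topspace (product_topology (\<lambda>_. euclidean) schwartz)) F"
    if "eventually (\<lambda>x. f x \<in> tempered_distributions) F"
    using that by eventually_elim (simp add: topspace_product_topology PiE_def ext)
  then show ?thesis
    unfolding weak_star_def limitin_subtopology limitin_componentwise limitin_canonical_iff
    using ext by blast
qed

lemma weighted_comb_is_dirac_comb:
  assumes s: "(\<lambda>a. \<bar>c a\<bar> * (1 / (1 + norm a) ^ k)) summable_on A"
  shows "is_dirac_comb (weighted_comb A c) A c"
proof -
  have fin: "(\<lambda>\<phi>\<in>schwartz. \<Sum>a\<in>F. of_real (c a) * dirac a \<phi>) = weighted_comb F c" if "finite F" for F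
    using that by (auto simp: weighted_comb_def dirac_def restrict_def)
  have fin_tempered: "weighted_comb F c \<in> tempered_distributions" if "finite F" for F
    by (rule weighted_comb_tempered[where k = 0]) (use that in simp)
  show ?thesis
    unfolding is_dirac_comb_def limitin_weak_star_iff
  proof (intro conjI ballI)
    show "weighted_comb A c \<in> tempered_distributions" using s by (rule weighted_comb_tempered)
    show "\<forall>\<^sub>F F in finite_subsets_at_top A.
        (\<lambda>\<phi>\<in>schwartz. \<Sum>a\<in>F. of_real (c a) * dirac a \<phi>) \<in> tempered_distributions"
      using fin fin_tempered by (intro eventually_finite_subsets_at_top_weakI) simp
    fix \<phi> :: "'a testfun" assume f: "\<phi> \<in> schwartz"
    have "((\<lambda>a. of_real (c a) * \<phi> a) has_sum weighted_comb A c \<phi>) A"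
      using has_sum_infsum[OF weighted_comb_summable(2)[OF f s]] f by (simp add: weighted_comb_def)
    then show "((\<lambda>F. (\<lambda>\<phi>\<in>schwartz. \<Sum>a\<in>F. of_real (c a) * dirac a \<phi>) \<phi>) \<longlongrightarrow> weighted_comb A c \<phi>)
        (finite_subsets_at_top A)"
      using f by (simp add: has_sum_def dirac_def)
  qed
qed

text \<open>
  Up to the tail of the majorant, both series are sums over one finite set, where convergence is
  termwise.
\<close>

lemma infsum_dominated_convergence:
  fixes f :: "'b \<Rightarrow> 'a \<Rightarrow> complex"
  assumes g: "g summable_on A"
    and dom: "\<forall>\<^sub>F x in F. \<forall>a\<in>A. norm (f x a) \<le> g a"
    and lim: "\<And>a. a \<in> A \<Longrightarrow> ((\<lambda>x. f x a) \<longlongrightarrow> h a) F"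
    and h: "\<And>a. a \<in> A \<Longrightarrow> norm (h a) \<le> g a"
  shows "((\<lambda>x. infsum (f x) A) \<longlongrightarrow> infsum h A) F"
proof (rule tendstoI)
  fix e :: real assume e: "e > 0"
  have "\<forall>\<^sub>F B in finite_subsets_at_top A. dist (sum g B) (infsum g A) < e / 4"
    using has_sum_infsum[OF g] e unfolding has_sum_def by (intro tendstoD) auto
  then obtain B where B: "finite B" "B \<subseteq> A" "dist (sum g B) (infsum g A) < e / 4"
    unfolding eventually_finite_subsets_at_top by blast
  have gs: "g summable_on A - B" using g by (rule summable_on_subset_banach) simp
  have "infsum g A = sum g B + infsum g (A - B)"
    using infsum_Un_disjoint[of g B "A - B"] B gs by (simp add: Un_absorb1 Un_Diff_cancel)
  then have tail: "infsum g (A - B) < e / 4" using B(3) by (simp add: dist_real_def)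
  have est: "norm (infsum u A - sum u B) \<le> infsum g (A - B)" if u: "\<And>a. a \<in> A \<Longrightarrow> norm (u a) \<le> g a"
    for u :: "'a \<Rightarrow> complex"
  proof -
    have "(\<lambda>a. norm (u a)) summable_on A"
      by (rule summable_on_comparison_test[OF g]) (use u in auto)
    then have us: "u summable_on A" by (rule abs_summable_summable)
    then have us': "u summable_on A - B" by (rule summable_on_subset_banach) simp
    have "infsum u A = sum u B + infsum u (A - B)"
      using infsum_Un_disjoint[of u B "A - B"] B us' by (simp add: Un_absorb1 Un_Diff_cancel)
    moreover have "norm (infsum u (A - B)) \<le> infsum g (A - B)"
      using has_sum_infsum[OF us'] has_sum_infsum[OF gs] u by (rule norm_infsum_le) auto
    ultimately show ?thesis by simp
  qed
  have "((\<lambda>x. \<Sum>a\<in>B. f x a) \<longlongrightarrow> (\<Sum>a\<in>B. h a)) F"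
    using B(2) lim by (intro tendsto_sum) auto
  then have "\<forall>\<^sub>F x in F. dist (\<Sum>a\<in>B. f x a) (\<Sum>a\<in>B. h a) < e / 4" using e by (intro tendstoD) auto
  with dom show "\<forall>\<^sub>F x in F. dist (infsum (f x) A) (infsum h A) < e"
  proof eventually_elim
    case (elim x)
    have "norm (infsum (f x) A - sum (f x) B) < e / 4" using est[of "f x"] elim(1) tail by force
    moreover have "norm (infsum h A - sum h B) < e / 4" using est[of h] h tail by force
    ultimately have "dist (infsum (f x) A) (sum (f x) B) < e / 4" "dist (infsum h A) (sum h B) < e / 4"
      by (simp_all add: dist_norm)
    then show ?case using elim(2) e
      dist_triangle[of "infsum (f x) A" "infsum h A" "sum (f x) B"]
      dist_triangle[of "sum (f x) B" "infsum h A" "sum h B"]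
      by (simp add: dist_commute)
  qed
qed

lemma limitin_weighted_comb:
  assumes s: "(\<lambda>a. 1 / (1 + norm a) ^ k) summable_on A"
    and bound: "\<forall>\<^sub>F x in F. \<forall>a\<in>A. \<bar>c x a\<bar> \<le> K" and w: "\<And>a. a \<in> A \<Longrightarrow> \<bar>w a\<bar> \<le> K"
    and lim: "\<And>a. a \<in> A \<Longrightarrow> ((\<lambda>x. c x a) \<longlongrightarrow> w a) F"
  shows "limitin weak_star (\<lambda>x. weighted_comb A (c x)) (weighted_comb A w) F"
proof -
  have summ: "(\<lambda>a. \<bar>u a\<bar> * (1 / (1 + norm a) ^ k)) summable_on A" if "\<And>a. a \<in> A \<Longrightarrow> \<bar>u a\<bar> \<le> K" for u
    by (rule summable_on_comparison_test[OF summable_on_cmult_right[OF s, of K]])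
       (use that in \<open>auto intro!: divide_right_mono\<close>)
  show ?thesis
    unfolding limitin_weak_star_iff
  proof (intro conjI ballI)
    show "weighted_comb A w \<in> tempered_distributions"
      by (rule weighted_comb_tempered[OF summ[OF w]])
    show "\<forall>\<^sub>F x in F. weighted_comb A (c x) \<in> tempered_distributions"
      using bound
    proof eventually_elim
      case (elim x)
      then show ?case by (intro weighted_comb_tempered[where k = k] summ) auto
    qed
    fix \<phi> :: "'a testfun" assume f: "\<phi> \<in> schwartz"
    obtain M where M: "\<And>x. norm (\<phi> x) \<le> M * (1 / (1 + norm x) ^ k)"
      using schwartz_decay[OF f] by blast
    have le: "norm (of_real u * \<phi> a) \<le> K * (M * (1 / (1 + norm a) ^ k))" if "\<bar>u\<bar> \<le> K" for u a
    proof -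
      have "\<bar>u\<bar> * norm (\<phi> a) \<le> K * (M * (1 / (1 + norm a) ^ k))"
        by (rule mult_mono[OF that M]) (use that in auto)
      then show ?thesis by (simp add: norm_mult)
    qed
    have "((\<lambda>x. \<Sum>\<^sub>\<infinity>a\<in>A. of_real (c x a) * \<phi> a) \<longlongrightarrow> (\<Sum>\<^sub>\<infinity>a\<in>A. of_real (w a) * \<phi> a)) F"
    proof (rule infsum_dominated_convergence)
      show "(\<lambda>a. K * (M * (1 / (1 + norm a) ^ k))) summable_on A"
        using s by (intro summable_on_cmult_right)
      show "\<forall>\<^sub>F x in F. \<forall>a\<in>A. norm (of_real (c x a) * \<phi> a) \<le> K * (M * (1 / (1 + norm a) ^ k))"
        using bound by eventually_elim (use le in blast)
      show "norm (of_real (w a) * \<phi> a) \<le> K * (M * (1 / (1 + norm a) ^ k))" if "a \<in> A" for a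
        using w[OF that] by (rule le)
      show "((\<lambda>x. of_real (c x a) * \<phi> a) \<longlongrightarrow> of_real (w a) * \<phi> a) F" if "a \<in> A" for a
        using lim[OF that] by (intro tendsto_intros)
    qed
    then show "((\<lambda>x. weighted_comb A (c x) \<phi>) \<longlongrightarrow> weighted_comb A w \<phi>) F"
      using f by (simp add: weighted_comb_def)
  qed
qed

text \<open>
  Collecting the pairs \<open>(x, y)\<close> with the same difference \<open>a\<close>; only finitely many \<open>a\<close> occur, so the
  series over \<open>A\<close> is a finite sum.
\<close>

lemma autocorrelation_approx_eq_weighted_comb:
  assumes fin: "finite {x \<in> S. norm x < R}" and A: "\<And>x y. x \<in> S \<Longrightarrow> y \<in> S \<Longrightarrow> x - y \<in> A"
  shows "autocorrelation_approx S R = weighted_comb A (\<lambda>a. 1 / (pi * R\<^sup>2) *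
    real (card {x \<in> S. x - a \<in> S \<and> norm x < R \<and> norm (x - a) < R}))"
proof
  fix \<phi> :: "2 testfun"
  define P where "P = {(x, y). x \<in> S \<and> y \<in> S \<and> norm x < R \<and> norm y < R}"
  define D where "D = (\<lambda>(x, y). x - y) ` P"
  define n where "n a = card {x \<in> S. x - a \<in> S \<and> norm x < R \<and> norm (x - a) < R}" for a
  have "P = {x \<in> S. norm x < R} \<times> {x \<in> S. norm x < R}" by (auto simp: P_def)
  then have finP: "finite P" using fin by simp
  have fib: "card {z \<in> P. (\<lambda>(x, y). x - y) z = a} = n a" for a
    unfolding n_def
    by (rule bij_betw_same_card[of fst], rule bij_betwI[where g = "\<lambda>x. (x, x - a)"])
       (auto simp: P_def)
  have n0: "n a = 0" if "a \<notin> D" for a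
  proof -
    have "{z \<in> P. (\<lambda>(x, y). x - y) z = a} = {}" using that by (auto simp: D_def)
    then show ?thesis using fib[of a] by (simp only: card.empty)
  qed
  show "autocorrelation_approx S R \<phi> = weighted_comb A (\<lambda>a. 1 / (pi * R\<^sup>2) *
      real (card {x \<in> S. x - a \<in> S \<and> norm x < R \<and> norm (x - a) < R})) \<phi>"
  proof (cases "\<phi> \<in> schwartz")
    case True
    have "(\<Sum>(x, y)\<in>P. dirac (x - y) \<phi>) = (\<Sum>z\<in>P. \<phi> ((\<lambda>(x, y). x - y) z))"
      using True by (intro sum.cong) (auto simp: dirac_def)
    also have "\<dots> = (\<Sum>a\<in>D. \<Sum>z | z \<in> P \<and> (\<lambda>(x, y). x - y) z = a. \<phi> ((\<lambda>(x, y). x - y) z))"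
      unfolding D_def by (rule sum.image_gen[OF finP])
    also have "\<dots> = (\<Sum>a\<in>D. of_nat (n a) * \<phi> a)"
      by (intro sum.cong refl) (simp flip: fib)
    finally have "(\<Sum>(x, y)\<in>P. dirac (x - y) \<phi>) = (\<Sum>a\<in>D. of_nat (n a) * \<phi> a)" .
    moreover have "autocorrelation_approx S R \<phi> =
        of_real (1 / (pi * R\<^sup>2)) * (\<Sum>(x, y)\<in>P. dirac (x - y) \<phi>)"
      unfolding autocorrelation_approx_def restrict_apply P_def if_P[OF True] ..
    ultimately have "autocorrelation_approx S R \<phi> =
        (\<Sum>a\<in>D. of_real (1 / (pi * R\<^sup>2) * real (n a)) * \<phi> a)"
      by (simp only: sum_distrib_left of_real_mult of_real_of_nat_eq mult.assoc)
    also have "\<dots> = (\<Sum>\<^sub>\<infinity>a\<in>D. of_real (1 / (pi * R\<^sup>2) * real (n a)) * \<phi> a)"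
      using finP by (simp add: D_def)
    also have "\<dots> = (\<Sum>\<^sub>\<infinity>a\<in>A. of_real (1 / (pi * R\<^sup>2) * real (n a)) * \<phi> a)"
      using A by (intro infsum_cong_neutral) (auto simp: n0, auto simp: D_def P_def)
    finally show ?thesis using True by (simp add: weighted_comb_def n_def)
  qed (simp add: autocorrelation_approx_def weighted_comb_def)
qed

section \<open>The autocorrelation of the visible points\<close>

definition coincidence_density :: "(real^2) set \<Rightarrow> real \<Rightarrow> real^2 \<Rightarrow> real" where
  "coincidence_density S R a =
     1 / (pi * R\<^sup>2) * real (card {x \<in> S. x - a \<in> S \<and> norm x < R \<and> norm (x - a) < R})"

definition visible_weight :: "(real^2) set \<Rightarrow> real^2 \<Rightarrow> real" where
  "visible_weight \<Gamma> a = dens \<Gamma> * infsum (pair_density (lattice_content \<Gamma> a)) UNIV"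

text \<open>
  Requiring \<open>norm (x - a) < R\<close> in addition to \<open>norm x < R\<close> removes only points of the annulus
  \<open>R - norm a \<le> norm x < R\<close>, of which there are \<open>O(R)\<close>.
\<close>

lemma coincidence_density_error:
  assumes lat: "is_lattice \<Gamma>" and a: "a \<in> \<Gamma>"
  obtains C where "\<And>R. R \<ge> 1 + norm a \<Longrightarrow>
    \<bar>visible_weight \<Gamma> a - coincidence_density (visible_points \<Gamma>) R a\<bar> \<le> C * (1 / sqrt R)"
proof -
  obtain C1 where C1: "C1 > 0" "\<And>R. R \<ge> 1 \<Longrightarrow>
    \<bar>real (visible_pair_count \<Gamma> a R)
       - pi * R\<^sup>2 * dens \<Gamma> * infsum (pair_density (lattice_content \<Gamma> a)) UNIV\<bar> \<le> C1 * (R * sqrt R)"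
    using visible_pair_count_asymptotic[OF assms] by blast
  obtain C2 where C2: "C2 > 0" "\<And>q r. r \<ge> 0 \<Longrightarrow>
    \<bar>real (card {u \<in> \<Gamma>. norm (u - q) < r}) - pi * r\<^sup>2 * dens \<Gamma>\<bar> \<le> C2 * (r + 1)"
    using lattice_count_disc[OF lat] by blast
  define C3 where "C3 = 2 * pi * \<bar>dens \<Gamma>\<bar> * norm a + 4 * C2"
  have C3: "C3 \<ge> 0" using C2(1) by (simp add: C3_def)
  have "\<bar>visible_weight \<Gamma> a - coincidence_density (visible_points \<Gamma>) R a\<bar> \<le> (C1 + C3) / pi * (1 / sqrt R)"
    if R: "R \<ge> 1 + norm a" for R
  proof -
    have R1: "R \<ge> 1" using R norm_ge_zero[of a] by linarith
    define N where "N r = {x \<in> \<Gamma>. norm x < r}" for r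
    have finN: "finite (N r)" for r using finite_lattice_ball[OF lat, of 0 r] by (simp add: N_def)
    have cardN: "\<bar>real (card (N r)) - pi * r\<^sup>2 * dens \<Gamma>\<bar> \<le> C2 * (r + 1)" if "r \<ge> 0" for r
      using C2(2)[OF that, of 0] by (simp add: N_def)
    define A where "A = {x \<in> visible_points \<Gamma>. x - a \<in> visible_points \<Gamma> \<and> norm x < R}"
    define A' where "A' = {x \<in> visible_points \<Gamma>. x - a \<in> visible_points \<Gamma> \<and> norm x < R \<and> norm (x - a) < R}"
    have sub: "A' \<subseteq> A" "A \<subseteq> N R" by (auto simp: A_def A'_def N_def visible_points_def)
    have finA: "finite A" using sub(2) finN by (rule finite_subset)
    have "A - A' \<subseteq> N R - N (R - norm a)"
    proof
      fix x assume x: "x \<in> A - A'"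
      then have "norm (x - a) \<ge> R" by (auto simp: A_def A'_def)
      then have "norm x \<ge> R - norm a" using norm_triangle_ineq4[of x a] by linarith
      then show "x \<in> N R - N (R - norm a)" using x sub by (auto simp: N_def)
    qed
    then have "card (A - A') \<le> card (N R - N (R - norm a))" using finN by (intro card_mono) auto
    moreover have "card (A - A') = card A - card A'" "card A' \<le> card A"
      using sub(1) finA by (auto intro: card_Diff_subset card_mono finite_subset)
    moreover have "N (R - norm a) \<subseteq> N R" by (auto simp: N_def intro: less_le_trans[of _ "R - norm a" R])
    then have "card (N R - N (R - norm a)) = card (N R) - card (N (R - norm a))"
      "card (N (R - norm a)) \<le> card (N R)"
      using finN by (auto intro: card_Diff_subset card_mono)
    ultimately have "real (card A) - real (card A') \<le> real (card (N R)) - real (card (N (R - norm a)))"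
      by linarith
    also have "\<dots> \<le> pi * R\<^sup>2 * dens \<Gamma> + C2 * (R + 1) - (pi * (R - norm a)\<^sup>2 * dens \<Gamma> - C2 * (R - norm a + 1))"
      using cardN[of R] cardN[of "R - norm a"] R R1 by linarith
    also have "\<dots> = pi * dens \<Gamma> * (2 * R * norm a - (norm a)\<^sup>2) + C2 * (2 * R + 2 - norm a)"
      by (simp add: power2_eq_square algebra_simps)
    also have "\<dots> \<le> pi * \<bar>dens \<Gamma>\<bar> * (2 * R * norm a) + C2 * (4 * R)"
    proof (intro add_mono mult_left_mono)
      have nonneg: "0 \<le> 2 * R * norm a - (norm a)\<^sup>2"
        using mult_right_mono[of "norm a" "2 * R" "norm a"] R norm_ge_zero[of a]
        by (simp add: power2_eq_square)
      show "pi * dens \<Gamma> * (2 * R * norm a - (norm a)\<^sup>2) \<le> pi * \<bar>dens \<Gamma>\<bar> * (2 * R * norm a)"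
        by (rule mult_mono[OF mult_left_mono]) (use nonneg R1 in auto)
      show "2 * R + 2 - norm a \<le> 4 * R" using R1 norm_ge_zero[of a] by linarith
    qed (use C2 in simp)
    also have "\<dots> = C3 * R" by (simp add: C3_def algebra_simps)
    also have "\<dots> \<le> C3 * (R * sqrt R)"
      using C3 R1 by (intro mult_left_mono) (auto intro: mult_left_mono[of 1 "sqrt R" R, simplified])
    finally have "\<bar>real (card A') - real (card A)\<bar> \<le> C3 * (R * sqrt R)"
      using \<open>card A' \<le> card A\<close> by simp
    moreover have "\<bar>real (card A) - pi * R\<^sup>2 * visible_weight \<Gamma> a\<bar> \<le> C1 * (R * sqrt R)"
      using C1(2)[OF R1] by (simp add: A_def visible_pair_count_def visible_weight_def mult.assoc)
    ultimately have "\<bar>pi * R\<^sup>2 * visible_weight \<Gamma> a - real (card A')\<bar> \<le> C1 * (R * sqrt R) + C3 * (R * sqrt R)"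
      by linarith
    then have "\<bar>pi * R\<^sup>2 * visible_weight \<Gamma> a - real (card A')\<bar> / (pi * R\<^sup>2) \<le>
        (C1 * (R * sqrt R) + C3 * (R * sqrt R)) / (pi * R\<^sup>2)"
      by (rule divide_right_mono) simp
    moreover have "\<bar>pi * R\<^sup>2 * visible_weight \<Gamma> a - real (card A')\<bar> / (pi * R\<^sup>2) =
        \<bar>visible_weight \<Gamma> a - coincidence_density (visible_points \<Gamma>) R a\<bar>"
    proof -
      have pos: "pi * R\<^sup>2 > 0" using R1 by simp
      then have "\<bar>pi * R\<^sup>2 * visible_weight \<Gamma> a - real (card A')\<bar> / (pi * R\<^sup>2) =
          \<bar>(pi * R\<^sup>2 * visible_weight \<Gamma> a - real (card A')) / (pi * R\<^sup>2)\<bar>" by simp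
      also have "(pi * R\<^sup>2 * visible_weight \<Gamma> a - real (card A')) / (pi * R\<^sup>2) =
          visible_weight \<Gamma> a - coincidence_density (visible_points \<Gamma>) R a"
        using pos R1 by (simp add: coincidence_density_def A'_def diff_divide_distrib)
      finally show ?thesis .
    qed
    moreover have "(C1 * (R * sqrt R) + C3 * (R * sqrt R)) / (pi * R\<^sup>2) = (C1 + C3) / pi * (1 / sqrt R)"
    proof -
      define r where "r = sqrt R"
      have "r > 0" "R = r * r" using R1 by (simp_all add: r_def)
      then show ?thesis by (simp add: power2_eq_square field_simps)
    qed
    ultimately show ?thesis by simp
  qed
  then show ?thesis by (rule that)
qed

text \<open>
  Every coincidence within the disc is one of its \<open>O(R\<^sup>2)\<close> lattice points, whatever \<open>a\<close> is. This is
  the uniform bound for dominated convergence.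
\<close>

lemma coincidence_density_bounded:
  assumes lat: "is_lattice \<Gamma>"
  obtains K where "\<And>R a. R \<ge> 1 \<Longrightarrow> \<bar>coincidence_density (visible_points \<Gamma>) R a\<bar> \<le> K"
proof -
  obtain C where C: "C > 0" "\<And>q r. r \<ge> 0 \<Longrightarrow>
    \<bar>real (card {u \<in> \<Gamma>. norm (u - q) < r}) - pi * r\<^sup>2 * dens \<Gamma>\<bar> \<le> C * (r + 1)"
    using lattice_count_disc[OF lat] by blast
  have "\<bar>coincidence_density (visible_points \<Gamma>) R a\<bar> \<le> dens \<Gamma> + 2 * C / pi" if R: "R \<ge> 1" for R a
  proof -
    have "card {x \<in> visible_points \<Gamma>. x - a \<in> visible_points \<Gamma> \<and> norm x < R \<and> norm (x - a) < R} \<le>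
        card {x \<in> \<Gamma>. norm (x - 0) < R}"
      by (intro card_mono finite_lattice_ball lat) (auto simp: visible_points_def)
    then have "real (card {x \<in> visible_points \<Gamma>. x - a \<in> visible_points \<Gamma> \<and> norm x < R \<and> norm (x - a) < R})
        \<le> pi * R\<^sup>2 * dens \<Gamma> + C * (R + 1)"
      using C(2)[of R 0] R by linarith
    also have "\<dots> \<le> pi * R\<^sup>2 * dens \<Gamma> + C * (R\<^sup>2 + R\<^sup>2)"
      using C(1) R by (intro add_left_mono mult_left_mono add_mono)
        (auto simp: power2_eq_square intro: mult_left_mono[of 1 R R, simplified] order.trans[of 1 R])
    also have "\<dots> = (pi * R\<^sup>2) * (dens \<Gamma> + 2 * C / pi)" by (simp add: field_simps)
    finally show ?thesis using R by (simp add: coincidence_density_def pos_divide_le_eq mult.commute)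
  qed
  then show ?thesis by (rule that)
qed

lemma visible_weight_eq:
  assumes lat: "is_lattice \<Gamma>" and a: "a \<in> \<Gamma>"
  shows "visible_weight \<Gamma> a = dens \<Gamma> * xi 2 *
    prime_prod (\<lambda>p. enat p dvd cont \<Gamma> a) (\<lambda>p. 1 + 1 / ((real p)\<^sup>2 - 2))"
proof -
  have "prime_prod (\<lambda>p. True) (local_density (lattice_content \<Gamma> a)) =
      xi 2 * prime_prod (\<lambda>p. enat p dvd cont \<Gamma> a) (\<lambda>p. 1 + 1 / ((real p)\<^sup>2 - 2))"
    by (rule prime_prod_local_density) (rule dvd_cont_iff[OF lat a])
  then show ?thesis by (simp add: visible_weight_def infsum_pair_density mult.assoc)
qed

lemma tendsto_coincidence_density:
  assumes "is_lattice \<Gamma>" "a \<in> \<Gamma>"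
  shows "((\<lambda>R. coincidence_density (visible_points \<Gamma>) R a) \<longlongrightarrow> visible_weight \<Gamma> a) at_top"
proof -
  obtain C where C: "\<And>R. R \<ge> 1 + norm a \<Longrightarrow>
    \<bar>visible_weight \<Gamma> a - coincidence_density (visible_points \<Gamma>) R a\<bar> \<le> C * (1 / sqrt R)"
    using coincidence_density_error[OF assms] by blast
  have "((\<lambda>R. 1 / sqrt R) \<longlongrightarrow> 0) at_top"
    by (intro tendsto_divide_0[OF tendsto_const] filterlim_at_top_imp_at_infinity sqrt_at_top)
  then have "((\<lambda>R. C * (1 / sqrt R)) \<longlongrightarrow> 0) at_top" using tendsto_mult_right_zero by blast
  moreover have "\<forall>\<^sub>F R in at_top. norm (coincidence_density (visible_points \<Gamma>) R a - visible_weight \<Gamma> a)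
      \<le> C * (1 / sqrt R)"
    using eventually_ge_at_top[of "1 + norm a"]
    by eventually_elim (use C in \<open>simp add: abs_minus_commute\<close>)
  ultimately have "((\<lambda>R. coincidence_density (visible_points \<Gamma>) R a - visible_weight \<Gamma> a) \<longlongrightarrow> 0) at_top"
    by (rule Lim_null_comparison[rotated])
  then show ?thesis by (rule LIM_zero_cancel)
qed

theorem theorem2:
  fixes \<Gamma> :: "(real^2) set"
  assumes "is_lattice \<Gamma>"
  shows "\<exists>\<gamma> w.
    is_natural_autocorrelation (visible_points \<Gamma>) \<gamma> \<and>
    is_dirac_comb \<gamma> \<Gamma> w \<and>
    (\<forall>a\<in>\<Gamma>.
       w a = dens \<Gamma> * xi 2 *
         prime_prod (\<lambda>p. enat p dvd cont \<Gamma> a) (\<lambda>p. 1 + 1 / ((real p)\<^sup>2 - 2)) \<and>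
       (\<lambda>R. \<bar>w a - 1 / (pi * R\<^sup>2) *
              real (card {x \<in> visible_points \<Gamma>.
                x - a \<in> visible_points \<Gamma> \<and> norm x < R \<and> norm (x - a) < R})\<bar>)
         \<in> O[at_top](\<lambda>R. 1 / sqrt R))"
proof (intro exI conjI ballI)
  note lat = assms
  define w where "w = visible_weight \<Gamma>"
  obtain K where K: "\<And>R a. R \<ge> 1 \<Longrightarrow> \<bar>coincidence_density (visible_points \<Gamma>) R a\<bar> \<le> K"
    using coincidence_density_bounded[OF lat] by blast
  have ev: "\<forall>\<^sub>F R in at_top. \<forall>a\<in>\<Gamma>. \<bar>coincidence_density (visible_points \<Gamma>) R a\<bar> \<le> K"
    using eventually_ge_at_top[of 1] by eventually_elim (use K in blast)
  have wK: "\<bar>w a\<bar> \<le> K" if a: "a \<in> \<Gamma>" for a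
  proof (rule tendsto_upperbound)
    show "((\<lambda>R. \<bar>coincidence_density (visible_points \<Gamma>) R a\<bar>) \<longlongrightarrow> \<bar>w a\<bar>) at_top"
      unfolding w_def by (intro tendsto_rabs tendsto_coincidence_density lat a)
    show "\<forall>\<^sub>F R in at_top. \<bar>coincidence_density (visible_points \<Gamma>) R a\<bar> \<le> K"
      using ev by eventually_elim (use a in blast)
  qed simp
  show "is_natural_autocorrelation (visible_points \<Gamma>) (weighted_comb \<Gamma> w)"
    unfolding is_natural_autocorrelation_def
  proof
    show "uniform_discrete (visible_points \<Gamma>)"
      using uniform_discrete_lattice[OF lat] unfolding uniform_discrete_def visible_points_def by blast
    have "autocorrelation_approx (visible_points \<Gamma>) R =
        weighted_comb \<Gamma> (coincidence_density (visible_points \<Gamma>) R)" for R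
      unfolding coincidence_density_def[abs_def]
    proof (rule autocorrelation_approx_eq_weighted_comb)
      show "finite {x \<in> visible_points \<Gamma>. norm x < R}"
        by (rule finite_subset[OF _ finite_lattice_ball[OF lat, of 0 R]]) (auto simp: visible_points_def)
    qed (auto simp: visible_points_def intro: lattice_diff[OF lat])
    then have "autocorrelation_approx (visible_points \<Gamma>) =
        (\<lambda>R. weighted_comb \<Gamma> (coincidence_density (visible_points \<Gamma>) R))" by (rule ext)
    then show "limitin weak_star (autocorrelation_approx (visible_points \<Gamma>)) (weighted_comb \<Gamma> w) at_top"
      using limitin_weighted_comb[OF summable_lattice_decay[OF lat] ev wK]
        tendsto_coincidence_density[OF lat] by (simp add: w_def)
  qed
  show "is_dirac_comb (weighted_comb \<Gamma> w) \<Gamma> w"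
  proof (rule weighted_comb_is_dirac_comb)
    show "(\<lambda>a. \<bar>w a\<bar> * (1 / (1 + norm a) ^ 4)) summable_on \<Gamma>"
      by (rule summable_on_comparison_test[OF summable_on_cmult_right[OF summable_lattice_decay[OF lat], of K]])
         (use wK in \<open>auto intro!: divide_right_mono\<close>)
  qed
  fix a assume a: "a \<in> \<Gamma>"
  show "w a = dens \<Gamma> * xi 2 * prime_prod (\<lambda>p. enat p dvd cont \<Gamma> a) (\<lambda>p. 1 + 1 / ((real p)\<^sup>2 - 2))"
    unfolding w_def by (rule visible_weight_eq[OF lat a])
  obtain C where C: "\<And>R. R \<ge> 1 + norm a \<Longrightarrow>
    \<bar>visible_weight \<Gamma> a - coincidence_density (visible_points \<Gamma>) R a\<bar> \<le> C * (1 / sqrt R)"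
    using coincidence_density_error[OF lat a] by blast
  show "(\<lambda>R. \<bar>w a - 1 / (pi * R\<^sup>2) * real (card {x \<in> visible_points \<Gamma>.
      x - a \<in> visible_points \<Gamma> \<and> norm x < R \<and> norm (x - a) < R})\<bar>) \<in> O[at_top](\<lambda>R. 1 / sqrt R)"
    unfolding w_def coincidence_density_def[symmetric]
  proof (rule bigoI)
    show "\<forall>\<^sub>F R in at_top. norm \<bar>visible_weight \<Gamma> a - coincidence_density (visible_points \<Gamma>) R a\<bar>
        \<le> C * norm (1 / sqrt R)"
      using eventually_ge_at_top[of "1 + norm a"]
    proof eventually_elim
      case (elim R)
      then have "R \<ge> 0" using norm_ge_zero[of a] by linarith
      then show ?case using C[OF elim] by simp
    qed
  qed
qed

end
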